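(* Let $A,B\in M_n$ be positive semi-definite matrices. Then for all $p\ge 2$ and all $t$ with $\frac{p-1}{2p}\le t\le\frac{p+1}{2p}$, $$\lambda\big((A\sharp_tB)^p\,(A\sharp_{1-t}B)^p\big)\prec_{\log}\lambda(AB)^p .$$
   Context: $M_n$ is the space of $n\times n$ complex matrices. For a matrix $X\in M_n$ with real eigenvalues, $\lambda(X)=(\lambda_1(X),\dots,\lambda_n(X))^t$ is the vector of eigenvalues (with multiplicity) in decreasing order; products of two positive semi-definite matrices have real nonnegative eigenvalues. For a vector $v$ with nonnegative entries, $v^p$ is the entrywise power. For vectors $x,y\in\mathbb{R}^n$ with nonnegative entries in decreasing order, $x\prec_{\log}y$ means $\prod_{i=1}^k x_i\le\prod_{i=1}^k y_i$ for $k=1,\dots,n-1$ and $\prod_{i=1}^n x_i=\prod_{i=1}^n y_i$. For positive definite $A,B$ and $0\le t\le1$, the weighted geometric mean is $A\sharp_tB=A^{\frac12}(A^{-\frac12}BA^{-\frac12})^tA^{\frac12}$; for positive semi-definite $A,B$ it is $A\sharp_tB=\lim_{\epsilon\to0^+}(A+\epsilon I_n)\sharp_t(B+\epsilon I_n)$. *)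

theory Defs
  imports
    "HOL-Computational_Algebra.Fundamental_Theorem_Algebra"
    "Jordan_Normal_Form.Schur_Decomposition"
begin

definition hermitian_mat :: "complex mat \<Rightarrow> bool" where
  "hermitian_mat A \<longleftrightarrow> square_mat A \<and> mat_adjoint A = A"

(* For Hermitian A the number v^* A v is real, so taking Re loses nothing. *)
definition psd_mat :: "complex mat \<Rightarrow> bool" where
  "psd_mat A \<longleftrightarrow> hermitian_mat A \<and>
     (\<forall>v \<in> carrier_vec (dim_row A). 0 \<le> Re ((A *\<^sub>v v) \<bullet>c v))"

definition unitary_mat :: "nat \<Rightarrow> complex mat \<Rightarrow> bool" where
  "unitary_mat n U \<longleftrightarrow> U \<in> carrier_mat n n \<and> mat_adjoint U * U = 1\<^sub>m n \<and> U * mat_adjoint U = 1\<^sub>m n"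

(* Functional calculus A^r = U diag(d_i^r) U^* for any spectral decomposition A = U diag(d_i) U^*;
   intended for positive semi-definite A (positive definite if r < 0), where all d_i are
   nonnegative (positive).  Independence of the decomposition is mat_powr_eqI below. *)
definition mat_powr :: "complex mat \<Rightarrow> real \<Rightarrow> complex mat" where
  "mat_powr A r = (THE B. \<exists>U d. unitary_mat (dim_row A) U \<and>
     A = U * mat_diag (dim_row A) (\<lambda>i. complex_of_real (d i)) * mat_adjoint U \<and>
     B = U * mat_diag (dim_row A) (\<lambda>i. complex_of_real (d i powr r)) * mat_adjoint U)"

(* The formula for the weighted geometric mean of positive definite matrices. *)
definition pd_geom_mean :: "real \<Rightarrow> complex mat \<Rightarrow> complex mat \<Rightarrow> complex mat" where
  "pd_geom_mean t A B =
     mat_powr A (1/2) * mat_powr (mat_powr A (-1/2) * B * mat_powr A (-1/2)) t * mat_powr A (1/2)"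

(* The positive semi-definite case: the limit as \<epsilon> \<rightarrow> 0+, taken entrywise. *)
definition geom_mean :: "real \<Rightarrow> complex mat \<Rightarrow> complex mat \<Rightarrow> complex mat" where
  "geom_mean t A B = mat (dim_row A) (dim_row A) (\<lambda>(i, j).
     Lim (at_right (0::real)) (\<lambda>\<epsilon>.
       pd_geom_mean t (A + complex_of_real \<epsilon> \<cdot>\<^sub>m 1\<^sub>m (dim_row A))
                      (B + complex_of_real \<epsilon> \<cdot>\<^sub>m 1\<^sub>m (dim_row A)) $$ (i, j)))"

(* For matrices all of whose eigenvalues are real; unspecified otherwise. *)
definition eigvals_desc :: "complex mat \<Rightarrow> real list" where
  "eigvals_desc X = (THE l. sorted_wrt (\<ge>) l \<and>
     image_mset complex_of_real (mset l) = proots (char_poly X))"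

(* For lists of nonnegative reals in decreasing order. *)
definition log_majorized :: "real list \<Rightarrow> real list \<Rightarrow> bool" (infix "\<prec>\<^sub>l\<^sub>o\<^sub>g" 50) where
  "x \<prec>\<^sub>l\<^sub>o\<^sub>g y \<longleftrightarrow> length x = length y \<and>
     (\<forall>k \<in> {1..<length x}. (\<Prod>i<k. x ! i) \<le> (\<Prod>i<k. y ! i)) \<and>
     (\<Prod>i<length x. x ! i) = (\<Prod>i<length y. y ! i)"

lemma eigvals_desc_eqI:
  assumes "sorted_wrt (\<ge>) l" "image_mset complex_of_real (mset l) = proots (char_poly X)"
  shows "eigvals_desc X = l"
  unfolding eigvals_desc_def
proof (rule the_equality)
  fix l' assume l': "sorted_wrt (\<ge>) l' \<and> image_mset complex_of_real (mset l') = proots (char_poly X)"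
  have "inj complex_of_real" by (simp add: inj_def)
  hence "mset l' = mset l"
    using l' assms(2) by (metis multiset.inj_map injD)
  hence "mset (rev l') = mset (rev l)" by simp
  moreover have "sorted (rev l')" "sorted (rev l)"
    using l' assms(1) by (simp_all add: sorted_wrt_rev)
  ultimately show "l' = l" by (metis properties_for_sort rev_rev_ident)
qed (use assms in simp)

lemma mat_adjoint_carrier: "U \<in> carrier_mat n m \<Longrightarrow> mat_adjoint U \<in> carrier_mat m n"
  unfolding mat_adjoint_def by auto

lemma mat_powr_eqI:
  assumes U: "unitary_mat n U"
    and A: "A = U * mat_diag n (\<lambda>i. complex_of_real (d i)) * mat_adjoint U"
  shows "mat_powr A r = U * mat_diag n (\<lambda>i. complex_of_real (d i powr r)) * mat_adjoint U"
proof -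
  let ?D = "\<lambda>d. mat_diag n (\<lambda>i. complex_of_real (d i))"
  have Uc: "U \<in> carrier_mat n n" "mat_adjoint U \<in> carrier_mat n n"
    using U mat_adjoint_carrier[of U n n] by (auto simp: unitary_mat_def)
  have n: "dim_row A = n" using A Uc by simp
  show ?thesis unfolding mat_powr_def n
  proof (rule the_equality)
    fix B assume "\<exists>V e. unitary_mat n V \<and> A = V * ?D e * mat_adjoint V \<and>
                        B = V * ?D (\<lambda>i. e i powr r) * mat_adjoint V"
    then obtain V e where V: "unitary_mat n V" and AV: "A = V * ?D e * mat_adjoint V"
      and B: "B = V * ?D (\<lambda>i. e i powr r) * mat_adjoint V" by blast
    have Vc: "V \<in> carrier_mat n n" "mat_adjoint V \<in> carrier_mat n n"
      using V mat_adjoint_carrier[of V n n] by (auto simp: unitary_mat_def)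
    define W where "W = mat_adjoint V * U"
    have Wc: "W \<in> carrier_mat n n" using Uc Vc by (simp add: W_def)
    have Dc: "?D f \<in> carrier_mat n n" for f by simp
    have mc: "X * Y \<in> carrier_mat n n" if "X \<in> carrier_mat n n" "Y \<in> carrier_mat n n"
      for X Y :: "complex mat" using that by simp
    have VV: "mat_adjoint V * V = 1\<^sub>m n" "V * mat_adjoint V = 1\<^sub>m n"
      and UU: "mat_adjoint U * U = 1\<^sub>m n" "U * mat_adjoint U = 1\<^sub>m n"
      using U V by (auto simp: unitary_mat_def)
    have VU: "mat_adjoint V * (V * X) = X" "mat_adjoint U * (U * X) = X"
      "V * (mat_adjoint V * X) = X" if "X \<in> carrier_mat n n" for X
      using that Uc Vc VV UU
      by (simp_all add: assoc_mult_mat[symmetric, where n\<^sub>1=n and n\<^sub>2=n and n\<^sub>3=n and n\<^sub>4=n])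
    note assoc = assoc_mult_mat[where n\<^sub>1=n and n\<^sub>2=n and n\<^sub>3=n and n\<^sub>4=n]
    have "mat_adjoint V * A * U = W * ?D d"
      using Uc Vc Dc UU unfolding A W_def by (simp add: assoc VU mc right_mult_one_mat[OF Dc] right_mult_one_mat[where nr=n])
    moreover have "mat_adjoint V * A * U = ?D e * W"
      using Uc Vc Dc VV unfolding AV W_def by (simp add: assoc VU mc right_mult_one_mat[OF Dc] right_mult_one_mat[where nr=n])
    ultimately have "W * ?D d = ?D e * W" by simp
    have *: "W $$ (i,j) * complex_of_real (d j) = complex_of_real (e i) * W $$ (i,j)"
      if "i < n" "j < n" for i j
    proof -
      have "(W * ?D d) $$ (i,j) = (?D e * W) $$ (i,j)"
        using \<open>W * ?D d = ?D e * W\<close> by simp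
      thus ?thesis
        using that by (simp add: mat_diag_mult_right[OF Wc] mat_diag_mult_left[OF Wc])
    qed
    have "W * ?D (\<lambda>i. d i powr r) = ?D (\<lambda>i. e i powr r) * W"
      unfolding mat_diag_mult_right[OF Wc] mat_diag_mult_left[OF Wc]
    proof (rule cong_mat, goal_cases)
      case (3 i j)
      then show ?case using *[of i j] by (cases "W $$ (i,j) = 0") auto
    qed auto
    hence "V * (W * ?D (\<lambda>i. d i powr r)) * mat_adjoint U = V * (?D (\<lambda>i. e i powr r) * W) * mat_adjoint U"
      by simp
    moreover have "V * (W * ?D (\<lambda>i. d i powr r)) * mat_adjoint U = U * ?D (\<lambda>i. d i powr r) * mat_adjoint U"
      using Uc Vc Dc unfolding W_def by (simp add: assoc VU mc right_mult_one_mat[OF Dc] right_mult_one_mat[where nr=n])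
    moreover have "V * (?D (\<lambda>i. e i powr r) * W) * mat_adjoint U = B"
      using Uc Vc Dc UU unfolding B W_def by (simp add: assoc VU mc right_mult_one_mat[OF Dc] right_mult_one_mat[where nr=n])
    ultimately show "B = U * ?D (\<lambda>i. d i powr r) * mat_adjoint U" by simp
  qed (use U A in blast)
qed

end

theory Submission
  imports Defs
begin

text \<open>
The eigenvalues of a product \<open>P Q\<close> of positive semidefinite matrices are those of the
Hermitian matrix \<open>Q\<^sup>1\<^sup>/\<^sup>2 P Q\<^sup>1\<^sup>/\<^sup>2\<close>, so a bound on the largest one is an inequality in the
Loewner order. The proof establishes such an inequality for positive definite matrices, lifts it
from the largest eigenvalue to products of eigenvalues, and extends it to semidefinite matrices.

\<^emph>\<open>The largest eigenvalue.\<close> Let \<open>A\<close> and \<open>B\<close> be positive definite with \<open>\<lambda>\<^sub>1(AB) \<le> 1\<close>, that is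
\<open>B \<le> A\<^sup>-\<^sup>1\<close>, and let \<open>t \<le> 1/2\<close>. Put \<open>C = A^(-1/2) B A^(-1/2)\<close>, so that \<open>C \<le> A\<^sup>-\<^sup>2\<close>, and
\<open>K = A^(1/2) C^(t/2)\<close>, so that the geometric mean \<open>A #\<^sub>t B\<close> is \<open>W = K K*\<close>; let \<open>Z = K* K\<close>. From
\<open>W^(a+1) = K Z^a K*\<close> and \<open>Z^(a+1) = K* W^a K\<close>, upper bounds for \<open>W^a\<close> by a power of \<open>A\<close> and for
\<open>Z^a\<close> by a power of \<open>C\<close> imply the corresponding bounds with \<open>a + 1\<close> in place of \<open>a\<close>, at the price
of one use of the Loewner-Heinz inequality. Its exponent stays in \<open>[0, 1]\<close> up to the power \<open>p\<close>
precisely because \<open>p (1 - 2t) \<le> 1\<close>. The outcome, an inequality of Furuta type, is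
\<open>(A #\<^sub>t B)^p \<le> A^\<theta>\<close> with \<open>\<theta> = p (1 - 2t)\<close> (lemmas \<open>furuta_bootstrap\<close> and
\<open>pd_geom_mean_powr_le\<close>). Since \<open>A #\<^bsub>1-t\<^esub> B = B #\<^sub>t A\<close>, also \<open>(A #\<^bsub>1-t\<^esub> B)^p \<le> B^\<theta>\<close>. Finally
\<open>\<theta> \<le> 1\<close> gives \<open>B^\<theta> \<le> A^(-\<theta>)\<close>, so the first power is at most the inverse of the second, which
says that their product has largest eigenvalue at most 1. Scaling \<open>A\<close> removes the normalisation
(\<open>geom_mean_norm_bound\<close>). The hypothesis on \<open>t\<close> reads \<open>p \<bar>1 - 2t\<bar> \<le> 1\<close>, and \<open>t > 1/2\<close> reduces to
\<open>t < 1/2\<close> by exchanging the two factors.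

\<^emph>\<open>Products of eigenvalues.\<close> The \<open>k\<close>-th compound matrix, the matrix of all \<open>k \<times> k\<close> minors, is
multiplicative by the Cauchy-Binet formula. It therefore commutes with adjoints, real powers and
geometric means, while the largest eigenvalue of the compound of a positive semidefinite matrix is
the product of its \<open>k\<close> largest eigenvalues. Applied to compounds, the bound on \<open>\<lambda>\<^sub>1\<close> is the
inequality between partial products. Equality of the full products is an identity between
determinants.

\<^emph>\<open>Semidefinite matrices.\<close> Here \<open>A\<close> and \<open>B\<close> are replaced by \<open>A + \<epsilon>I\<close> and \<open>B + \<epsilon>I\<close>. The geometric
mean is monotone in both arguments, so it converges as \<open>\<epsilon>\<close> decreases to 0. Real powers are
continuous on positive semidefinite matrices, because \<open>X \<le> Y + \<delta>I\<close> implies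
\<open>X^r \<le> Y^r + \<delta>^r I\<close> for \<open>r \<le> 1\<close>, again by Loewner-Heinz. Hence all bounds pass to the limit.
\<close>

section \<open>Adjoints and quadratic forms\<close>

abbreviation adjoint_mat :: "complex mat \<Rightarrow> complex mat" ("_\<^sup>\<dagger>" [1000] 999)
  where "A\<^sup>\<dagger> \<equiv> mat_adjoint A"

lemma adjoint_dim [simp]: "dim_row (A\<^sup>\<dagger>) = dim_col A" "dim_col (A\<^sup>\<dagger>) = dim_row A"
  by (auto simp: mat_adjoint_def)

lemma adjoint_carrier [simp]: "A \<in> carrier_mat n m \<Longrightarrow> A\<^sup>\<dagger> \<in> carrier_mat m n"
  by (rule mat_adjoint_carrier)

lemma adjoint_index [simp]:
  "i < dim_col A \<Longrightarrow> j < dim_row A \<Longrightarrow> A\<^sup>\<dagger> $$ (i, j) = cnj (A $$ (j, i))"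
  by (simp add: mat_adjoint_def mat_of_rows_index)

lemma adjoint_adjoint [simp]: "(A\<^sup>\<dagger>)\<^sup>\<dagger> = A"
  by (rule eq_matI) auto

lemma adjoint_one [simp]: "(1\<^sub>m n :: complex mat)\<^sup>\<dagger> = 1\<^sub>m n"
  by (rule eq_matI) auto

lemma adjoint_mult:
  "A \<in> carrier_mat n m \<Longrightarrow> B \<in> carrier_mat m l \<Longrightarrow> (A * B)\<^sup>\<dagger> = B\<^sup>\<dagger> * A\<^sup>\<dagger>"
  by (rule eq_matI) (auto simp: scalar_prod_def intro!: sum.cong)

lemma adjoint_real_diag [simp]:
  "(mat_diag n (\<lambda>i. complex_of_real (d i)))\<^sup>\<dagger> = mat_diag n (\<lambda>i. complex_of_real (d i))"
  by (rule eq_matI) (auto simp: mat_diag_def)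

lemma cscalar_prod_adjoint:
  assumes "A \<in> carrier_mat n m" "v \<in> carrier_vec m" "w \<in> carrier_vec n"
  shows "(A *\<^sub>v v) \<bullet>c w = v \<bullet>c (A\<^sup>\<dagger> *\<^sub>v w)"
proof -
  have "(A *\<^sub>v v) \<bullet>c w = (\<Sum>i<n. \<Sum>j<m. A $$ (i,j) * v $ j * cnj (w $ i))"
    using assms by (auto simp: scalar_prod_def sum_distrib_right lessThan_atLeast0 intro!: sum.cong)
  also have "\<dots> = (\<Sum>j<m. \<Sum>i<n. A $$ (i,j) * v $ j * cnj (w $ i))"
    by (rule sum.swap)
  also have "\<dots> = v \<bullet>c (A\<^sup>\<dagger> *\<^sub>v w)"
    using assms
    by (auto simp: scalar_prod_def sum_distrib_left lessThan_atLeast0 algebra_simps intro!: sum.cong)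
  finally show ?thesis .
qed

definition qform :: "complex mat \<Rightarrow> complex vec \<Rightarrow> real" where
  "qform A v = Re ((A *\<^sub>v v) \<bullet>c v)"

definition loewner_le :: "nat \<Rightarrow> complex mat \<Rightarrow> complex mat \<Rightarrow> bool" where
  "loewner_le n A B \<longleftrightarrow> (\<forall>v \<in> carrier_vec n. qform A v \<le> qform B v)"

lemma loewner_le_refl [simp]: "loewner_le n A A"
  by (simp add: loewner_le_def)

lemma loewner_le_trans [trans]: "loewner_le n A B \<Longrightarrow> loewner_le n B C \<Longrightarrow> loewner_le n A C"
  by (force simp: loewner_le_def)

lemma cscalar_prod_self: "v \<in> carrier_vec n \<Longrightarrow> v \<bullet>c v = complex_of_real (\<Sum>i<n. (cmod (v $ i))\<^sup>2)"
  by (simp add: scalar_prod_def lessThan_atLeast0 complex_norm_square del: of_real_power)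

lemma qform_congr:
  assumes "A \<in> carrier_mat n n" "K \<in> carrier_mat n m" "v \<in> carrier_vec m"
  shows "qform (K\<^sup>\<dagger> * A * K) v = qform A (K *\<^sub>v v)"
proof -
  have 1: "K\<^sup>\<dagger> * A \<in> carrier_mat m n" "K *\<^sub>v v \<in> carrier_vec n" using assms by auto
  have "K\<^sup>\<dagger> * A * K *\<^sub>v v = K\<^sup>\<dagger> * A *\<^sub>v (K *\<^sub>v v)"
    by (rule assoc_mult_mat_vec[OF 1(1) assms(2,3)])
  also have "\<dots> = K\<^sup>\<dagger> *\<^sub>v (A *\<^sub>v (K *\<^sub>v v))"
    by (rule assoc_mult_mat_vec[OF _ assms(1) 1(2)]) (use assms in auto)
  finally have "K\<^sup>\<dagger> * A * K *\<^sub>v v = K\<^sup>\<dagger> *\<^sub>v (A *\<^sub>v (K *\<^sub>v v))" .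
  thus ?thesis
    using assms cscalar_prod_adjoint[of "K\<^sup>\<dagger>" m n "A *\<^sub>v (K *\<^sub>v v)" v]
    by (simp add: qform_def)
qed

lemma loewner_le_congr:
  assumes "loewner_le n A B" "A \<in> carrier_mat n n" "B \<in> carrier_mat n n" "K \<in> carrier_mat n m"
  shows "loewner_le m (K\<^sup>\<dagger> * A * K) (K\<^sup>\<dagger> * B * K)"
  using assms by (auto simp: loewner_le_def qform_congr)

lemma qform_add:
  "A \<in> carrier_mat n n \<Longrightarrow> B \<in> carrier_mat n n \<Longrightarrow> v \<in> carrier_vec n \<Longrightarrow>
    qform (A + B) v = qform A v + qform B v"
  by (simp add: qform_def add_mult_distrib_mat_vec[of _ n n] add_scalar_prod_distrib[of _ n])

lemma smult_mat_vec:
  "A \<in> carrier_mat n m \<Longrightarrow> v \<in> carrier_vec m \<Longrightarrow> (c \<cdot>\<^sub>m A) *\<^sub>v v = c \<cdot>\<^sub>v (A *\<^sub>v v)"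
  by (rule eq_vecI) (auto simp: scalar_prod_def sum_distrib_left algebra_simps)

lemma qform_smult:
  "A \<in> carrier_mat n n \<Longrightarrow> v \<in> carrier_vec n \<Longrightarrow>
    qform (complex_of_real c \<cdot>\<^sub>m A) v = c * qform A v"
  by (simp add: qform_def smult_mat_vec[of _ n n])

lemma hermitian_mat_iff: "A \<in> carrier_mat n n \<Longrightarrow> hermitian_mat A \<longleftrightarrow> A\<^sup>\<dagger> = A"
  by (auto simp: hermitian_mat_def)

lemma psd_mat_iff: "A \<in> carrier_mat n n \<Longrightarrow> psd_mat A \<longleftrightarrow> A\<^sup>\<dagger> = A \<and> (\<forall>v\<in>carrier_vec n. 0 \<le> qform A v)"
  by (auto simp: psd_mat_def hermitian_mat_iff qform_def)

lemma unitary_matD: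
  assumes "unitary_mat n U"
  shows "U \<in> carrier_mat n n" "U\<^sup>\<dagger> * U = 1\<^sub>m n" "U * U\<^sup>\<dagger> = 1\<^sub>m n"
  using assms by (auto simp: unitary_mat_def)

lemma unitary_matI: 
  assumes "U \<in> carrier_mat n n" "U\<^sup>\<dagger> * U = 1\<^sub>m n" shows "unitary_mat n U"
  using assms mat_mult_left_right_inverse[of "U\<^sup>\<dagger>" n U] by (simp add: unitary_mat_def)

lemma mult_carrier_square [simp]:
  "X \<in> carrier_mat n n \<Longrightarrow> Y \<in> carrier_mat n n \<Longrightarrow> X * Y \<in> carrier_mat n n"
  by simp

lemma unitary_mult:
  assumes "unitary_mat n U" "unitary_mat n V" shows "unitary_mat n (U * V)"
proof (rule unitary_matI)
  note c = unitary_matD[OF assms(1)] unitary_matD[OF assms(2)]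
  show "U * V \<in> carrier_mat n n" using c by simp
  have "(U * V)\<^sup>\<dagger> * (U * V) = V\<^sup>\<dagger> * (U\<^sup>\<dagger> * U) * V"
    using c(1,4) by (simp add: adjoint_mult[of _ n n _ n] assoc_mult_mat[of _ n n _ n _ n])
  thus "(U * V)\<^sup>\<dagger> * (U * V) = 1\<^sub>m n" using c by simp
qed

section \<open>The spectral theorem\<close>

text \<open>
Gram-Schmidt, started at an eigenvector, yields an orthogonal basis; dividing each vector by its
length turns it into the columns of a unitary matrix.
\<close>

lemma unitary_first_column:
  fixes A :: "complex mat"
  assumes A: "A \<in> carrier_mat n n" and n: "n \<noteq> 0" and e: "eigenvalue A e"
  obtains U where "unitary_mat n U" "col (U\<^sup>\<dagger> * A * U) 0 = vec n (\<lambda>i. if i = 0 then e else 0)"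
proof -
  obtain v where ev: "eigenvector A v e" using e by (auto simp: eigenvalue_def)
  hence v: "v \<in> carrier_vec n" and v0: "v \<noteq> 0\<^sub>v n" and Av: "A *\<^sub>v v = e \<cdot>\<^sub>v v"
    using A by (auto simp: eigenvector_def)
  interpret cof_vec_space n "TYPE(complex)" .
  define b where "b = basis_completion v"
  define ws where "ws = gram_schmidt n b"
  from basis_completion[OF v v0, folded b_def]
  have dist_b: "distinct b" and indep: "\<not> lin_dep (set b)" and b: "set b \<subseteq> carrier_vec n"
    and hdb: "hd b = v" and len_b: "length b = n" by auto
  from hdb len_b n obtain vs where bv: "b = v # vs" by (cases b, auto)
  from gram_schmidt_result[OF b dist_b indep refl, folded ws_def]
  have ws: "set ws \<subseteq> carrier_vec n" "corthogonal ws" "length ws = n" by (auto simp: len_b)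
  have hdws: "hd ws = v"
    using gram_schmidt_hd[OF v, of vs, folded bv] unfolding ws_def .
  hence ws0: "ws ! 0 = v" using ws(3) n by (metis hd_conv_nth length_0_conv)
  define c where "c i = 1 / sqrt (Re (ws ! i \<bullet>c ws ! i))" for i
  define U where "U = mat_of_cols n ws * mat_diag n (\<lambda>i. complex_of_real (c i))"
  have "mat_of_cols n ws \<in> carrier_mat n n" using ws(3) by auto
  hence U: "U \<in> carrier_mat n n" by (auto simp: U_def)
  have wsi: "ws ! i \<in> carrier_vec n" if "i < n" for i using ws that by auto
  have colU: "col U i = complex_of_real (c i) \<cdot>\<^sub>v ws ! i" if "i < n" for i
    using that ws wsi[OF that] unfolding U_def
    by (subst mat_diag_mult_right[of _ n]) (auto simp: mat_of_cols_index)
  have nz: "Re (ws ! i \<bullet>c ws ! i) > 0" if "i < n" for i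
  proof -
    have "ws ! i \<bullet>c ws ! i \<noteq> 0" using corthogonalD[OF ws(2)] that ws(3) by auto
    moreover have "Re (ws ! i \<bullet>c ws ! i) \<ge> 0" "Im (ws ! i \<bullet>c ws ! i) = 0"
      using cscalar_prod_self[OF wsi[OF that]] by (simp_all add: sum_nonneg)
    ultimately show ?thesis by (metis complex_eq_iff le_less zero_complex.sel)
  qed
  have orth: "col U j \<bullet>c col U i = (if i = j then 1 else 0)" if "i < n" "j < n" for i j
  proof -
    have "col U j \<bullet>c col U i = complex_of_real (c j * c i) * (ws ! j \<bullet>c ws ! i)"
      using that wsi
      by (simp add: colU conjugate_smult_vec smult_scalar_prod_distrib[of _ n] scalar_prod_smult_distrib[of _ n])
    also have "\<dots> = (if i = j then 1 else 0)"
    proof (cases "i = j")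
      case True
      have "ws ! i \<bullet>c ws ! i = complex_of_real (Re (ws ! i \<bullet>c ws ! i))"
        using cscalar_prod_self[OF wsi[OF that(1)]] by simp
      moreover have "c i * c i * Re (ws ! i \<bullet>c ws ! i) = 1"
        using nz[OF that(1)] by (simp add: c_def)
      ultimately show ?thesis using True by (metis of_real_1 of_real_mult)
    next
      case False
      thus ?thesis using corthogonalD[OF ws(2), of j i] that ws(3) by simp
    qed
    finally show ?thesis .
  qed
  have adj: "(U\<^sup>\<dagger> * X) $$ (i, j) = col X j \<bullet>c col U i"
    if "i < n" "j < n" "X \<in> carrier_mat n n" for i j X
    using that U by (auto simp: scalar_prod_def algebra_simps intro!: sum.cong)
  have uni: "unitary_mat n U"
  proof (rule unitary_matI[OF U], rule eq_matI)
    fix i j assume "i < dim_row (1\<^sub>m n :: complex mat)" "j < dim_col (1\<^sub>m n :: complex mat)"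
    thus "(U\<^sup>\<dagger> * U) $$ (i, j) = 1\<^sub>m n $$ (i, j)" using adj[OF _ _ U] orth by simp
  qed (use U in auto)
  have "col (U\<^sup>\<dagger> * A * U) 0 = vec n (\<lambda>i. if i = 0 then e else 0)"
  proof (rule eq_vecI)
    fix i assume "i < dim_vec (vec n (\<lambda>i. if i = 0 then e else 0))"
    hence i: "i < n" by simp
    have "col (A * U) 0 = A *\<^sub>v col U 0" using A U n by auto
    also have "\<dots> = e \<cdot>\<^sub>v col U 0"
      using n v Av A by (simp add: colU ws0 mult_mat_vec[of _ n n] smult_smult_assoc mult.commute)
    finally have AU: "col (A * U) 0 = e \<cdot>\<^sub>v col U 0" .
    have "col (U\<^sup>\<dagger> * A * U) 0 $ i = (U\<^sup>\<dagger> * (A * U)) $$ (i, 0)"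
      using i n U A by (simp add: assoc_mult_mat[of _ n n _ n _ n])
    also have "\<dots> = (e \<cdot>\<^sub>v col U 0) \<bullet>c col U i"
      using adj[of i 0 "A * U"] i n A U AU by simp
    also have "\<dots> = (if i = 0 then e else 0)"
      using orth[of i 0] i n U by auto
    finally show "col (U\<^sup>\<dagger> * A * U) 0 $ i = vec n (\<lambda>i. if i = 0 then e else 0) $ i" using i by simp
  qed (use U A in auto)
  thus ?thesis using uni that by blast
qed

text \<open>
Induction on the list of roots of the characteristic polynomial. In the unitary basis of the
previous lemma the first column is \<open>(e, 0, \<dots>, 0)\<close>; the matrix being Hermitian, so is the first row,
and the remaining block is again Hermitian. The eigenvalues appear on the diagonal in the order in
which they are listed, so that a sorted list gives a sorted diagonal.
\<close>

lemma spectral_induct: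
  fixes A :: "complex mat"
  assumes "A \<in> carrier_mat n n" "A\<^sup>\<dagger> = A" "char_poly A = (\<Prod>e\<leftarrow>es. [:- e, 1:])"
  shows "\<exists>U. unitary_mat n U \<and> A = U * mat_diag n (\<lambda>i. es ! i) * U\<^sup>\<dagger>"
  using assms
proof (induction es arbitrary: n A)
  case Nil
  hence "n = 0" using degree_monic_char_poly[of A n] by simp
  moreover have "unitary_mat 0 (1\<^sub>m 0)" by (simp add: unitary_mat_def)
  ultimately show ?case using Nil by (intro exI[of _ "1\<^sub>m 0"]) auto
next
  case (Cons e es)
  note A = Cons.prems(1)
  have deg: "degree (char_poly A) = n" using degree_monic_char_poly[OF A] by simp
  have "n \<noteq> 0" 
  proof
    assume "n = 0"
    hence "char_poly A = 1" using deg degree_monic_char_poly[OF A] monic_degree_0[of "char_poly A"] by auto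
    hence "[:-e, 1:] dvd 1" using Cons.prems(3) by (metis dvdI list.simps(9) prod_list.Cons)
    thus False by (simp add: is_unit_iff_degree)
  qed
  then obtain m where n: "n = Suc m" by (cases n) auto
  have "eigenvalue A e" unfolding eigenvalue_root_char_poly[OF A] Cons.prems(3) by simp
  then obtain W where W: "unitary_mat n W"
    and col0: "col (W\<^sup>\<dagger> * A * W) 0 = vec n (\<lambda>i. if i = 0 then e else 0)"
    using unitary_first_column[OF A \<open>n \<noteq> 0\<close>] by blast
  note Wc = unitary_matD[OF W]
  define B where "B = W\<^sup>\<dagger> * A * W"
  have B: "B \<in> carrier_mat n n" using A Wc by (simp add: B_def)
  have Bh: "B\<^sup>\<dagger> = B" using A Wc(1) Cons.prems(2) unfolding B_def
    by (simp add: adjoint_mult[of _ n n _ n] assoc_mult_mat[of _ n n _ n _ n])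
  have B0: "B $$ (i, 0) = (if i = 0 then e else 0)" if "i < n" for i
  proof -
    have "B $$ (i, 0) = col B 0 $ i" using that B n by simp
    thus ?thesis using that by (simp add: col0[folded B_def])
  qed
  have B0': "B $$ (0, i) = (if i = 0 then e else 0)" if "i < n" for i
  proof (cases "i = 0")
    case False
    have "B $$ (0, i) = B\<^sup>\<dagger> $$ (0, i)" by (simp add: Bh)
    also have "\<dots> = cnj (B $$ (i, 0))" using that B n by simp
    finally show ?thesis using B0[OF that] False by simp
  qed (use B0 n in simp)
  define B3 where "B3 = mat m m (\<lambda>(i,j). B $$ (Suc i, Suc j))"
  have B3: "B3 \<in> carrier_mat m m" by (simp add: B3_def)
  have B3h: "B3\<^sup>\<dagger> = B3"
  proof (rule eq_matI)
    fix i j assume "i < dim_row B3" "j < dim_col B3"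
    hence ij: "i < m" "j < m" using B3 by auto
    have "B $$ (Suc i, Suc j) = B\<^sup>\<dagger> $$ (Suc i, Suc j)" by (simp add: Bh)
    also have "\<dots> = cnj (B $$ (Suc j, Suc i))" using ij B n by simp
    finally show "B3\<^sup>\<dagger> $$ (i, j) = B3 $$ (i, j)" using ij by (simp add: B3_def)
  qed (simp_all add: B3_def)
  have blk: "B = four_block_mat (mat 1 1 (\<lambda>_. e)) (0\<^sub>m 1 m) (0\<^sub>m m 1) B3"
    by (rule eq_matI) (use B n B0 B0' in \<open>auto simp: B3_def\<close>)
  have sim: "similar_mat A B"
  proof -
    have "similar_mat_wit A B W (W\<^sup>\<dagger>)"
    proof (rule similar_mat_witI[of _ _ n])
      have "W * B * W\<^sup>\<dagger> = (W * W\<^sup>\<dagger>) * A * (W * W\<^sup>\<dagger>)"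
        unfolding B_def using A Wc(1) by (simp add: assoc_mult_mat[of _ n n _ n _ n])
      thus "A = W * B * W\<^sup>\<dagger>" using Wc A by simp
    qed (use Wc A B in auto)
    thus ?thesis by (auto simp: similar_mat_def)
  qed
  have "char_poly A = char_poly (mat 1 1 (\<lambda>_. e)) * char_poly B3"
    using char_poly_similar[OF sim] blk
      char_poly_four_block_zeros_col[of "mat 1 1 (\<lambda>_. e)" "0\<^sub>m 1 m" m B3] B3 by simp
  also have "char_poly (mat 1 1 (\<lambda>_. e)) = [: -e,1 :]"
    by (simp add: char_poly_defs det_def sign_def)
  finally have "[:- e, 1:] * char_poly B3 = [:- e, 1:] * (\<Prod>e\<leftarrow>es. [:- e, 1:])"
    unfolding Cons.prems(3) by simp
  hence "char_poly B3 = (\<Prod>e\<leftarrow>es. [:- e, 1:])"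
    by (subst (asm) mult_left_cancel) auto
  from Cons.IH[OF B3 B3h this] obtain V where V: "unitary_mat m V"
    and B3V: "B3 = V * mat_diag m (\<lambda>i. es ! i) * V\<^sup>\<dagger>" by blast
  note Vc = unitary_matD[OF V]
  define V' where "V' = four_block_mat (1\<^sub>m 1) (0\<^sub>m 1 m) (0\<^sub>m m 1) V"
  have V'c: "V' \<in> carrier_mat n n" using Vc n by (auto simp: V'_def)
  have V'adj: "V'\<^sup>\<dagger> = four_block_mat (1\<^sub>m 1) (0\<^sub>m 1 m) (0\<^sub>m m 1) (V\<^sup>\<dagger>)"
    by (rule eq_matI) (use Vc in \<open>auto simp: V'_def\<close>)
  have one: "1\<^sub>m n = four_block_mat (1\<^sub>m 1) (0\<^sub>m 1 m) (0\<^sub>m m 1) (1\<^sub>m m :: complex mat)"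
    by (rule eq_matI) (auto simp: n)
  have V': "unitary_mat n V'"
    by (rule unitary_matI[OF V'c], unfold V'adj, unfold V'_def)
       (use Vc n in \<open>simp add: mult_four_block_mat[of _ 1 1 _ m _ m _ _ 1 _ m] one\<close>)
  have D: "mat_diag n (\<lambda>i. (e # es) ! i)
      = four_block_mat (mat 1 1 (\<lambda>_. e)) (0\<^sub>m 1 m) (0\<^sub>m m 1) (mat_diag m (\<lambda>i. es ! i))"
    by (rule eq_matI) (auto simp: n mat_diag_def nth_Cons')
  have m1: "mat 1 1 (\<lambda>_. e) * 1\<^sub>m 1 = mat 1 1 (\<lambda>_. e)" "1\<^sub>m 1 * mat 1 1 (\<lambda>_. e) = mat 1 1 (\<lambda>_. e)" 
    by (auto intro!: right_mult_one_mat left_mult_one_mat)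
  have z: "0\<^sub>m k m * mat_diag m (\<lambda>i. es ! i) = 0\<^sub>m k m" "0\<^sub>m k m * V\<^sup>\<dagger> = 0\<^sub>m k m"
    "V * mat_diag m (\<lambda>i. es ! i) * 0\<^sub>m m k = 0\<^sub>m m k" for k
    using Vc(1) by (auto intro!: left_mult_zero_mat right_mult_zero_mat[of _ m m])
  have "V' * mat_diag n (\<lambda>i. (e # es) ! i) * V'\<^sup>\<dagger> = B"
    unfolding D V'adj blk B3V unfolding V'_def using Vc
    by (simp add: mult_four_block_mat[of _ 1 1 _ m _ m _ _ 1 _ m] m1 z)
  hence "A = W * (V' * mat_diag n (\<lambda>i. (e # es) ! i) * V'\<^sup>\<dagger>) * W\<^sup>\<dagger>"
  proof -
    assume *: "V' * mat_diag n (\<lambda>i. (e # es) ! i) * V'\<^sup>\<dagger> = B"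
    have "W * B * W\<^sup>\<dagger> = (W * W\<^sup>\<dagger>) * A * (W * W\<^sup>\<dagger>)"
      unfolding B_def using A Wc(1) by (simp add: assoc_mult_mat[of _ n n _ n _ n])
    thus ?thesis using Wc A * by simp
  qed
  also have "\<dots> = (W * V') * mat_diag n (\<lambda>i. (e # es) ! i) * (W * V')\<^sup>\<dagger>"
    using Wc(1) V'c by (simp add: adjoint_mult[of _ n n _ n] assoc_mult_mat[of _ n n _ n _ n])
  finally show ?case using unitary_mult[OF W V'] by blast
qed

section \<open>Spectral calculus of Hermitian matrices\<close>

text \<open>
Unlike \<open>hermitian_mat\<close> and \<open>psd_mat\<close>, the predicates \<open>herm\<close>, \<open>psd\<close> and \<open>pd\<close> fix the dimension.
\<close>

definition herm :: "nat \<Rightarrow> complex mat \<Rightarrow> bool" where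
  "herm n A \<longleftrightarrow> A \<in> carrier_mat n n \<and> A\<^sup>\<dagger> = A"

definition psd :: "nat \<Rightarrow> complex mat \<Rightarrow> bool" where
  "psd n A \<longleftrightarrow> herm n A \<and> (\<forall>v\<in>carrier_vec n. 0 \<le> qform A v)"

definition pd :: "nat \<Rightarrow> complex mat \<Rightarrow> bool" where
  "pd n A \<longleftrightarrow> herm n A \<and> (\<forall>v\<in>carrier_vec n. v \<noteq> 0\<^sub>v n \<longrightarrow> 0 < qform A v)"

definition spectral :: "nat \<Rightarrow> complex mat \<Rightarrow> (nat \<Rightarrow> real) \<Rightarrow> complex mat" where
  "spectral n U d = U * mat_diag n (\<lambda>i. complex_of_real (d i)) * U\<^sup>\<dagger>"

lemma hermD: "herm n A \<Longrightarrow> A \<in> carrier_mat n n" "herm n A \<Longrightarrow> A\<^sup>\<dagger> = A"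
  by (auto simp: herm_def)

lemma psd_herm: "psd n A \<Longrightarrow> herm n A"
  by (simp add: psd_def)

lemma mult_vec_square [simp]: "X \<in> carrier_mat n n \<Longrightarrow> v \<in> carrier_vec n \<Longrightarrow> X *\<^sub>v v \<in> carrier_vec n"
  by simp

lemma mult_mat_zero_vec: "X \<in> carrier_mat n m \<Longrightarrow> X *\<^sub>v 0\<^sub>v m = 0\<^sub>v n"
  by (rule eq_vecI) auto

lemma pd_psd:
  assumes "pd n A" shows "psd n A"
  unfolding psd_def
proof (intro conjI ballI)
  fix v :: "complex vec" assume v: "v \<in> carrier_vec n"
  have "qform A (0\<^sub>v n) = 0"
    using assms by (simp add: pd_def herm_def qform_def mult_mat_zero_vec)
  thus "0 \<le> qform A v" using assms v by (cases "v = 0\<^sub>v n") (auto simp: pd_def less_imp_le)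
qed (use assms in \<open>simp add: pd_def\<close>)

lemma pd_herm: "pd n A \<Longrightarrow> herm n A"
  by (simp add: pd_def)

lemma psd_carrier: "psd n A \<Longrightarrow> A \<in> carrier_mat n n"
  by (simp add: psd_def herm_def)

lemma pd_carrier: "pd n A \<Longrightarrow> A \<in> carrier_mat n n"
  by (simp add: pd_def herm_def)

lemma psd_qform_nonneg: "psd n A \<Longrightarrow> v \<in> carrier_vec n \<Longrightarrow> 0 \<le> qform A v"
  by (simp add: psd_def)

lemma spectral_carrier [simp]: "unitary_mat n U \<Longrightarrow> spectral n U d \<in> carrier_mat n n"
  by (simp add: spectral_def unitary_matD)

lemma spectral_cong: "(\<And>i. i < n \<Longrightarrow> d i = e i) \<Longrightarrow> spectral n U d = spectral n U e"
proof -
  assume *: "\<And>i. i < n \<Longrightarrow> d i = e i"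
  have "mat_diag n (\<lambda>i. complex_of_real (d i)) = mat_diag n (\<lambda>i. complex_of_real (e i))"
    by (rule eq_matI) (auto simp: mat_diag_def *)
  thus ?thesis by (simp add: spectral_def)
qed

lemma spectral_mult:
  assumes U: "unitary_mat n U"
  shows "spectral n U d * spectral n U e = spectral n U (\<lambda>i. d i * e i)"
proof -
  note c = unitary_matD[OF U]
  let ?D = "mat_diag n (\<lambda>i. complex_of_real (d i))" and ?E = "mat_diag n (\<lambda>i. complex_of_real (e i))"
  have "spectral n U d * spectral n U e = U * (?D * (U\<^sup>\<dagger> * U) * ?E) * U\<^sup>\<dagger>"
    unfolding spectral_def using c(1) by (simp add: assoc_mult_mat[of _ n n _ n _ n] del: mat_diag_diag)
  also have "?D * (U\<^sup>\<dagger> * U) * ?E = mat_diag n (\<lambda>i. complex_of_real (d i * e i))"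
    by (simp add: c right_mult_one_mat[of _ n])
  finally show ?thesis by (simp add: spectral_def)
qed

lemma spectral_add:
  assumes U: "unitary_mat n U"
  shows "spectral n U d + spectral n U e = spectral n U (\<lambda>i. d i + e i)"
proof -
  note c = unitary_matD[OF U]
  have "mat_diag n (\<lambda>i. complex_of_real (d i + e i))
      = mat_diag n (\<lambda>i. complex_of_real (d i)) + mat_diag n (\<lambda>i. complex_of_real (e i))"
    by (rule eq_matI) (auto simp: mat_diag_def)
  thus ?thesis using c(1)
    by (simp add: spectral_def mult_add_distrib_mat[where nr=n and n=n and nc=n] add_mult_distrib_mat[where nr=n and n=n and nc=n])
qed

lemma spectral_smult:
  assumes U: "unitary_mat n U"
  shows "complex_of_real c \<cdot>\<^sub>m spectral n U d = spectral n U (\<lambda>i. c * d i)"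
proof -
  note u = unitary_matD[OF U]
  have "mat_diag n (\<lambda>i. complex_of_real (c * d i))
      = complex_of_real c \<cdot>\<^sub>m mat_diag n (\<lambda>i. complex_of_real (d i))"
    by (rule eq_matI) (auto simp: mat_diag_def)
  thus ?thesis using u(1)
    by (simp add: spectral_def mult_smult_distrib[of _ n n _ n] mult_smult_assoc_mat[of _ n n _ n])
qed

lemma spectral_one:
  assumes U: "unitary_mat n U"
  shows "spectral n U (\<lambda>_. 1) = 1\<^sub>m n"
  using unitary_matD[OF U] by (simp add: spectral_def)

lemma spectral_herm: "unitary_mat n U \<Longrightarrow> herm n (spectral n U d)"
  by (simp add: herm_def, simp add: spectral_def unitary_matD adjoint_mult[of _ n n _ n] assoc_mult_mat[of _ n n _ n _ n])

lemma qform_diag: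
  assumes "w \<in> carrier_vec n"
  shows "qform (mat_diag n (\<lambda>i. complex_of_real (d i))) w = (\<Sum>i<n. d i * (cmod (w $ i))\<^sup>2)"
proof -
  have "mat_diag n (\<lambda>i. complex_of_real (d i)) *\<^sub>v w = vec n (\<lambda>i. complex_of_real (d i) * w $ i)"
    by (rule eq_vecI) (use assms in \<open>auto simp: mat_diag_def scalar_prod_def if_distrib[of "\<lambda>x. x * _"] sum.delta cong: if_cong\<close>)
  hence "qform (mat_diag n (\<lambda>i. complex_of_real (d i))) w
     = Re (\<Sum>i<n. complex_of_real (d i) * (w $ i * cnj (w $ i)))"
    using assms by (simp add: qform_def scalar_prod_def lessThan_atLeast0 algebra_simps)
  thus ?thesis by (simp add: complex_norm_square[symmetric] del: of_real_power)
qed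

lemma qform_spectral:
  assumes U: "unitary_mat n U" and v: "v \<in> carrier_vec n"
  shows "qform (spectral n U d) v = (\<Sum>i<n. d i * (cmod ((U\<^sup>\<dagger> *\<^sub>v v) $ i))\<^sup>2)"
proof -
  have "qform (spectral n U d) v = qform (mat_diag n (\<lambda>i. complex_of_real (d i))) (U\<^sup>\<dagger> *\<^sub>v v)"
    using qform_congr[of "mat_diag n (\<lambda>i. complex_of_real (d i))" n "U\<^sup>\<dagger>" n v] unitary_matD(1)[OF U] v
    by (simp add: spectral_def)
  also have "\<dots> = (\<Sum>i<n. d i * (cmod ((U\<^sup>\<dagger> *\<^sub>v v) $ i))\<^sup>2)"
    using unitary_matD(1)[OF U] v by (intro qform_diag) auto
  finally show ?thesis .
qed

lemma spectral_eigenvector: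
  assumes U: "unitary_mat n U" and i: "i < n"
  shows "spectral n U d *\<^sub>v col U i = complex_of_real (d i) \<cdot>\<^sub>v col U i"
    and "qform (spectral n U d) (col U i) = d i" and "col U i \<noteq> 0\<^sub>v n"
proof -
  note c = unitary_matD[OF U]
  let ?D = "mat_diag n (\<lambda>i. complex_of_real (d i))"
  have Uu: "U\<^sup>\<dagger> *\<^sub>v col U i = unit_vec n i"
  proof -
    have "U\<^sup>\<dagger> *\<^sub>v col U i = col (U\<^sup>\<dagger> * U) i" using c(1) i by (intro eq_vecI) auto
    thus ?thesis using i by (simp add: c)
  qed
  have "spectral n U d * U = U * ?D"
    unfolding spectral_def using c by (simp add: assoc_mult_mat[of _ n n _ n _ n] right_mult_one_mat[of _ n])
  hence "spectral n U d *\<^sub>v col U i = col (U * ?D) i"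
    using c(1) i spectral_carrier[OF U, of d] by (metis col_mult2)
  also have "\<dots> = complex_of_real (d i) \<cdot>\<^sub>v col U i"
    by (rule eq_vecI) (use c(1) i in \<open>auto simp: mat_diag_mult_right[of _ n n]\<close>)
  finally show "spectral n U d *\<^sub>v col U i = complex_of_real (d i) \<cdot>\<^sub>v col U i" .
  have col: "col U i \<in> carrier_vec n" using c(1) i by auto
  have "qform (spectral n U d) (col U i) = (\<Sum>j<n. if j = i then d j else 0)"
    unfolding qform_spectral[OF U col] Uu by (rule sum.cong) (auto simp: i)
  thus "qform (spectral n U d) (col U i) = d i" using i by simp
  show "col U i \<noteq> 0\<^sub>v n"
  proof
    assume 0: "col U i = 0\<^sub>v n"
    have "U\<^sup>\<dagger> *\<^sub>v col U i = 0\<^sub>v n" unfolding 0 by (rule mult_mat_zero_vec) (use c in simp)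
    hence "unit_vec n i = (0\<^sub>v n :: complex vec)" unfolding Uu .
    thus False using i by (metis index_unit_vec(2) index_zero_vec(1) zero_neq_one)
  qed
qed

text \<open>
The diagonal entries are real because the diagonal matrix \<open>U* A U\<close> is Hermitian, and they decrease
because the roots of the characteristic polynomial may be listed by decreasing real part.
\<close>

lemma herm_spectral:
  assumes "herm n A"
  obtains U d where "unitary_mat n U" "A = spectral n U d" "\<And>i j. i \<le> j \<Longrightarrow> j < n \<Longrightarrow> d j \<le> d i"
proof -
  note A = hermD[OF assms]
  obtain as where as: "char_poly A = (\<Prod>a\<leftarrow>as. [:- a, 1:])" "length as = n"
    using char_poly_factorized[OF A(1)] by blast
  define es where "es = sort_key (\<lambda>z. - Re z) as"
  have len: "length es = n" by (simp add: es_def as)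
  have "(\<Prod>a\<leftarrow>as. [:- a, 1:]) = (\<Prod>a\<leftarrow>es. [:- a, 1:])"
    by (simp add: prod_mset_prod_list[symmetric] es_def)
  then obtain U where U: "unitary_mat n U" and AU: "A = U * mat_diag n (\<lambda>i. es ! i) * U\<^sup>\<dagger>"
    using spectral_induct[OF A] as by metis
  note c = unitary_matD[OF U]
  let ?D = "mat_diag n (\<lambda>i. es ! i)"
  have D: "U\<^sup>\<dagger> * A * U = ?D"
  proof -
    have "U\<^sup>\<dagger> * A * U = (U\<^sup>\<dagger> * U) * ?D * (U\<^sup>\<dagger> * U)"
      unfolding AU using c(1) by (simp add: assoc_mult_mat[of _ n n _ n _ n])
    thus ?thesis by (simp add: c left_mult_one_mat[of _ n n] right_mult_one_mat[of _ n])
  qed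
  have Dh: "?D\<^sup>\<dagger> = ?D"
    unfolding D[symmetric] using c(1) A
    by (simp add: adjoint_mult[of _ n n _ n] assoc_mult_mat[of _ n n _ n _ n])
  have real: "complex_of_real (Re (es ! i)) = es ! i" if "i < n" for i
  proof -
    have "?D\<^sup>\<dagger> $$ (i, i) = ?D $$ (i, i)" by (simp add: Dh)
    hence "cnj (es ! i) = es ! i" using that by (simp add: mat_diag_def)
    thus ?thesis by (metis Reals_cnj_iff of_real_Re)
  qed
  have "?D = mat_diag n (\<lambda>i. complex_of_real (Re (es ! i)))"
    by (rule eq_matI) (auto simp: mat_diag_def real)
  hence "A = spectral n U (\<lambda>i. Re (es ! i))" using AU by (simp add: spectral_def)
  moreover have "Re (es ! j) \<le> Re (es ! i)" if "i \<le> j" "j < n" for i j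
  proof -
    have "sorted (map (\<lambda>z. - Re z) es)" by (simp add: es_def)
    from sorted_nth_mono[OF this that(1)] show ?thesis using that len by simp
  qed
  ultimately show ?thesis using U that by blast
qed

lemma psd_spectral:
  assumes "psd n A"
  obtains U d where "unitary_mat n U" "A = spectral n U d" "\<And>i j. i \<le> j \<Longrightarrow> j < n \<Longrightarrow> d j \<le> d i"
    "\<And>i. i < n \<Longrightarrow> 0 \<le> d i"
proof -
  obtain U d where *: "unitary_mat n U" "A = spectral n U d" "\<And>i j. i \<le> j \<Longrightarrow> j < n \<Longrightarrow> d j \<le> d i"
    using herm_spectral[OF psd_herm[OF assms]] by blast
  have "0 \<le> d i" if "i < n" for i
  proof -
    have "col U i \<in> carrier_vec n" using unitary_matD(1)[OF *(1)] that by auto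
    thus ?thesis
      using assms spectral_eigenvector(2)[OF *(1) that, of d] unfolding psd_def *(2) by metis
  qed
  with * show ?thesis using that by blast
qed

lemma pd_spectral:
  assumes "pd n A"
  obtains U d where "unitary_mat n U" "A = spectral n U d" "\<And>i j. i \<le> j \<Longrightarrow> j < n \<Longrightarrow> d j \<le> d i"
    "\<And>i. i < n \<Longrightarrow> 0 < d i"
proof -
  obtain U d where *: "unitary_mat n U" "A = spectral n U d" "\<And>i j. i \<le> j \<Longrightarrow> j < n \<Longrightarrow> d j \<le> d i"
    using herm_spectral[OF pd_herm[OF assms]] by blast
  have "0 < d i" if "i < n" for i
  proof -
    have "col U i \<in> carrier_vec n" using unitary_matD(1)[OF *(1)] that by auto
    thus ?thesis
      using assms spectral_eigenvector(2)[OF *(1) that, of d] spectral_eigenvector(3)[OF *(1) that] unfolding pd_def *(2) by metis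
  qed
  with * show ?thesis using that by blast
qed

lemma psd_spectralI: "unitary_mat n U \<Longrightarrow> (\<And>i. i < n \<Longrightarrow> 0 \<le> d i) \<Longrightarrow> psd n (spectral n U d)"
  by (auto simp: psd_def spectral_herm qform_spectral intro!: sum_nonneg)

lemma pd_spectralI:
  assumes U: "unitary_mat n U" and d: "\<And>i. i < n \<Longrightarrow> 0 < d i" shows "pd n (spectral n U d)"
  unfolding pd_def
proof (intro conjI ballI impI spectral_herm[OF U])
  fix v :: "complex vec" assume v: "v \<in> carrier_vec n" "v \<noteq> 0\<^sub>v n"
  note c = unitary_matD[OF U]
  let ?w = "U\<^sup>\<dagger> *\<^sub>v v"
  have w: "?w \<in> carrier_vec n" using c v by auto
  have "\<exists>i<n. ?w $ i \<noteq> 0"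
  proof (rule ccontr)
    assume "\<not> ?thesis"
    hence "?w = 0\<^sub>v n" by (intro eq_vecI) (use w c(1) in auto)
    hence "U *\<^sub>v ?w = 0\<^sub>v n" using mult_mat_zero_vec[of U n n] c by simp
    moreover have "U *\<^sub>v ?w = v"
      using c v assoc_mult_mat_vec[of U n n "U\<^sup>\<dagger>" n v] by simp
    ultimately show False using v by simp
  qed
  then obtain i where i: "i < n" "?w $ i \<noteq> 0" by blast
  have "0 < (\<Sum>i<n. d i * (cmod (?w $ i))\<^sup>2)"
    by (rule sum_pos2[of _ i]) (use i d in \<open>auto simp: less_imp_le\<close>)
  thus "0 < qform (spectral n U d) v" by (simp add: qform_spectral[OF U v(1)])
qed

lemma spectral_powr: "unitary_mat n U \<Longrightarrow> mat_powr (spectral n U d) r = spectral n U (\<lambda>i. d i powr r)"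
  by (simp add: spectral_def mat_powr_eqI)

lemma powr_herm: "herm n A \<Longrightarrow> herm n (mat_powr A r)"
  by (elim herm_spectral) (simp add: spectral_powr spectral_herm)

lemma powr_carrier: "herm n A \<Longrightarrow> mat_powr A r \<in> carrier_mat n n"
  by (simp add: powr_herm hermD)

lemma powr_adj: "herm n A \<Longrightarrow> (mat_powr A r)\<^sup>\<dagger> = mat_powr A r"
  using hermD(2)[OF powr_herm] .

lemma powr_psd: "herm n A \<Longrightarrow> psd n (mat_powr A r)"
  by (elim herm_spectral) (simp add: spectral_powr psd_spectralI)

lemma powr_pd: "pd n A \<Longrightarrow> pd n (mat_powr A r)"
  by (elim pd_spectral) (simp add: spectral_powr, rule pd_spectralI, assumption, metis less_irrefl powr_gt_zero)

lemma powr_mult_powr: "herm n A \<Longrightarrow> mat_powr A r * mat_powr A s = mat_powr A (r + s)"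
  by (elim herm_spectral) (simp add: spectral_powr spectral_mult powr_add)

lemma mat_powr_powr: "herm n A \<Longrightarrow> mat_powr (mat_powr A r) s = mat_powr A (r * s)"
  by (elim herm_spectral) (simp add: spectral_powr powr_powr)

lemma powr_0: 
  assumes "pd n A" shows "mat_powr A 0 = 1\<^sub>m n"
  using assms
proof (elim pd_spectral)
  fix U d assume *: "unitary_mat n U" "A = spectral n U d" "\<And>i. i < n \<Longrightarrow> 0 < d i"
  have "spectral n U (\<lambda>i. d i powr 0) = spectral n U (\<lambda>_. 1)" by (rule spectral_cong) (use *(3) in force)
  thus ?thesis using * by (simp add: spectral_powr spectral_one)
qed

lemma powr_1: 
  assumes "psd n A" shows "mat_powr A 1 = A"
  using assms
proof (elim psd_spectral)
  fix U d assume *: "unitary_mat n U" "A = spectral n U d" "\<And>i. i < n \<Longrightarrow> 0 \<le> d i"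
  have "spectral n U (\<lambda>i. d i powr 1) = spectral n U d" by (rule spectral_cong) (use *(3) in force)
  thus ?thesis using * by (simp add: spectral_powr)
qed

lemma powr_smult:
  assumes "psd n A" "0 \<le> c"
  shows "mat_powr (complex_of_real c \<cdot>\<^sub>m A) r = complex_of_real (c powr r) \<cdot>\<^sub>m mat_powr A r"
  using assms(1)
proof (elim psd_spectral)
  fix U d assume *: "unitary_mat n U" "A = spectral n U d" "\<And>i. i < n \<Longrightarrow> 0 \<le> d i"
  have "spectral n U (\<lambda>i. (c * d i) powr r) = spectral n U (\<lambda>i. c powr r * d i powr r)"
    by (rule spectral_cong) (use *(3) assms(2) in \<open>simp add: powr_mult\<close>)
  thus ?thesis using * by (simp add: spectral_smult spectral_powr)
qed

lemma det_mat_diag: "det (mat_diag k f) = (\<Prod>i<k. f i :: complex)"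
  by (subst det_upper_triangular[of _ k])
     (auto simp: mat_diag_def diag_mat_def prod.list_conv_set_nth lessThan_atLeast0)

lemma det_spectral: 
  assumes U: "unitary_mat n U" shows "det (spectral n U d) = complex_of_real (\<Prod>i<n. d i)"
proof -
  note c = unitary_matD[OF U]
  let ?D = "mat_diag n (\<lambda>i. complex_of_real (d i))"
  have "det (spectral n U d) = det U * det (U\<^sup>\<dagger>) * det ?D"
    unfolding spectral_def using c(1) by (simp add: det_mult[of _ n])
  also have "det U * det (U\<^sup>\<dagger>) = 1"
    using det_mult[of U n "U\<^sup>\<dagger>"] c by simp
  also have "det ?D = (\<Prod>i<n. complex_of_real (d i))" by (rule det_mat_diag)
  finally show ?thesis by simp
qed

lemma char_poly_spectral:
  assumes U: "unitary_mat n U"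
  shows "char_poly (spectral n U d) = (\<Prod>i<n. [:- complex_of_real (d i), 1:])"
proof -
  note c = unitary_matD[OF U]
  let ?D = "mat_diag n (\<lambda>i. complex_of_real (d i))"
  have "similar_mat_wit (spectral n U d) ?D U (U\<^sup>\<dagger>)"
    by (rule similar_mat_witI[of _ _ n]) (use c spectral_carrier[OF U] in \<open>auto simp: spectral_def\<close>)
  hence "char_poly (spectral n U d) = char_poly ?D"
    using char_poly_similar unfolding similar_mat_def by blast
  also have "\<dots> = (\<Prod>a\<leftarrow>diag_mat ?D. [:- a, 1:])"
    by (rule char_poly_upper_triangular[of _ n]) (auto simp: mat_diag_def)
  also have "\<dots> = (\<Prod>i<n. [:- complex_of_real (d i), 1:])"
    by (simp add: mat_diag_def diag_mat_def prod.list_conv_set_nth lessThan_atLeast0)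
  finally show ?thesis .
qed

text \<open>
Between the eigenbases of \<open>P\<close> and \<open>Q\<close>, the entry \<open>(i, j)\<close> of the matrix of \<open>X\<close> vanishes unless the
\<open>i\<close>-th eigenvalue of \<open>Q\<close> equals the \<open>j\<close>-th one of \<open>P\<close>; hence \<open>X\<close> intertwines any function of the
two matrices.
\<close>

lemma intertwine_powr:
  assumes P: "herm n P" and Q: "herm n Q" and X: "X \<in> carrier_mat n n" and XP: "X * P = Q * X"
  shows "X * mat_powr P r = mat_powr Q r * X"
proof -
  obtain U d where U: "unitary_mat n U" and P: "P = spectral n U d" using herm_spectral[OF P] by blast
  obtain V e where V: "unitary_mat n V" and Q: "Q = spectral n V e" using herm_spectral[OF Q] by blast
  note u = unitary_matD[OF U] and v = unitary_matD[OF V]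
  let ?D = "\<lambda>d. mat_diag n (\<lambda>i. complex_of_real (d i))"
  note assoc = assoc_mult_mat[of _ n n _ n _ n]
  define W where "W = V\<^sup>\<dagger> * X * U"
  have W: "W \<in> carrier_mat n n" using u v X by (simp add: W_def)
  have XW: "X = V * W * U\<^sup>\<dagger>"
  proof -
    have "V * W * U\<^sup>\<dagger> = (V * V\<^sup>\<dagger>) * X * (U * U\<^sup>\<dagger>)"
      unfolding W_def using u(1) v(1) X by (simp add: assoc)
    thus ?thesis using u v X by simp
  qed
  have l: "X * spectral n U d = V * (W * ?D d) * U\<^sup>\<dagger>" for d
  proof -
    have "X * spectral n U d = V * W * (U\<^sup>\<dagger> * U) * ?D d * U\<^sup>\<dagger>"
      unfolding XW spectral_def using u(1) v(1) W by (simp add: assoc)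
    thus ?thesis using u v(1) W by (simp add: assoc)
  qed
  have r: "spectral n V e * X = V * (?D e * W) * U\<^sup>\<dagger>" for e
  proof -
    have "spectral n V e * X = V * ?D e * (V\<^sup>\<dagger> * V) * W * U\<^sup>\<dagger>"
      unfolding XW spectral_def using u(1) v(1) W by (simp add: assoc)
    thus ?thesis using u(1) v W by (simp add: assoc left_mult_one_mat[of _ n n])
  qed
  have WD: "W * ?D d = ?D e * W"
  proof -
    have "V\<^sup>\<dagger> * (V * (W * ?D d) * U\<^sup>\<dagger>) * U = V\<^sup>\<dagger> * (V * (?D e * W) * U\<^sup>\<dagger>) * U"
      using XP l[of d] r[of e] P Q by simp
    moreover have "V\<^sup>\<dagger> * (V * Y * U\<^sup>\<dagger>) * U = Y" if Y: "Y \<in> carrier_mat n n" for Y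
    proof -
      have "V\<^sup>\<dagger> * (V * Y * U\<^sup>\<dagger>) * U = (V\<^sup>\<dagger> * V) * Y * (U\<^sup>\<dagger> * U)"
        using u(1) v(1) Y by (simp add: assoc)
      thus ?thesis using u v Y by simp
    qed
    ultimately show ?thesis using W by simp
  qed
  have *: "W $$ (i,j) * complex_of_real (d j) = complex_of_real (e i) * W $$ (i,j)"
    if "i < n" "j < n" for i j
    using arg_cong[OF WD, of "\<lambda>M. M $$ (i,j)"] that
    by (simp add: mat_diag_mult_right[OF W] mat_diag_mult_left[OF W])
  have "W * ?D (\<lambda>i. d i powr r) = ?D (\<lambda>i. e i powr r) * W"
    unfolding mat_diag_mult_right[OF W] mat_diag_mult_left[OF W]
  proof (rule cong_mat, goal_cases)
    case (3 i j)
    then show ?case using *[of i j] by (cases "W $$ (i,j) = 0") auto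
  qed auto
  thus ?thesis by (simp add: P Q spectral_powr U V l r)
qed

lemma psd_congr:
  assumes A: "psd n A" and K: "K \<in> carrier_mat n m"
  shows "psd m (K\<^sup>\<dagger> * A * K)"
  unfolding psd_def herm_def
proof (intro conjI ballI)
  note a = hermD[OF psd_herm[OF A]]
  show "K\<^sup>\<dagger> * A * K \<in> carrier_mat m m" using a K by auto
  show "(K\<^sup>\<dagger> * A * K)\<^sup>\<dagger> = K\<^sup>\<dagger> * A * K"
  proof -
    have "(K\<^sup>\<dagger> * A * K)\<^sup>\<dagger> = K\<^sup>\<dagger> * (K\<^sup>\<dagger> * A)\<^sup>\<dagger>" by (rule adjoint_mult) (use a K in auto)
    also have "(K\<^sup>\<dagger> * A)\<^sup>\<dagger> = A * K" using adjoint_mult[of "K\<^sup>\<dagger>" m n A n] a K by simp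
    finally show ?thesis using a K by (simp add: assoc_mult_mat[of _ m n _ n _ m])
  qed
  show "0 \<le> qform (K\<^sup>\<dagger> * A * K) v" if "v \<in> carrier_vec m" for v
    using that a K psd_qform_nonneg[OF A] by (auto simp: qform_congr)
qed

lemma pd_congr:
  assumes A: "pd n A" and K: "K \<in> carrier_mat n n" and L: "L \<in> carrier_mat n n" "L * K = 1\<^sub>m n"
  shows "pd n (K\<^sup>\<dagger> * A * K)"
  unfolding pd_def
proof (intro conjI ballI impI)
  show "herm n (K\<^sup>\<dagger> * A * K)" using psd_congr[OF pd_psd[OF A] K] psd_herm by blast
  fix v :: "complex vec" assume v: "v \<in> carrier_vec n" "v \<noteq> 0\<^sub>v n"
  have "K *\<^sub>v v \<noteq> 0\<^sub>v n"
  proof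
    assume "K *\<^sub>v v = 0\<^sub>v n"
    hence "L *\<^sub>v (K *\<^sub>v v) = 0\<^sub>v n" using L mult_mat_zero_vec[of L n n] by simp
    moreover have "L *\<^sub>v (K *\<^sub>v v) = v" using assoc_mult_mat_vec[OF L(1) K v(1)] L v by simp
    ultimately show False using v by simp
  qed
  moreover have "K *\<^sub>v v \<in> carrier_vec n" using K v by auto
  ultimately show "0 < qform (K\<^sup>\<dagger> * A * K) v"
    using A unfolding qform_congr[OF pd_carrier[OF A] K v(1)] pd_def by blast
qed

lemma powr_congr_psd:
  assumes "herm n A" "psd n B" shows "psd n (mat_powr A r * B * mat_powr A r)"
  using psd_congr[OF assms(2) powr_carrier[OF assms(1), of r]] powr_adj[OF assms(1)] by simp

lemma powr_inverse:
  assumes "pd n A" shows "mat_powr A (-r) * mat_powr A r = 1\<^sub>m n" "mat_powr A r * mat_powr A (-r) = 1\<^sub>m n"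
  using assms by (simp_all add: powr_mult_powr[OF pd_herm] powr_0)

lemma powr_congr_pd:
  assumes "pd n A" "pd n B" shows "pd n (mat_powr A r * B * mat_powr A r)"
  using pd_congr[OF assms(2) _ _ powr_inverse(1)[OF assms(1), of r]] powr_adj[OF pd_herm[OF assms(1)]]
    powr_carrier[OF pd_herm[OF assms(1)]] by simp

lemma gram_herm: 
  assumes "X \<in> carrier_mat n n" shows "herm n (X\<^sup>\<dagger> * X)" "herm n (X * X\<^sup>\<dagger>)"
  using assms by (auto simp: herm_def adjoint_mult[of _ n n _ n])

text \<open>
\<open>X\<close> intertwines \<open>X* X\<close> and \<open>X X*\<close>. This identity drives both the symmetry of the geometric mean and
the bootstrap argument for its powers.
\<close>

lemma gram_powr:
  assumes "X \<in> carrier_mat n n"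
  shows "X * mat_powr (X\<^sup>\<dagger> * X) r = mat_powr (X * X\<^sup>\<dagger>) r * X"
  by (rule intertwine_powr[of n]) (use assms gram_herm[of X n] in \<open>auto simp: assoc_mult_mat[of _ n n _ n _ n]\<close>)

section \<open>The Loewner order and the Loewner-Heinz inequality\<close>

definition norm_sq :: "complex vec \<Rightarrow> real" where
  "norm_sq v = Re (v \<bullet>c v)"

lemma norm_sq_eq: "v \<in> carrier_vec n \<Longrightarrow> norm_sq v = (\<Sum>i<n. (cmod (v $ i))\<^sup>2)"
  by (simp add: norm_sq_def cscalar_prod_self)

lemma qform_one_norm_sq: "v \<in> carrier_vec n \<Longrightarrow> qform (1\<^sub>m n) v = norm_sq v"
  by (simp add: qform_def norm_sq_def)

lemma norm_sq_pos: 
  assumes "v \<in> carrier_vec n" "v \<noteq> 0\<^sub>v n" shows "0 < norm_sq v"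
proof -
  have "\<exists>i<n. v $ i \<noteq> 0" using assms by (metis carrier_vecD eq_vecI index_zero_vec)
  then obtain i where "i < n" "v $ i \<noteq> 0" by blast
  hence "0 < (\<Sum>i<n. (cmod (v $ i))\<^sup>2)" by (intro sum_pos2[of _ i]) auto
  thus ?thesis using assms by (simp add: norm_sq_eq)
qed

text \<open>
The squared length of \<open>x - y\<close> is nonnegative. In this form, weaker than the Cauchy-Schwarz
inequality, no square roots occur.
\<close>

lemma Re_cscalar_le:
  assumes "x \<in> carrier_vec n" "y \<in> carrier_vec n"
  shows "2 * Re (x \<bullet>c y) \<le> norm_sq x + norm_sq y"
proof -
  have "2 * Re (x $ i * cnj (y $ i)) \<le> (cmod (x $ i))\<^sup>2 + (cmod (y $ i))\<^sup>2" for i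
  proof -
    have "Re (x $ i * cnj (y $ i)) \<le> cmod (x $ i) * cmod (y $ i)"
      by (metis complex_Re_le_cmod complex_mod_cnj norm_mult)
    thus ?thesis using sum_squares_bound[of "cmod (x $ i)" "cmod (y $ i)"] by linarith
  qed
  hence "(\<Sum>i<n. 2 * Re (x $ i * cnj (y $ i))) \<le> (\<Sum>i<n. (cmod (x $ i))\<^sup>2 + (cmod (y $ i))\<^sup>2)"
    by (intro sum_mono)
  moreover have "Re (x \<bullet>c y) = (\<Sum>i<n. Re (x $ i * cnj (y $ i)))"
    using assms by (simp add: scalar_prod_def lessThan_atLeast0)
  ultimately show ?thesis
    using assms by (simp add: norm_sq_eq sum.distrib sum_distrib_left del: times_complex.sel)
qed

lemma cscalar_herm:
  assumes "herm n K" "v \<in> carrier_vec n" "w \<in> carrier_vec n"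
  shows "(K *\<^sub>v v) \<bullet>c w = v \<bullet>c (K *\<^sub>v w)"
  using cscalar_prod_adjoint[of K n n v w] assms by (simp add: herm_def)

lemma norm_sq_herm:
  assumes "herm n K" "v \<in> carrier_vec n"
  shows "norm_sq (K *\<^sub>v v) = qform (K * K) v"
  using assms cscalar_herm[of n K "K *\<^sub>v v" v] hermD(1)[OF assms(1)]
  by (simp add: norm_sq_def qform_def assoc_mult_mat_vec[of _ n n _ n])

lemma norm_sq_powr:
  assumes "herm n A" "v \<in> carrier_vec n"
  shows "norm_sq (mat_powr A (r / 2) *\<^sub>v v) = qform (mat_powr A r) v"
  using assms by (simp add: norm_sq_herm[OF powr_herm] powr_mult_powr)

lemma loewner_le_spectral_one:
  assumes U: "unitary_mat n U" 
  shows "loewner_le n (spectral n U d) (complex_of_real c \<cdot>\<^sub>m 1\<^sub>m n) \<longleftrightarrow> (\<forall>i<n. d i \<le> c)"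
proof -
  have one: "complex_of_real c \<cdot>\<^sub>m 1\<^sub>m n = spectral n U (\<lambda>_. c)"
    using spectral_smult[OF U, of c "\<lambda>_. 1"] by (simp add: spectral_one[OF U])
  show ?thesis
  proof
    assume le: "loewner_le n (spectral n U d) (complex_of_real c \<cdot>\<^sub>m 1\<^sub>m n)"
    show "\<forall>i<n. d i \<le> c"
    proof (intro allI impI)
      fix i assume i: "i < n"
      have "col U i \<in> carrier_vec n" using unitary_matD(1)[OF U] i by auto
      thus "d i \<le> c" using le spectral_eigenvector(2)[OF U i] unfolding one loewner_le_def by metis
    qed
  next
    assume "\<forall>i<n. d i \<le> c"
    thus "loewner_le n (spectral n U d) (complex_of_real c \<cdot>\<^sub>m 1\<^sub>m n)"
      unfolding one loewner_le_def by (auto simp: qform_spectral[OF U] intro!: sum_mono mult_right_mono)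
  qed
qed

lemma smult_one [simp]: "(1::complex) \<cdot>\<^sub>m A = A"
  by (rule eq_matI) auto

lemma loewner_congr_powr:
  assumes "loewner_le n X Y" "X \<in> carrier_mat n n" "Y \<in> carrier_mat n n" "herm n A"
  shows "loewner_le n (mat_powr A r * X * mat_powr A r) (mat_powr A r * Y * mat_powr A r)"
  using loewner_le_congr[OF assms(1-3) powr_carrier[OF assms(4), of r]] by (simp add: powr_adj[OF assms(4)])

lemma powr_sandwich:
  assumes "herm n A"
  shows "mat_powr A r * mat_powr A s * mat_powr A u = mat_powr A (r + s + u)"
  using assms by (simp add: powr_mult_powr)

lemma powr_sandwich_cancel:
  assumes A: "pd n A" and X: "X \<in> carrier_mat n n" and "s = - r"
  shows "mat_powr A s * (mat_powr A r * X * mat_powr A r) * mat_powr A s = X"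
proof -
  note h = pd_herm[OF A] and c = powr_carrier[OF pd_herm[OF A]]
  have "mat_powr A s * (mat_powr A r * X * mat_powr A r) * mat_powr A s
      = (mat_powr A s * mat_powr A r) * X * (mat_powr A r * mat_powr A s)"
    using X c by (simp add: assoc_mult_mat[of _ n n _ n _ n])
  thus ?thesis using X by (simp add: powr_mult_powr[OF h] powr_0[OF A] \<open>s = - r\<close>)
qed

text \<open>
Pedersen's argument. The claim is that every eigenvalue of
\<open>H = A^(-m/2) B^m A^(-m/2)\<close> with \<open>m = (s + t)/2\<close> is at most 1. Now \<open>H\<close> is similar to the product of
\<open>(B^(s/2) A^(-s/2))*\<close> and \<open>B^(t/2) A^(-t/2)\<close>, both contractions by hypothesis, and an eigenvalue
of a product of contractions has modulus at most 1.
\<close>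

lemma loewner_heinz_midpoint:
  assumes B: "psd n B" and A: "pd n A"
    and s: "loewner_le n (mat_powr B s) (mat_powr A s)"
    and t: "loewner_le n (mat_powr B t) (mat_powr A t)"
  shows "loewner_le n (mat_powr B ((s + t) / 2)) (mat_powr A ((s + t) / 2))"
proof -
  define m where "m = (s + t) / 2"
  note hA = pd_herm[OF A] and hB = psd_herm[OF B]
  note cA = powr_carrier[OF hA] and cB = powr_carrier[OF hB]
  note assoc = assoc_mult_mat[of _ n n _ n _ n] and assocv = assoc_mult_mat_vec[of _ n n _ n]
  define H where "H = mat_powr A (- m / 2) * mat_powr B m * mat_powr A (- m / 2)"
  have "psd n H" unfolding H_def by (rule powr_congr_psd[OF hA powr_psd[OF hB]])
  then obtain U d where U: "unitary_mat n U" and H: "H = spectral n U d" using psd_spectral by blast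
  have d1: "d i \<le> 1" if i: "i < n" for i
  proof -
    define u where "u = col U i"
    have u: "u \<in> carrier_vec n" "u \<noteq> 0\<^sub>v n" "H *\<^sub>v u = complex_of_real (d i) \<cdot>\<^sub>v u"
      using spectral_eigenvector[OF U i] unitary_matD(1)[OF U] i by (auto simp: u_def H)
    define w where "w = mat_powr A ((t - s) / 4) *\<^sub>v u"
    have w: "w \<in> carrier_vec n" using cA u by (simp add: w_def)
    have "mat_powr A ((s - t) / 4) *\<^sub>v w = u"
      unfolding w_def using u cA by (simp add: assocv[symmetric] powr_mult_powr[OF hA] powr_0[OF A] add_divide_distrib[symmetric])
    hence "w \<noteq> 0\<^sub>v n" using u mult_mat_zero_vec[OF cA, of "(s - t) / 4"] by auto
    hence N: "0 < norm_sq w" using norm_sq_pos w by blast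
    define x where "x = mat_powr B (t / 2) *\<^sub>v (mat_powr A (- t / 2) *\<^sub>v w)"
    define y where "y = mat_powr B (s / 2) *\<^sub>v (mat_powr A (- s / 2) *\<^sub>v w)"
    have bound: "norm_sq (mat_powr B (r / 2) *\<^sub>v (mat_powr A (- r / 2) *\<^sub>v w)) \<le> norm_sq w"
      if "loewner_le n (mat_powr B r) (mat_powr A r)" for r
    proof -
      have "norm_sq (mat_powr B (r / 2) *\<^sub>v (mat_powr A (- r / 2) *\<^sub>v w))
          \<le> norm_sq (mat_powr A (r / 2) *\<^sub>v (mat_powr A (- r / 2) *\<^sub>v w))"
        using that cA w unfolding loewner_le_def by (simp add: norm_sq_powr[OF hA] norm_sq_powr[OF hB])
      also have "mat_powr A (r / 2) *\<^sub>v (mat_powr A (- r / 2) *\<^sub>v w) = w"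
        using cA w by (simp add: assocv[symmetric] powr_mult_powr[OF hA] powr_0[OF A])
      finally show ?thesis .
    qed
    \<comment> \<open>\<open>w\<close> is an eigenvector of the product of contractions, so the inner product of \<open>x\<close> and \<open>y\<close> is \<open>d i\<close> times the squared length of \<open>w\<close>\<close>
    have "x \<bullet>c y = (mat_powr A (- s / 2) *\<^sub>v (mat_powr B (s / 2) *\<^sub>v x)) \<bullet>c w"
    proof -
      have "(mat_powr B (s / 2) *\<^sub>v x) \<bullet>c (mat_powr A (- s / 2) *\<^sub>v w) = x \<bullet>c y"
        unfolding y_def using w cA cB by (intro cscalar_herm[OF powr_herm[OF hB]]) (auto simp: x_def)
      moreover have "(mat_powr A (- s / 2) *\<^sub>v (mat_powr B (s / 2) *\<^sub>v x)) \<bullet>c w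
          = (mat_powr B (s / 2) *\<^sub>v x) \<bullet>c (mat_powr A (- s / 2) *\<^sub>v w)"
        using w cA cB by (intro cscalar_herm[OF powr_herm[OF hA]]) (auto simp: x_def)
      ultimately show ?thesis by simp
    qed
    also have "mat_powr A (- s / 2) *\<^sub>v (mat_powr B (s / 2) *\<^sub>v x)
        = (mat_powr A (- s / 2) * (mat_powr B (s / 2) * mat_powr B (t / 2)) * (mat_powr A (- t / 2) * mat_powr A ((t - s) / 4))) *\<^sub>v u"
      unfolding x_def w_def using u cA cB by (simp add: assocv)
    also have "mat_powr A (- s / 2) * (mat_powr B (s / 2) * mat_powr B (t / 2)) * (mat_powr A (- t / 2) * mat_powr A ((t - s) / 4))
       = mat_powr A ((t - s) / 4) * H"
    proof -
      have e: "(t - s) / 4 + - m / 2 = - s / 2" "- t / 2 + (t - s) / 4 = - m / 2" "s / 2 + t / 2 = m"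
        by (simp_all add: m_def field_simps)
      have "mat_powr A ((t - s) / 4) * H
          = (mat_powr A ((t - s) / 4) * mat_powr A (- m / 2)) * mat_powr B m * mat_powr A (- m / 2)"
        unfolding H_def using cA cB by (simp add: assoc)
      thus ?thesis unfolding powr_mult_powr[OF hA] powr_mult_powr[OF hB] e by simp
    qed
    also have "(mat_powr A ((t - s) / 4) * H) *\<^sub>v u = complex_of_real (d i) \<cdot>\<^sub>v w"
      using cA u H spectral_carrier[OF U, of d] by (simp add: assocv mult_mat_vec[of _ n n] w_def)
    also have "(complex_of_real (d i) \<cdot>\<^sub>v w) \<bullet>c w = complex_of_real (d i) * (w \<bullet>c w)"
      using w by simp
    finally have "Re (x \<bullet>c y) = d i * norm_sq w" by (simp add: norm_sq_def)
    moreover have "2 * Re (x \<bullet>c y) \<le> norm_sq x + norm_sq y"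
      using w cA cB by (intro Re_cscalar_le[of _ n]) (auto simp: x_def y_def)
    moreover have "norm_sq x \<le> norm_sq w" "norm_sq y \<le> norm_sq w"
      using bound[OF s] bound[OF t] by (simp_all add: x_def y_def)
    ultimately have "d i * norm_sq w \<le> 1 * norm_sq w" by linarith
    thus ?thesis using N by (simp del: mult_1)
  qed
  hence "loewner_le n H (complex_of_real 1 \<cdot>\<^sub>m 1\<^sub>m n)" unfolding H loewner_le_spectral_one[OF U] by blast
  hence "loewner_le n (mat_powr A (m / 2) * H * mat_powr A (m / 2)) (mat_powr A (m / 2) * 1\<^sub>m n * mat_powr A (m / 2))"
    using loewner_congr_powr[OF _ _ _ hA, of H "1\<^sub>m n" "m / 2"] H spectral_carrier[OF U, of d] by simp
  thus ?thesis
    using cA cB powr_sandwich_cancel[OF A cB[of m], of "m / 2" "- m / 2"]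
    by (simp add: m_def[symmetric] H_def powr_mult_powr[OF hA] right_mult_one_mat[OF cA])
qed

text \<open>
A point \<open>r\<close> outside \<open>S\<close> would lie strictly between the largest element of \<open>S\<close> below it and the
smallest one above it, but their midpoint belongs to \<open>S\<close>.
\<close>

lemma closed_midpoint_interval:
  fixes S :: "real set"
  assumes S: "closed S" "S \<subseteq> {0..1}" "0 \<in> S" "1 \<in> S" and mid: "\<And>x y. x \<in> S \<Longrightarrow> y \<in> S \<Longrightarrow> (x + y) / 2 \<in> S"
    and r: "0 \<le> r" "r \<le> 1"
  shows "r \<in> S"
proof -
  have "compact S" using compact_Int_closed[of "{0..1}" S] S(1,2) by (simp add: Int_absorb1)
  hence "compact (S \<inter> {..r})" "compact (S \<inter> {r..})" by (auto intro: compact_Int_closed)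
  moreover have "0 \<in> S \<inter> {..r}" "1 \<in> S \<inter> {r..}" using S r by auto
  ultimately obtain a b where a: "a \<in> S \<inter> {..r}" "\<forall>x \<in> S \<inter> {..r}. x \<le> a"
    and b: "b \<in> S \<inter> {r..}" "\<forall>x \<in> S \<inter> {r..}. b \<le> x"
    using compact_attains_sup[of "S \<inter> {..r}"] compact_attains_inf[of "S \<inter> {r..}"] by (metis empty_iff)
  have m: "(a + b) / 2 \<in> S" using mid a(1) b(1) by blast
  have "a = r \<or> b = r"
  proof (cases "(a + b) / 2 \<le> r")
    case True
    hence "(a + b) / 2 \<in> S \<inter> {..r}" using m by simp
    hence "(a + b) / 2 \<le> a" using a(2) by blast
    thus ?thesis using a(1) b(1) by auto
  next
    case False
    hence "(a + b) / 2 \<in> S \<inter> {r..}" using m by simp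
    hence "b \<le> (a + b) / 2" using b(2) by blast
    thus ?thesis using a(1) b(1) by auto
  qed
  thus ?thesis using a(1) b(1) by auto
qed

text \<open>
The base 0 is no exception, as \<open>0 powr r = 0\<close> for every \<open>r\<close>, including \<open>r = 0\<close>.
\<close>

lemma continuous_powr_exponent: "continuous_on UNIV (\<lambda>r. (x::real) powr r)"
  by (cases "x = 0") (auto simp: powr_def intro!: continuous_intros)

lemma continuous_qform_powr:
  assumes A: "herm n A" and v: "v \<in> carrier_vec n"
  shows "continuous_on UNIV (\<lambda>r. qform (mat_powr A r) v)"
proof -
  obtain U d where U: "unitary_mat n U" and A: "A = spectral n U d" using herm_spectral[OF A] by blast
  show ?thesis unfolding A spectral_powr[OF U] qform_spectral[OF U v]
    by (intro continuous_on_sum continuous_on_mult continuous_powr_exponent continuous_on_const)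
qed

text \<open>
The exponents for which the inequality holds form a closed set that contains 0 and 1 and is closed
under midpoints.
\<close>

theorem loewner_heinz:
  assumes B: "psd n B" and A: "pd n A" and le: "loewner_le n B A" and r: "0 \<le> r" "r \<le> 1"
  shows "loewner_le n (mat_powr B r) (mat_powr A r)"
proof -
  define S where "S = {r \<in> {0..1}. loewner_le n (mat_powr B r) (mat_powr A r)}"
  have "r \<in> S"
  proof (rule closed_midpoint_interval[OF _ _ _ _ _ r])
    have "S = {0..1} \<inter> (\<Inter>v\<in>carrier_vec n. {r. qform (mat_powr B r) v \<le> qform (mat_powr A r) v})"
      by (auto simp: S_def loewner_le_def)
    moreover have "closed (\<Inter>v\<in>carrier_vec n. {r. qform (mat_powr B r) v \<le> qform (mat_powr A r) v})"
      by (intro closed_INT ballI closed_Collect_le continuous_qform_powr[OF psd_herm[OF B]] continuous_qform_powr[OF pd_herm[OF A]])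
    ultimately show "closed S" by auto
    obtain U d where U: "unitary_mat n U" and Bs: "B = spectral n U d" using herm_spectral[OF psd_herm[OF B]] by blast
    have "loewner_le n (mat_powr B 0) (complex_of_real 1 \<cdot>\<^sub>m 1\<^sub>m n)"
      unfolding Bs spectral_powr[OF U] loewner_le_spectral_one[OF U] by simp
    thus "0 \<in> S" by (simp add: S_def powr_0[OF A])
    show "1 \<in> S" using le by (simp add: S_def powr_1[OF B] powr_1[OF pd_psd[OF A]])
    show "S \<subseteq> {0..1}" by (auto simp: S_def)
    show "(x + y) / 2 \<in> S" if "x \<in> S" "y \<in> S" for x y
      using that loewner_heinz_midpoint[OF B A] by (auto simp: S_def)
  qed
  thus ?thesis by (simp add: S_def)
qed

text \<open>
For \<open>w = Y\<^sup>-\<^sup>1 v\<close> the quadratic form \<open>q\<close> of \<open>Y\<^sup>-\<^sup>1\<close> at \<open>v\<close> is the inner product of \<open>w\<close> and \<open>v\<close>, and so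
of \<open>X^(1/2) w\<close> and \<open>X^(-1/2) v\<close>. Hence \<open>2 q\<close> is at most the form of \<open>X\<close> at \<open>w\<close>, which is at most
that of \<open>Y\<close> at \<open>w\<close>, namely \<open>q\<close>, plus the form of \<open>X\<^sup>-\<^sup>1\<close> at \<open>v\<close>.
\<close>

lemma loewner_inverse_antimono:
  assumes X: "pd n X" and Y: "pd n Y" and le: "loewner_le n X Y"
  shows "loewner_le n (mat_powr Y (-1)) (mat_powr X (-1))"
  unfolding loewner_le_def
proof
  fix v :: "complex vec" assume v: "v \<in> carrier_vec n"
  note hX = pd_herm[OF X] and hY = pd_herm[OF Y]
  note cX = powr_carrier[OF hX] and cY = powr_carrier[OF hY]
  note assocv = assoc_mult_mat_vec[of _ n n _ n]
  define w where "w = mat_powr Y (-1) *\<^sub>v v"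
  have w: "w \<in> carrier_vec n" using v cY by (simp add: w_def)
  define q where "q = qform (mat_powr Y (-1)) v"
  have wv: "w \<bullet>c v = v \<bullet>c w" 
    unfolding w_def using v by (intro cscalar_herm[OF powr_herm[OF hY]]) auto
  have Yw: "Y *\<^sub>v w = v"
  proof -
    have "Y * mat_powr Y (-1) = mat_powr Y 1 * mat_powr Y (-1)" by (simp add: powr_1[OF pd_psd[OF Y]])
    also have "\<dots> = 1\<^sub>m n" by (simp add: powr_mult_powr[OF hY] powr_0[OF Y])
    finally show ?thesis unfolding w_def using v cY pd_carrier[OF Y] by (simp add: assocv[symmetric])
  qed
  have "mat_powr X (-1/2) *\<^sub>v (mat_powr X (1/2) *\<^sub>v w) = w"
    using cX w by (simp add: assocv[symmetric] powr_mult_powr[OF hX] powr_0[OF X])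
  hence "(mat_powr X (1/2) *\<^sub>v w) \<bullet>c (mat_powr X (-1/2) *\<^sub>v v) = w \<bullet>c v"
    using cscalar_herm[OF powr_herm[OF hX, of "-1/2"], of "mat_powr X (1/2) *\<^sub>v w" v] cX w v by simp
  moreover have "2 * Re ((mat_powr X (1/2) *\<^sub>v w) \<bullet>c (mat_powr X (-1/2) *\<^sub>v v))
      \<le> norm_sq (mat_powr X (1/2) *\<^sub>v w) + norm_sq (mat_powr X (-1/2) *\<^sub>v v)"
    using cX w v by (intro Re_cscalar_le[of _ n]) auto
  ultimately have "2 * Re (w \<bullet>c v) \<le> norm_sq (mat_powr X (1/2) *\<^sub>v w) + norm_sq (mat_powr X (-1/2) *\<^sub>v v)" by metis
  also have "norm_sq (mat_powr X (1/2) *\<^sub>v w) = qform X w"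
    using norm_sq_powr[OF hX w, of 1] by (simp add: powr_1[OF pd_psd[OF X]])
  also have "norm_sq (mat_powr X (-1/2) *\<^sub>v v) = qform (mat_powr X (-1)) v"
    using norm_sq_powr[OF hX v, of "-1"] by simp
  also have "qform X w \<le> qform Y w" using le w by (simp add: loewner_le_def)
  also have "qform Y w = q" by (simp add: qform_def Yw wv[symmetric] q_def, simp add: w_def)
  also have "Re (w \<bullet>c v) = q" by (simp add: q_def w_def qform_def)
  finally show "qform (mat_powr Y (-1)) v \<le> qform (mat_powr X (-1)) v"
    unfolding q_def by simp
qed

lemma loewner_heinz_neg:
  assumes "pd n X" "pd n Y" "loewner_le n X (mat_powr Y (-u))" "0 \<le> r" "r \<le> 1"
  shows "loewner_le n (mat_powr X r) (mat_powr Y (-(u * r)))"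
  using loewner_heinz[OF pd_psd[OF assms(1)] powr_pd[OF assms(2)] assms(3-5)]
  by (simp add: mat_powr_powr[OF pd_herm[OF assms(2)]])

section \<open>The operator inequality behind the theorem\<close>

lemma gram_powr_Suc:
  assumes X: "X \<in> carrier_mat n n" and G: "pd n (X * X\<^sup>\<dagger>)"
  shows "mat_powr (X * X\<^sup>\<dagger>) (r + 1) = X * mat_powr (X\<^sup>\<dagger> * X) r * X\<^sup>\<dagger>"
proof -
  note h = gram_herm[OF X] 
  have "X * mat_powr (X\<^sup>\<dagger> * X) r * X\<^sup>\<dagger> = mat_powr (X * X\<^sup>\<dagger>) r * (X * X\<^sup>\<dagger>)"
    using X powr_carrier[OF h(2)] by (simp add: gram_powr assoc_mult_mat[of _ n n _ n _ n])
  also have "\<dots> = mat_powr (X * X\<^sup>\<dagger>) r * mat_powr (X * X\<^sup>\<dagger>) 1" by (simp add: powr_1[OF pd_psd[OF G]])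
  also have "\<dots> = mat_powr (X * X\<^sup>\<dagger>) (r + 1)" by (rule powr_mult_powr[OF h(2)])
  finally show ?thesis by simp
qed

text \<open>
With \<open>\<delta> = 1/2 - t\<close>, the two bounds \<open>Z^a \<le> C^(-a\<delta>)\<close> and \<open>W^a \<le> A^(2a\<delta>)\<close> are carried from \<open>a\<close> to
\<open>a + 1\<close> simultaneously: conjugating the bound for \<open>Z^a\<close> by \<open>K\<close> leaves \<open>C^(t - a\<delta>)\<close> in the
middle, which is compared with a power of \<open>A\<close>; conjugating the bound for \<open>W^a\<close> by \<open>K*\<close> leaves
\<open>A^(1 + 2a\<delta>)\<close>, which is compared with a power of \<open>C\<close>. The comparisons need \<open>a\<delta> \<le> t\<close>, which holds
for \<open>a + 1 \<le> p\<close>. The induction starts at the fractional part of \<open>p\<close>.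
\<close>

lemma furuta_bootstrap:
  assumes A: "pd n A" and C: "pd n C" and le: "loewner_le n C (mat_powr A (-2))"
    and t: "0 \<le> t" "t \<le> 1/2" and p: "0 \<le> p" "p * (1 - 2 * t) \<le> 1"
  shows "loewner_le n (mat_powr (mat_powr A (1/2) * mat_powr C t * mat_powr A (1/2)) p)
           (mat_powr A (p * (1 - 2 * t)))"
proof -
  note hA = pd_herm[OF A] and hC = pd_herm[OF C]
  note cA = powr_carrier[OF hA] and cC = powr_carrier[OF hC]
  note assoc = assoc_mult_mat[of _ n n _ n _ n]
  define \<delta> where "\<delta> = 1/2 - t"
  have \<delta>: "0 \<le> \<delta>" "p * \<delta> \<le> 1/2" using t p by (auto simp: \<delta>_def algebra_simps)
  define K where "K = mat_powr A (1/2) * mat_powr C (t/2)"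
  have K: "K \<in> carrier_mat n n" using cA cC by (simp add: K_def)
  have Kadj: "K\<^sup>\<dagger> = mat_powr C (t/2) * mat_powr A (1/2)"
    unfolding K_def using cA cC adjoint_mult[of _ n n _ n] by (simp add: powr_adj[OF hA] powr_adj[OF hC])
  define W where "W = K * K\<^sup>\<dagger>"
  define Z where "Z = K\<^sup>\<dagger> * K"
  have W: "W = mat_powr A (1/2) * mat_powr C t * mat_powr A (1/2)"
  proof -
    have "W = mat_powr A (1/2) * (mat_powr C (t/2) * mat_powr C (t/2)) * mat_powr A (1/2)"
      unfolding W_def Kadj unfolding K_def using cA cC by (simp add: assoc)
    thus ?thesis by (simp add: powr_mult_powr[OF hC])
  qed
  have Z: "Z = mat_powr C (t/2) * A * mat_powr C (t/2)"
  proof -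
    have "Z = mat_powr C (t/2) * (mat_powr A (1/2) * mat_powr A (1/2)) * mat_powr C (t/2)"
      unfolding Z_def Kadj unfolding K_def using cA cC by (simp add: assoc)
    thus ?thesis by (simp add: powr_mult_powr[OF hA] powr_1[OF pd_psd[OF A]])
  qed
  have Wpd: "pd n W" unfolding W by (rule powr_congr_pd[OF A powr_pd[OF C]])
  have Zpd: "pd n Z" unfolding Z by (rule powr_congr_pd[OF C A])
  have inv: "loewner_le n (mat_powr A 2) (mat_powr C (-1))"
    using loewner_inverse_antimono[OF C powr_pd[OF A] le] by (simp add: mat_powr_powr[OF hA])
  have Apow: "loewner_le n (mat_powr A (2 * r)) (mat_powr C (- r))" if "0 \<le> r" "r \<le> 1" for r
    using loewner_heinz_neg[OF powr_pd[OF A] C inv that] by (simp add: mat_powr_powr[OF hA])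
  have Cpow: "loewner_le n (mat_powr C r) (mat_powr A (- 2 * r))" if "0 \<le> r" "r \<le> 1" for r
    using loewner_heinz_neg[OF C A le that] by simp
  define P where "P a \<longleftrightarrow> loewner_le n (mat_powr Z a) (mat_powr C (- (a * \<delta>)))
      \<and> loewner_le n (mat_powr W a) (mat_powr A (2 * (a * \<delta>)))" for a
  have step: "P (a + 1)" if a: "P a" "0 \<le> a" "a * \<delta> \<le> t" for a
    unfolding P_def
  proof
    have a\<delta>: "0 \<le> a * \<delta>" using a \<delta> by simp
    have "mat_powr W (a + 1) = K * mat_powr Z a * K\<^sup>\<dagger>"
      unfolding W_def Z_def by (rule gram_powr_Suc[OF K]) (use Wpd W_def in simp)
    moreover have "loewner_le n (K * mat_powr Z a * K\<^sup>\<dagger>) (K * mat_powr C (- (a * \<delta>)) * K\<^sup>\<dagger>)"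
      using loewner_le_congr[of n "mat_powr Z a" "mat_powr C (- (a * \<delta>))" "K\<^sup>\<dagger>" n] a(1) K cC powr_carrier[OF pd_herm[OF Zpd]]
      by (simp add: P_def)
    moreover have "K * mat_powr C (- (a * \<delta>)) * K\<^sup>\<dagger>
        = mat_powr A (1/2) * mat_powr C (t - a * \<delta>) * mat_powr A (1/2)"
    proof -
      have "K * mat_powr C (- (a * \<delta>)) * K\<^sup>\<dagger>
         = mat_powr A (1/2) * (mat_powr C (t/2) * mat_powr C (- (a * \<delta>)) * mat_powr C (t/2)) * mat_powr A (1/2)"
        unfolding Kadj unfolding K_def using cA cC by (simp add: assoc)
      thus ?thesis by (simp add: powr_sandwich[OF hC] algebra_simps)
    qed
    moreover have "loewner_le n \<dots> (mat_powr A (1/2) * mat_powr A (- 2 * (t - a * \<delta>)) * mat_powr A (1/2))"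
      by (rule loewner_congr_powr[OF Cpow cC cA hA]) (use a t a\<delta> in auto)
    moreover have "mat_powr A (1/2) * mat_powr A (- 2 * (t - a * \<delta>)) * mat_powr A (1/2) = mat_powr A (2 * ((a + 1) * \<delta>))"
    proof -
      have "1/2 + - 2 * (t - a * \<delta>) + 1/2 = 2 * ((a + 1) * \<delta>)" by (simp add: \<delta>_def field_simps)
      thus ?thesis unfolding powr_sandwich[OF hA] by simp
    qed
    ultimately show "loewner_le n (mat_powr W (a + 1)) (mat_powr A (2 * ((a + 1) * \<delta>)))"
      using loewner_le_trans by metis
    have "mat_powr Z (a + 1) = K\<^sup>\<dagger> * mat_powr W a * K"
      unfolding W_def Z_def using gram_powr_Suc[of "K\<^sup>\<dagger>" n a] K Zpd Z_def by simp
    moreover have "loewner_le n (K\<^sup>\<dagger> * mat_powr W a * K) (K\<^sup>\<dagger> * mat_powr A (2 * (a * \<delta>)) * K)"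
      using loewner_le_congr[of n "mat_powr W a" "mat_powr A (2 * (a * \<delta>))" K n] a(1) K cA powr_carrier[OF pd_herm[OF Wpd]]
      by (simp add: P_def)
    moreover have "K\<^sup>\<dagger> * mat_powr A (2 * (a * \<delta>)) * K
        = mat_powr C (t/2) * mat_powr A (2 * (1/2 + a * \<delta>)) * mat_powr C (t/2)"
    proof -
      have "K\<^sup>\<dagger> * mat_powr A (2 * (a * \<delta>)) * K
         = mat_powr C (t/2) * (mat_powr A (1/2) * mat_powr A (2 * (a * \<delta>)) * mat_powr A (1/2)) * mat_powr C (t/2)"
        unfolding Kadj unfolding K_def using cA cC by (simp add: assoc)
      thus ?thesis by (simp add: powr_sandwich[OF hA] algebra_simps)
    qed
    moreover have "loewner_le n \<dots> (mat_powr C (t/2) * mat_powr C (- (1/2 + a * \<delta>)) * mat_powr C (t/2))"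
      by (rule loewner_congr_powr[OF Apow cA cC hC]) (use a t a\<delta> in auto)
    moreover have "mat_powr C (t/2) * mat_powr C (- (1/2 + a * \<delta>)) * mat_powr C (t/2) = mat_powr C (- ((a + 1) * \<delta>))"
    proof -
      have "t/2 + - (1/2 + a * \<delta>) + t/2 = - ((a + 1) * \<delta>)" by (simp add: \<delta>_def field_simps)
      thus ?thesis unfolding powr_sandwich[OF hC] by simp
    qed
    ultimately show "loewner_le n (mat_powr Z (a + 1)) (mat_powr C (- ((a + 1) * \<delta>)))"
      using loewner_le_trans by metis
  qed
  have P0: "P 0" by (simp add: P_def powr_0[OF A] powr_0[OF C] powr_0[OF Wpd] powr_0[OF Zpd])
  have P1: "P 1" using step[OF P0] t by simp
  have Pr: "P r" if "0 \<le> r" "r \<le> 1" for r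
    unfolding P_def
  proof
    show "loewner_le n (mat_powr Z r) (mat_powr C (- (r * \<delta>)))"
      using loewner_heinz_neg[OF Zpd C _ that, of \<delta>] P1
      by (simp add: P_def powr_1[OF pd_psd[OF Zpd]] mult.commute)
    show "loewner_le n (mat_powr W r) (mat_powr A (2 * (r * \<delta>)))"
    proof -
      have "loewner_le n W (mat_powr A (- (- 2 * \<delta>)))" using P1 by (simp add: P_def powr_1[OF pd_psd[OF Wpd]])
      from loewner_heinz_neg[OF Wpd A this that] show ?thesis by (simp add: mult_ac)
    qed
  qed
  have Pn: "P (r + real k)" if "0 \<le> r" "r \<le> 1" "r + real k \<le> p" for r k
    using that(3)
  proof (induction k)
    case (Suc k)
    have "(r + real k + 1) * \<delta> \<le> p * \<delta>" using Suc.prems \<delta> by (intro mult_right_mono) auto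
    moreover have "(r + real k + 1) * \<delta> = (r + real k) * \<delta> + \<delta>" by (simp add: algebra_simps)
    moreover have "t = 1/2 - \<delta>" by (simp add: \<delta>_def)
    ultimately have "(r + real k) * \<delta> \<le> t" using \<delta>(2) by linarith
    from step[OF _ _ this] Suc that show ?case by (simp add: algebra_simps)
  qed (use Pr that in simp)
  have "P (frac p + real (nat \<lfloor>p\<rfloor>))"
  proof (rule Pn)
    show "0 \<le> frac p" "frac p \<le> 1" using frac_ge_0[of p] frac_lt_1[of p] by linarith+
    show "frac p + real (nat \<lfloor>p\<rfloor>) \<le> p" using p by (simp add: frac_def of_nat_nat)
  qed
  hence "P p" using p by (simp add: frac_def of_nat_nat)
  moreover have "2 * (p * \<delta>) = p * (1 - 2 * t)" by (simp add: \<delta>_def algebra_simps)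
  ultimately show ?thesis by (simp add: P_def W)
qed

section \<open>Weighted geometric means of positive definite matrices\<close>

lemma pd_geom_mean_pd:
  assumes "pd n A" "pd n B" shows "pd n (pd_geom_mean t A B)"
  unfolding pd_geom_mean_def using assms by (intro powr_congr_pd powr_pd) auto

text \<open>
With \<open>X = A^(-1/2) B^(1/2)\<close>, the mean of \<open>A\<close> and \<open>B\<close> contains \<open>X X*\<close> and that of \<open>B\<close> and \<open>A\<close> contains
the inverse of \<open>X* X\<close>; the two are related by \<open>gram_powr\<close>.
\<close>

lemma pd_geom_mean_commute:
  assumes A: "pd n A" and B: "pd n B"
  shows "pd_geom_mean (1 - t) B A = pd_geom_mean t A B"
proof -
  note hA = pd_herm[OF A] and hB = pd_herm[OF B]
  note cA = powr_carrier[OF hA] and cB = powr_carrier[OF hB]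
  note c = cA cB pd_carrier[OF A] pd_carrier[OF B]
  note assoc = assoc_mult_mat[of _ n n _ n _ n]
  have A1: "A = mat_powr A 1" and B1: "B = mat_powr B 1" using powr_1 pd_psd A B by metis+
  define X where "X = mat_powr A (-1/2) * mat_powr B (1/2)"
  have X: "X \<in> carrier_mat n n" using c by (simp add: X_def)
  have Xadj: "X\<^sup>\<dagger> = mat_powr B (1/2) * mat_powr A (-1/2)"
    unfolding X_def using cA cB adjoint_mult[of _ n n _ n] by (simp add: powr_adj[OF hA] powr_adj[OF hB])
  have XX: "X * X\<^sup>\<dagger> = mat_powr A (-1/2) * B * mat_powr A (-1/2)"
  proof -
    have "X * X\<^sup>\<dagger> = mat_powr A (-1/2) * (mat_powr B (1/2) * mat_powr B (1/2)) * mat_powr A (-1/2)"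
      unfolding Xadj unfolding X_def using c by (simp add: assoc)
    thus ?thesis by (simp add: powr_mult_powr[OF hB] B1[symmetric])
  qed
  define E where "E = mat_powr B (-1/2) * A * mat_powr B (-1/2)"
  have E: "pd n E" unfolding E_def by (rule powr_congr_pd[OF B A])
  \<comment> \<open>\<open>X* X = B^(1/2) A\<^sup>-\<^sup>1 B^(1/2)\<close> is the inverse of \<open>E\<close>\<close>
  have "E * (X\<^sup>\<dagger> * X) = 1\<^sub>m n"
  proof -
    have "E * (X\<^sup>\<dagger> * X) = mat_powr B (-1/2) * A * (mat_powr B (-1/2) * mat_powr B (1/2))
        * (mat_powr A (-1/2) * mat_powr A (-1/2)) * mat_powr B (1/2)"
      unfolding Xadj E_def unfolding X_def using c by (simp add: assoc)
    also have "\<dots> = mat_powr B (-1/2) * (mat_powr A 1 * mat_powr A (-1)) * mat_powr B (1/2)"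
      using c by (simp add: powr_mult_powr[OF hA] powr_mult_powr[OF hB] powr_0[OF B] right_mult_one_mat[of _ n n] assoc A1[symmetric])
    also have "\<dots> = 1\<^sub>m n"
      using c by (simp add: powr_mult_powr[OF hA] powr_mult_powr[OF hB] powr_0[OF A] powr_0[OF B] right_mult_one_mat[of _ n n])
    finally show ?thesis .
  qed
  hence "mat_powr E (-1) * E * (X\<^sup>\<dagger> * X) = mat_powr E (-1)"
    using powr_carrier[OF pd_herm[OF E]] pd_carrier[OF E] X by (simp add: assoc right_mult_one_mat[of _ n n])
  moreover have "mat_powr E (-1) * E = 1\<^sub>m n"
    using powr_inverse(1)[OF E, of 1] by (simp add: powr_1[OF pd_psd[OF E]])
  ultimately have "mat_powr E (-1) = X\<^sup>\<dagger> * X" using X by simp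
  hence Epow: "mat_powr E (1 - t) = mat_powr (X\<^sup>\<dagger> * X) (t - 1)"
    using mat_powr_powr[OF pd_herm[OF E], of "-1" "t - 1"] by simp
  have cXX: "mat_powr (X\<^sup>\<dagger> * X) (t - 1) \<in> carrier_mat n n" using powr_carrier gram_herm(1)[OF X] by blast
  have AX: "mat_powr A (1/2) * X = mat_powr B (1/2)"
  proof -
    have "mat_powr A (1/2) * X = (mat_powr A (1/2) * mat_powr A (-1/2)) * mat_powr B (1/2)"
      unfolding X_def using c by (simp add: assoc)
    thus ?thesis using c by (simp add: powr_mult_powr[OF hA] powr_0[OF A] left_mult_one_mat[of _ n n])
  qed
  have XA: "X\<^sup>\<dagger> * mat_powr A (1/2) = mat_powr B (1/2)"
    using arg_cong[OF AX, of mat_adjoint] adjoint_mult[OF cA X] by (simp add: powr_adj[OF hA] powr_adj[OF hB])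
  have "pd_geom_mean (1 - t) B A = mat_powr B (1/2) * mat_powr (X\<^sup>\<dagger> * X) (t - 1) * mat_powr B (1/2)"
    unfolding pd_geom_mean_def E_def[symmetric] Epow ..
  also have "\<dots> = mat_powr A (1/2) * (X * mat_powr (X\<^sup>\<dagger> * X) (t - 1) * X\<^sup>\<dagger>) * mat_powr A (1/2)"
    using c X cXX by (simp add: assoc XA) (simp add: assoc[symmetric] AX)
  also have "X * mat_powr (X\<^sup>\<dagger> * X) (t - 1) * X\<^sup>\<dagger> = mat_powr (X * X\<^sup>\<dagger>) t"
    using gram_powr_Suc[OF X, of "t - 1"] powr_congr_pd[OF A B, of "-1/2"] by (simp add: XX)
  finally show ?thesis by (simp add: pd_geom_mean_def XX)
qed

lemma pd_geom_mean_mono_right: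
  assumes A: "pd n A" and B: "pd n B" "pd n B'" and le: "loewner_le n B B'" and t: "0 \<le> t" "t \<le> 1"
  shows "loewner_le n (pd_geom_mean t A B) (pd_geom_mean t A B')"
proof -
  note hA = pd_herm[OF A]
  note pB = powr_congr_pd[OF A B(1), of "-1/2"] and pB' = powr_congr_pd[OF A B(2), of "-1/2"]
  have "loewner_le n (mat_powr A (-1/2) * B * mat_powr A (-1/2)) (mat_powr A (-1/2) * B' * mat_powr A (-1/2))"
    by (intro loewner_congr_powr le hA pd_carrier B)
  from loewner_heinz[OF pd_psd[OF pB] pB' this t] show ?thesis
    unfolding pd_geom_mean_def
    by (intro loewner_congr_powr hA powr_carrier pd_herm[OF pB] pd_herm[OF pB'])
qed

text \<open>
Monotonicity in the first argument is that in the second one after exchanging the arguments.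
\<close>

lemma pd_geom_mean_mono:
  assumes "pd n A" "pd n A'" "pd n B" "pd n B'" "loewner_le n A A'" "loewner_le n B B'" "0 \<le> t" "t \<le> 1"
  shows "loewner_le n (pd_geom_mean t A B) (pd_geom_mean t A' B')"
proof -
  have "loewner_le n (pd_geom_mean t A B) (pd_geom_mean t A B')"
    using assms by (intro pd_geom_mean_mono_right) auto
  also have "loewner_le n (pd_geom_mean t A B') (pd_geom_mean t A' B')"
    unfolding pd_geom_mean_commute[of n, symmetric, OF assms(1,4)] pd_geom_mean_commute[of n, symmetric, OF assms(2,4)]
    using assms by (intro pd_geom_mean_mono_right) auto
  finally show ?thesis .
qed

lemma smult_mult_smult:
  assumes "X \<in> carrier_mat n n" "Y \<in> carrier_mat n n"
  shows "(a \<cdot>\<^sub>m X) * (b \<cdot>\<^sub>m Y) = (a * b) \<cdot>\<^sub>m (X * Y :: complex mat)"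
proof -
  have "(a \<cdot>\<^sub>m X) * (b \<cdot>\<^sub>m Y) = b \<cdot>\<^sub>m (a \<cdot>\<^sub>m (X * Y))"
    using assms by (simp add: mult_smult_distrib[of _ n n _ n] mult_smult_assoc_mat[of _ n n _ n])
  also have "\<dots> = (a * b) \<cdot>\<^sub>m (X * Y)" by (rule eq_matI) auto
  finally show ?thesis .
qed

lemma pd_smult:
  assumes "pd n A" "0 < c" shows "pd n (complex_of_real c \<cdot>\<^sub>m A)"
  using assms(1)
proof (elim pd_spectral)
  fix U d assume "unitary_mat n U" "A = spectral n U d" "\<And>i. i < n \<Longrightarrow> 0 < d i"
  thus ?thesis using assms(2) by (auto simp: spectral_smult intro!: pd_spectralI)
qed

lemma smult_sandwich:
  assumes "X \<in> carrier_mat n n" "Y \<in> carrier_mat n n"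
  shows "(complex_of_real a \<cdot>\<^sub>m X) * (complex_of_real b \<cdot>\<^sub>m Y) * (complex_of_real a \<cdot>\<^sub>m X) = complex_of_real (a * a * b) \<cdot>\<^sub>m (X * Y * X)"
  using assms by (simp add: smult_mult_smult[of _ n] mult_ac)

lemma pd_geom_mean_smult:
  assumes A: "pd n A" and B: "pd n B" and c: "0 < c"
  shows "pd_geom_mean t (complex_of_real c \<cdot>\<^sub>m A) B = complex_of_real (c powr (1 - t)) \<cdot>\<^sub>m pd_geom_mean t A B"
proof -
  note hA = pd_herm[OF A]
  note cA = powr_carrier[OF hA]
  have pw: "mat_powr (complex_of_real c \<cdot>\<^sub>m A) r = complex_of_real (c powr r) \<cdot>\<^sub>m mat_powr A r" for r
    using powr_smult[OF pd_psd[OF A]] c by simp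
  let ?C = "mat_powr A (-1/2) * B * mat_powr A (-1/2)"
  have C: "pd n ?C" by (rule powr_congr_pd[OF A B])
  have "mat_powr (complex_of_real c \<cdot>\<^sub>m A) (-1/2) * B * mat_powr (complex_of_real c \<cdot>\<^sub>m A) (-1/2)
      = complex_of_real (c powr (-1)) \<cdot>\<^sub>m ?C"
    unfolding pw using smult_sandwich[OF cA pd_carrier[OF B], of "c powr (-1/2)" "-1/2" 1]
    by (simp add: powr_add[symmetric])
  note e1 = this
  have e2: "mat_powr (complex_of_real (c powr (-1)) \<cdot>\<^sub>m ?C) t = complex_of_real (c powr (- t)) \<cdot>\<^sub>m mat_powr ?C t"
    using powr_smult[OF pd_psd[OF C], of "c powr (-1)" t] by (simp only: powr_powr powr_ge_zero) simp
  have "pd_geom_mean t (complex_of_real c \<cdot>\<^sub>m A) B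
     = (complex_of_real (c powr (1/2)) \<cdot>\<^sub>m mat_powr A (1/2))
        * (complex_of_real (c powr (- t)) \<cdot>\<^sub>m mat_powr ?C t) * (complex_of_real (c powr (1/2)) \<cdot>\<^sub>m mat_powr A (1/2))"
    unfolding pd_geom_mean_def unfolding e1 e2 unfolding pw ..
  also have "\<dots> = complex_of_real (c powr (1/2) * c powr (1/2) * c powr (-t)) \<cdot>\<^sub>m pd_geom_mean t A B"
    unfolding smult_sandwich[OF cA powr_carrier[OF pd_herm[OF C]]] pd_geom_mean_def ..
  also have "c powr (1/2) * c powr (1/2) * c powr (-t) = c powr (1 - t)"
    unfolding powr_add[symmetric] by simp
  finally show ?thesis .
qed

text \<open>
The Hermitian matrix that stands in for the product \<open>A B\<close>: it has the same eigenvalues.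
\<close>

definition sym_prod :: "complex mat \<Rightarrow> complex mat \<Rightarrow> complex mat" where
  "sym_prod A B = mat_powr B (1/2) * A * mat_powr B (1/2)"

lemma sym_prod_psd: "psd n A \<Longrightarrow> psd n B \<Longrightarrow> psd n (sym_prod A B)"
  unfolding sym_prod_def by (rule powr_congr_psd[OF psd_herm])

lemma sym_prod_le_one:
  assumes A: "psd n A" and B: "pd n B"
  shows "loewner_le n (sym_prod A B) (1\<^sub>m n) \<longleftrightarrow> loewner_le n A (mat_powr B (-1))"
proof
  note hB = pd_herm[OF B] and cA = psd_carrier[OF A]
  note cB = powr_carrier[OF hB]
  assume "loewner_le n (sym_prod A B) (1\<^sub>m n)"
  hence "loewner_le n (mat_powr B (-1/2) * sym_prod A B * mat_powr B (-1/2)) (mat_powr B (-1/2) * 1\<^sub>m n * mat_powr B (-1/2))"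
    using cA cB by (intro loewner_congr_powr hB) (auto simp: sym_prod_def)
  moreover have "mat_powr B (-1/2) * sym_prod A B * mat_powr B (-1/2) = A"
    unfolding sym_prod_def by (rule powr_sandwich_cancel[OF B cA]) simp
  ultimately show "loewner_le n A (mat_powr B (-1))"
    by (simp add: right_mult_one_mat[OF cB] powr_mult_powr[OF hB])
next
  note hB = pd_herm[OF B] and cA = psd_carrier[OF A]
  note cB = powr_carrier[OF hB]
  assume "loewner_le n A (mat_powr B (-1))"
  hence "loewner_le n (sym_prod A B) (mat_powr B (1/2) * mat_powr B (-1) * mat_powr B (1/2))"
    unfolding sym_prod_def using cA cB by (intro loewner_congr_powr hB) auto
  thus "loewner_le n (sym_prod A B) (1\<^sub>m n)" by (simp add: powr_sandwich[OF hB] powr_0[OF B])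
qed

text \<open>
The bootstrap, restated for the geometric mean: the matrix \<open>C = A^(-1/2) B A^(-1/2)\<close> inherits
\<open>C \<le> A\<^sup>-\<^sup>2\<close> from \<open>B \<le> A\<^sup>-\<^sup>1\<close>.
\<close>

lemma pd_geom_mean_powr_le:
  assumes A: "pd n A" and B: "pd n B" and le: "loewner_le n B (mat_powr A (-1))"
    and t: "0 \<le> t" "t \<le> 1/2" and p: "0 \<le> p" "p * (1 - 2 * t) \<le> 1"
  shows "loewner_le n (mat_powr (pd_geom_mean t A B) p) (mat_powr A (p * (1 - 2 * t)))"
  unfolding pd_geom_mean_def
proof (rule furuta_bootstrap[OF A powr_congr_pd[OF A B] _ t p])
  have "loewner_le n (mat_powr A (-1/2) * B * mat_powr A (-1/2)) (mat_powr A (-1/2) * mat_powr A (-1) * mat_powr A (-1/2))"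
    by (intro loewner_congr_powr le powr_carrier pd_carrier[OF B] pd_herm[OF A])
  thus "loewner_le n (mat_powr A (-1/2) * B * mat_powr A (-1/2)) (mat_powr A (-2))"
    by (simp add: powr_sandwich[OF pd_herm[OF A]])
qed

text \<open>
Both powers are bounded by the bootstrap, the second one after exchanging \<open>A\<close> and \<open>B\<close>, and
\<open>B^\<theta> \<le> A^(-\<theta>)\<close> connects the two bounds.
\<close>

lemma geom_mean_norm_bound_one:
  assumes A: "pd n A" and B: "pd n B" and le: "loewner_le n (sym_prod A B) (1\<^sub>m n)"
    and t: "0 \<le> t" "t \<le> 1/2" and p: "0 \<le> p" "p * (1 - 2 * t) \<le> 1"
  shows "loewner_le n (sym_prod (mat_powr (pd_geom_mean t A B) p) (mat_powr (pd_geom_mean (1 - t) A B) p)) (1\<^sub>m n)"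
proof -
  define \<theta> where "\<theta> = p * (1 - 2 * t)"
  have \<theta>: "0 \<le> \<theta>" "\<theta> \<le> 1" using t p by (auto simp: \<theta>_def)
  note P = powr_pd[OF pd_geom_mean_pd[OF A B], of t p]
  note Q = powr_pd[OF pd_geom_mean_pd[OF A B], of "1 - t" p]
  have AB: "loewner_le n A (mat_powr B (-1))" using le sym_prod_le_one[OF pd_psd[OF A] B] by simp
  have BA: "loewner_le n B (mat_powr A (-1))"
    using loewner_inverse_antimono[OF A powr_pd[OF B] AB] by (simp add: mat_powr_powr[OF pd_herm[OF B]] powr_1[OF pd_psd[OF B]])
  have "loewner_le n (mat_powr (pd_geom_mean (1 - t) A B) p) (mat_powr B \<theta>)"
    using pd_geom_mean_powr_le[OF B A AB t p] pd_geom_mean_commute[OF B A, of t] by (simp add: \<theta>_def)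
  also have "loewner_le n (mat_powr B \<theta>) (mat_powr A (- \<theta>))"
    using loewner_heinz_neg[OF B A BA \<theta>] by simp
  finally have "loewner_le n (mat_powr (mat_powr A (- \<theta>)) (-1)) (mat_powr (mat_powr (pd_geom_mean (1 - t) A B) p) (-1))"
    by (intro loewner_inverse_antimono Q powr_pd[OF A])
  hence "loewner_le n (mat_powr A \<theta>) (mat_powr (mat_powr (pd_geom_mean (1 - t) A B) p) (-1))"
    by (simp add: mat_powr_powr[OF pd_herm[OF A]])
  with pd_geom_mean_powr_le[OF A B BA t p, folded \<theta>_def]
  have "loewner_le n (mat_powr (pd_geom_mean t A B) p) (mat_powr (mat_powr (pd_geom_mean (1 - t) A B) p) (-1))"
    by (rule loewner_le_trans)
  thus ?thesis using sym_prod_le_one[OF pd_psd[OF P] Q] by simp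
qed

lemma loewner_le_smult_iff:
  assumes "A \<in> carrier_mat n n" "B \<in> carrier_mat n n" "0 < c"
  shows "loewner_le n (complex_of_real c \<cdot>\<^sub>m A) (complex_of_real c \<cdot>\<^sub>m B) \<longleftrightarrow> loewner_le n A B"
  using assms by (simp add: loewner_le_def qform_smult)

lemma sym_prod_smult:
  assumes A: "psd n A" and B: "psd n B" and ab: "0 \<le> b"
  shows "sym_prod (complex_of_real a \<cdot>\<^sub>m A) (complex_of_real b \<cdot>\<^sub>m B) = complex_of_real (a * b) \<cdot>\<^sub>m sym_prod A B"
  unfolding sym_prod_def powr_smult[OF B ab]
    smult_sandwich[OF powr_carrier[OF psd_herm[OF B]] psd_carrier[OF A]]
  using ab by (simp add: powr_add[symmetric] powr_half_sqrt mult.commute)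

text \<open>
Dividing \<open>A\<close> by \<open>c\<close> reduces to the case \<open>c = 1\<close>: the two means are homogeneous in \<open>A\<close> of degrees
\<open>1 - t\<close> and \<open>t\<close>, so the product of their \<open>p\<close>-th powers is homogeneous of degree \<open>p\<close>.
\<close>

theorem geom_mean_norm_bound:
  assumes A: "pd n A" and B: "pd n B" and c: "0 < c"
    and le: "loewner_le n (sym_prod A B) (complex_of_real c \<cdot>\<^sub>m 1\<^sub>m n)"
    and t: "0 \<le> t" "t \<le> 1/2" and p: "0 \<le> p" "p * (1 - 2 * t) \<le> 1"
  shows "loewner_le n (sym_prod (mat_powr (pd_geom_mean t A B) p) (mat_powr (pd_geom_mean (1 - t) A B) p))
           (complex_of_real (c powr p) \<cdot>\<^sub>m 1\<^sub>m n)"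
proof -
  define A' where "A' = complex_of_real (1 / c) \<cdot>\<^sub>m A"
  have A': "pd n A'" unfolding A'_def using c by (intro pd_smult A) auto
  note G = pd_geom_mean_pd[OF A B]
  note P = powr_pd[OF G, of t p] and Q = powr_pd[OF G, of "1 - t" p]
  have cS: "sym_prod A B \<in> carrier_mat n n" using sym_prod_psd A B pd_psd psd_carrier by blast
  have "sym_prod A' B = complex_of_real (1 / c) \<cdot>\<^sub>m sym_prod A B"
    unfolding A'_def using sym_prod_smult[OF pd_psd[OF A] pd_psd[OF B], of 1 "1 / c"] by simp
  moreover have "1\<^sub>m n = complex_of_real (1 / c) \<cdot>\<^sub>m (complex_of_real c \<cdot>\<^sub>m 1\<^sub>m n)"
    by (rule eq_matI) (use c in auto)
  ultimately have "loewner_le n (sym_prod A' B) (1\<^sub>m n)"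
    using loewner_le_smult_iff[of "sym_prod A B" n "complex_of_real c \<cdot>\<^sub>m 1\<^sub>m n" "1 / c"] le c cS by simp
  from geom_mean_norm_bound_one[OF A' B this t p]
  have 1: "loewner_le n (sym_prod (mat_powr (pd_geom_mean t A' B) p) (mat_powr (pd_geom_mean (1 - t) A' B) p)) (1\<^sub>m n)" .
  have pw: "mat_powr (pd_geom_mean s A' B) p = complex_of_real (((1 / c) powr (1 - s)) powr p) \<cdot>\<^sub>m mat_powr (pd_geom_mean s A B) p" for s
    unfolding A'_def using c by (subst pd_geom_mean_smult[OF A B]) (auto simp: powr_smult[OF pd_psd[OF G]])
  have "((1 / c) powr (1 - t)) powr p * ((1 / c) powr (1 - (1 - t))) powr p = (1 / c) powr p"
    using c by (simp add: powr_powr powr_add[symmetric] algebra_simps)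
  hence "sym_prod (mat_powr (pd_geom_mean t A' B) p) (mat_powr (pd_geom_mean (1 - t) A' B) p)
     = complex_of_real ((1 / c) powr p) \<cdot>\<^sub>m sym_prod (mat_powr (pd_geom_mean t A B) p) (mat_powr (pd_geom_mean (1 - t) A B) p)"
    unfolding pw by (subst sym_prod_smult[OF pd_psd[OF P] pd_psd[OF Q]]) auto
  moreover have "1\<^sub>m n = complex_of_real ((1 / c) powr p) \<cdot>\<^sub>m (complex_of_real (c powr p) \<cdot>\<^sub>m 1\<^sub>m n)"
    by (rule eq_matI) (use c in \<open>auto simp: powr_divide\<close>)
  moreover have "sym_prod (mat_powr (pd_geom_mean t A B) p) (mat_powr (pd_geom_mean (1 - t) A B) p) \<in> carrier_mat n n"
    using sym_prod_psd P Q pd_psd psd_carrier by blast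
  ultimately show ?thesis
    using loewner_le_smult_iff[of "sym_prod (mat_powr (pd_geom_mean t A B) p) (mat_powr (pd_geom_mean (1 - t) A B) p)" n
        "complex_of_real (c powr p) \<cdot>\<^sub>m 1\<^sub>m n" "(1 / c) powr p"] 1 c by simp
qed

section \<open>Compound matrices\<close>

text \<open>
Sets of \<open>k\<close> row or column indices, represented by their increasing enumerations.
\<close>

definition incr_lists :: "nat \<Rightarrow> nat \<Rightarrow> nat list set" where
  "incr_lists n k = {xs. sorted_wrt (<) xs \<and> length xs = k \<and> set xs \<subseteq> {..<n}}"

definition minor :: "nat \<Rightarrow> complex mat \<Rightarrow> nat list \<Rightarrow> nat list \<Rightarrow> complex" where
  "minor k A I J = det (mat k k (\<lambda>(i, j). A $$ (I ! i, J ! j)))"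

lemma finite_incr_lists: "finite (incr_lists n k)"
  by (rule finite_subset[OF _ finite_lists_length_eq[of "{..<n}" k]]) (auto simp: incr_lists_def)

lemma incr_listsD:
  assumes "L \<in> incr_lists n k"
  shows "length L = k" "distinct L" "sorted L" "\<And>i. i < k \<Longrightarrow> L ! i < n"
  using assms by (auto simp: incr_lists_def strict_sorted_iff subset_eq all_set_conv_all_nth)

lemma incr_lists_eqI:
  assumes "L \<in> incr_lists n k" "M \<in> incr_lists n k" "set L = set M" shows "L = M"
  using assms incr_listsD sorted_distinct_set_unique by metis

text \<open>
The maps from \<open>{0..<k}\<close> onto \<open>set L\<close> are the enumeration \<open>L\<close> preceded by a permutation. Maps are
extended by the identity outside \<open>{0..<k}\<close>, so that they match the index set of the row expansion
\<open>det_linear_rows_sum\<close>.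
\<close>

lemma sum_permutations_of_list:
  assumes L: "distinct L" "length L = k" "set L \<subseteq> {0..<n}"
  shows "(\<Sum>f | f \<in> {f. (\<forall>i\<in>{0..<k}. f i \<in> {0..<n}) \<and> (\<forall>i. i \<notin> {0..<k} \<longrightarrow> f i = i)} \<and> f ` {0..<k} = set L. h f)
       = (\<Sum>\<sigma> | \<sigma> permutes {0..<k}. h (\<lambda>i. if i < k then L ! \<sigma> i else i))"
proof (rule sum.reindex_bij_witness[symmetric,
    where j = "\<lambda>\<sigma> i. if i < k then L ! \<sigma> i else i"
      and i = "\<lambda>f i. if i < k then inv_into {0..<k} ((!) L) (f i) else i"])
  have bij: "bij_betw ((!) L) {0..<k} (set L)" 
    using bij_betw_nth[OF L(1), of "{0..<k}" "set L"] L(2) by (simp add: lessThan_atLeast0)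
  have inj: "inj_on ((!) L) {0..<k}" using bij by (rule bij_betw_imp_inj_on)
  show "(\<lambda>i. if i < k then inv_into {0..<k} ((!) L) ((\<lambda>i. if i < k then L ! \<sigma> i else i) i) else i) = \<sigma>"
    if "\<sigma> \<in> {\<sigma>. \<sigma> permutes {0..<k}}" for \<sigma>
  proof
    fix i
    show "(if i < k then inv_into {0..<k} ((!) L) ((\<lambda>i. if i < k then L ! \<sigma> i else i) i) else i) = \<sigma> i"
      using that inv_into_f_f[OF inj, of "\<sigma> i"] permutes_in_image[of \<sigma> "{0..<k}" i] permutes_not_in[of \<sigma> "{0..<k}" i] by auto
  qed
  show "(\<lambda>i. if i < k then L ! \<sigma> i else i) \<in> {f \<in> {f. (\<forall>i\<in>{0..<k}. f i \<in> {0..<n}) \<and> (\<forall>i. i \<notin> {0..<k} \<longrightarrow> f i = i)}. f ` {0..<k} = set L}"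
    if "\<sigma> \<in> {\<sigma>. \<sigma> permutes {0..<k}}" for \<sigma>
  proof -
    have \<sigma>: "\<sigma> permutes {0..<k}" using that by simp
    have "(\<lambda>i. if i < k then L ! \<sigma> i else i) ` {0..<k} = (!) L ` (\<sigma> ` {0..<k})" by (force simp: image_iff)
    also have "\<dots> = set L" using permutes_image[OF \<sigma>] bij by (simp add: bij_betw_imp_surj_on)
    finally have im: "(\<lambda>i. if i < k then L ! \<sigma> i else i) ` {0..<k} = set L" .
    have "(if i < k then L ! \<sigma> i else i) \<in> {0..<n}" if "i \<in> {0..<k}" for i
      using im L(3) that by blast
    thus ?thesis using im by simp
  qed
  fix f assume f: "f \<in> {f \<in> {f. (\<forall>i\<in>{0..<k}. f i \<in> {0..<n}) \<and> (\<forall>i. i \<notin> {0..<k} \<longrightarrow> f i = i)}. f ` {0..<k} = set L}"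
  hence im: "f ` {0..<k} = set L" and id: "\<And>i. \<not> i < k \<Longrightarrow> f i = i" by auto
  show "(\<lambda>i. if i < k then L ! (if i < k then inv_into {0..<k} ((!) L) (f i) else i) else i) = f"
  proof
    fix i
    show "(if i < k then L ! (if i < k then inv_into {0..<k} ((!) L) (f i) else i) else i) = f i"
      using im imageI[of i "{0..<k}" f] id[of i] bij f_inv_into_f[of "f i" "(!) L" "{0..<k}"] by (auto simp: bij_betw_imp_surj_on)
  qed
  have "card (f ` {0..<k}) = card {0..<k}" using im L by (simp add: distinct_card)
  hence "inj_on f {0..<k}" by (intro eq_card_imp_inj_on) auto
  hence "bij_betw f {0..<k} (set L)" using im by (simp add: bij_betw_def)
  hence b: "bij_betw (inv_into {0..<k} ((!) L) \<circ> f) {0..<k} {0..<k}"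
    using bij_betw_inv_into[OF bij] by (rule bij_betw_trans)
  have "bij_betw (\<lambda>i. if i < k then inv_into {0..<k} ((!) L) (f i) else i) {0..<k} {0..<k}"
    using b by (subst bij_betw_cong[where g = "inv_into {0..<k} ((!) L) \<circ> f"]) auto
  thus "(\<lambda>i. if i < k then inv_into {0..<k} ((!) L) (f i) else i) \<in> {\<sigma>. \<sigma> permutes {0..<k}}"
    by (auto intro!: bij_imp_permutes)
qed simp

text \<open>
Expand the minor of \<open>A B\<close> multilinearly in its rows; the summands are indexed by maps \<open>f\<close> from
\<open>{0..<k}\<close> to \<open>{0..<n}\<close>. A map that is not injective contributes a determinant with two equal rows.
The injective maps with a given image \<open>L\<close> differ by permutations, and summing over these yields
the Leibniz expansion of the minor of \<open>A\<close>.
\<close>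

theorem cauchy_binet:
  assumes A: "A \<in> carrier_mat n n" and B: "B \<in> carrier_mat n n"
    and I: "I \<in> incr_lists n k" and J: "J \<in> incr_lists n k"
  shows "minor k (A * B) I J = (\<Sum>L\<in>incr_lists n k. minor k A I L * minor k B L J)"
proof -
  note I' = incr_listsD[OF I] and J' = incr_listsD[OF J]
  let ?F = "{f. (\<forall>i\<in>{0..<k}. f i \<in> {0..<n}) \<and> (\<forall>i. i \<notin> {0..<k} \<longrightarrow> f i = i)}"
  have finF: "finite ?F" by (rule finite_bounded_functions) auto
  define b where "b l = vec k (\<lambda>j. B $$ (l, J ! j))" for l
  define g where "g f = (\<Prod>i = 0..<k. A $$ (I ! i, f i)) * det (mat\<^sub>r k k (\<lambda>i. b (f i)))" for f :: "nat \<Rightarrow> nat"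
  have "mat k k (\<lambda>(i, j). (A * B) $$ (I ! i, J ! j))
      = mat\<^sub>r k k (\<lambda>i. finsum_vec TYPE(complex) k (\<lambda>l. A $$ (I ! i, l) \<cdot>\<^sub>v b l) {0..<n})"
  proof (rule eq_matI)
    fix i j
    assume "i < dim_row (mat\<^sub>r k k (\<lambda>i. finsum_vec TYPE(complex) k (\<lambda>l. A $$ (I ! i, l) \<cdot>\<^sub>v b l) {0..<n}))"
      "j < dim_col (mat\<^sub>r k k (\<lambda>i. finsum_vec TYPE(complex) k (\<lambda>l. A $$ (I ! i, l) \<cdot>\<^sub>v b l) {0..<n}))"
    hence ij: "i < k" "j < k" by auto
    hence "I ! i < n" "J ! j < n" using I' J' by auto
    thus "mat k k (\<lambda>(i, j). (A * B) $$ (I ! i, J ! j)) $$ (i, j)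
      = mat\<^sub>r k k (\<lambda>i. finsum_vec TYPE(complex) k (\<lambda>l. A $$ (I ! i, l) \<cdot>\<^sub>v b l) {0..<n}) $$ (i, j)"
      using ij A B by (simp, subst index_finsum_vec) (auto simp: b_def scalar_prod_def)
  qed auto
  hence "minor k (A * B) I J = (\<Sum>f\<in>?F. det (mat\<^sub>r k k (\<lambda>i. A $$ (I ! i, f i) \<cdot>\<^sub>v b (f i))))"
    unfolding minor_def by (simp, subst det_linear_rows_sum) (auto simp: b_def)
  also have "\<dots> = (\<Sum>f\<in>?F. g f)"
    unfolding g_def by (rule sum.cong[OF refl], rule det_rows_mul) (auto simp: b_def)
  also have "\<dots> = (\<Sum>f | f \<in> ?F \<and> inj_on f {0..<k}. g f)"
  proof (rule sum.mono_neutral_right[OF finF])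
    show "\<forall>f\<in>?F - {f \<in> ?F. inj_on f {0..<k}}. g f = 0"
    proof
      fix f assume "f \<in> ?F - {f \<in> ?F. inj_on f {0..<k}}"
      then obtain i j where ij: "i < k" "j < k" "i \<noteq> j" "f i = f j" by (auto simp: inj_on_def)
      have "det (mat\<^sub>r k k (\<lambda>i. b (f i))) = 0"
        by (rule det_identical_rows[of _ k i j]) (use ij in \<open>auto simp: b_def\<close>)
      thus "g f = 0" by (simp add: g_def)
    qed
  qed auto
  also have "\<dots> = (\<Sum>L\<in>incr_lists n k. \<Sum>f | f \<in> {f. f \<in> ?F \<and> inj_on f {0..<k}} \<and> sorted_list_of_set (f ` {0..<k}) = L. g f)"
  proof (rule sum.group[symmetric])
    show "finite {f. f \<in> ?F \<and> inj_on f {0..<k}}" by (rule finite_subset[OF _ finF]) auto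
    show "(\<lambda>f. sorted_list_of_set (f ` {0..<k})) ` {f. f \<in> ?F \<and> inj_on f {0..<k}} \<subseteq> incr_lists n k"
      by (auto simp: incr_lists_def card_image)
  qed (rule finite_incr_lists)
  also have "\<dots> = (\<Sum>L\<in>incr_lists n k. minor k A I L * minor k B L J)"
  proof (rule sum.cong[OF refl])
    fix L assume L: "L \<in> incr_lists n k"
    note L' = incr_listsD[OF L]
    have setL: "set L \<subseteq> {0..<n}" using L by (auto simp: incr_lists_def)
    have key: "inj_on f {0..<k} \<and> sorted_list_of_set (f ` {0..<k}) = L \<longleftrightarrow> f ` {0..<k} = set L" for f
    proof
      assume *: "f ` {0..<k} = set L"
      have "card (f ` {0..<k}) = card {0..<k}" using * L' by (simp add: distinct_card)
      hence "inj_on f {0..<k}" by (intro eq_card_imp_inj_on) auto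
      thus "inj_on f {0..<k} \<and> sorted_list_of_set (f ` {0..<k}) = L"
        using * L' by (simp add: sorted_list_of_set.idem_if_sorted_distinct)
    qed auto
    have "{f. f \<in> {f. f \<in> ?F \<and> inj_on f {0..<k}} \<and> sorted_list_of_set (f ` {0..<k}) = L}
        = {f. f \<in> ?F \<and> f ` {0..<k} = set L}"
      unfolding mem_Collect_eq conj_assoc key ..
    hence "(\<Sum>f | f \<in> {f. f \<in> ?F \<and> inj_on f {0..<k}} \<and> sorted_list_of_set (f ` {0..<k}) = L. g f)
        = (\<Sum>\<sigma> | \<sigma> permutes {0..<k}. g (\<lambda>i. if i < k then L ! \<sigma> i else i))"
      using sum_permutations_of_list[OF L'(2) L'(1) setL, of g] by simp
    also have "\<dots> = (\<Sum>\<sigma> | \<sigma> permutes {0..<k}. (signof \<sigma> * (\<Prod>i = 0..<k. mat k k (\<lambda>(i, j). A $$ (I ! i, L ! j)) $$ (i, \<sigma> i))) * minor k B L J)"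
    proof (rule sum.cong[OF refl])
      fix \<sigma> assume "\<sigma> \<in> {\<sigma>. \<sigma> permutes {0..<k}}"
      hence \<sigma>: "\<sigma> permutes {0..<k}" by simp
      have \<sigma>k: "\<sigma> i < k" if "i < k" for i using permutes_in_image[OF \<sigma>, of i] that by simp
      have "mat\<^sub>r k k (\<lambda>i. b (if i < k then L ! \<sigma> i else i))
          = mat k k (\<lambda>(i, j). mat k k (\<lambda>(i, j). B $$ (L ! i, J ! j)) $$ (\<sigma> i, j))"
        by (rule eq_matI) (auto simp: b_def \<sigma>k)
      hence "det (mat\<^sub>r k k (\<lambda>i. b (if i < k then L ! \<sigma> i else i))) = signof \<sigma> * minor k B L J"
        unfolding minor_def by (simp add: det_permute_rows[OF _ \<sigma>])
      moreover have "(\<Prod>i = 0..<k. A $$ (I ! i, if i < k then L ! \<sigma> i else i))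
          = (\<Prod>i = 0..<k. mat k k (\<lambda>(i, j). A $$ (I ! i, L ! j)) $$ (i, \<sigma> i))"
        by (rule prod.cong) (auto simp: \<sigma>k)
      ultimately show "g (\<lambda>i. if i < k then L ! \<sigma> i else i)
          = (signof \<sigma> * (\<Prod>i = 0..<k. mat k k (\<lambda>(i, j). A $$ (I ! i, L ! j)) $$ (i, \<sigma> i))) * minor k B L J"
        by (simp add: g_def)
    qed
    also have "\<dots> = minor k A I L * minor k B L J"
      unfolding sum_distrib_right[symmetric] minor_def by (subst det_def'[of _ k]) auto
    finally show "(\<Sum>f | f \<in> {f. f \<in> ?F \<and> inj_on f {0..<k}} \<and> sorted_list_of_set (f ` {0..<k}) = L. g f)
        = minor k A I L * minor k B L J" .
  qed
  finally show ?thesis .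
qed

text \<open>
Any fixed numbering of the index sets will do.
\<close>

definition incr_enum :: "nat \<Rightarrow> nat \<Rightarrow> nat list list" where
  "incr_enum n k = (SOME xs. distinct xs \<and> set xs = incr_lists n k)"

abbreviation compound_dim :: "nat \<Rightarrow> nat \<Rightarrow> nat" where
  "compound_dim n k \<equiv> length (incr_enum n k)"

definition compound :: "nat \<Rightarrow> nat \<Rightarrow> complex mat \<Rightarrow> complex mat" where
  "compound n k A = mat (compound_dim n k) (compound_dim n k)
     (\<lambda>(a, b). minor k A (incr_enum n k ! a) (incr_enum n k ! b))"

lemma incr_enum: "distinct (incr_enum n k)" "set (incr_enum n k) = incr_lists n k"
proof -
  have "\<exists>xs. distinct xs \<and> set xs = incr_lists n k"
    using finite_distinct_list[OF finite_incr_lists] by blast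
  from someI_ex[OF this] show "distinct (incr_enum n k)" "set (incr_enum n k) = incr_lists n k"
    by (auto simp: incr_enum_def)
qed

lemma incr_enum_nth: "a < compound_dim n k \<Longrightarrow> incr_enum n k ! a \<in> incr_lists n k"
  using incr_enum(2) nth_mem by blast

lemma sum_incr_enum: "(\<Sum>a<compound_dim n k. f (incr_enum n k ! a)) = (\<Sum>L\<in>incr_lists n k. f L)"
  by (rule sum.reindex_bij_betw, rule bij_betw_nth) (auto simp: incr_enum)

lemma compound_carrier [simp]: "compound n k A \<in> carrier_mat (compound_dim n k) (compound_dim n k)"
  by (simp add: compound_def)

lemma compound_mult:
  assumes "A \<in> carrier_mat n n" "B \<in> carrier_mat n n"
  shows "compound n k (A * B) = compound n k A * compound n k B"
proof (rule eq_matI)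
  fix a b assume "a < dim_row (compound n k A * compound n k B)" "b < dim_col (compound n k A * compound n k B)"
  hence ab: "a < compound_dim n k" "b < compound_dim n k" by (auto simp: compound_def)
  let ?I = "incr_enum n k ! a" and ?J = "incr_enum n k ! b"
  have "(compound n k A * compound n k B) $$ (a, b)
      = (\<Sum>c<compound_dim n k. minor k A ?I (incr_enum n k ! c) * minor k B (incr_enum n k ! c) ?J)"
    using ab by (simp add: compound_def scalar_prod_def lessThan_atLeast0)
  also have "\<dots> = minor k (A * B) ?I ?J"
    using cauchy_binet[OF assms incr_enum_nth[OF ab(1)] incr_enum_nth[OF ab(2)]]
      sum_incr_enum[of "\<lambda>L. minor k A ?I L * minor k B L ?J" n k] by simp
  finally show "compound n k (A * B) $$ (a, b) = (compound n k A * compound n k B) $$ (a, b)"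
    using ab by (simp add: compound_def)
qed (auto simp: compound_def)

lemma det_adjoint:
  assumes M: "M \<in> carrier_mat k k" shows "det (M\<^sup>\<dagger>) = cnj (det M)"
proof -
  have T: "transpose_mat M \<in> carrier_mat k k" using M by simp
  have "cnj (det M) = cnj (det (transpose_mat M))" by (simp add: det_transpose[OF M])
  also have "\<dots> = (\<Sum>p | p permutes {0..<k}. cnj (signof p * (\<Prod>i = 0..<k. transpose_mat M $$ (i, p i))))"
    unfolding det_def'[OF T] by simp
  also have "\<dots> = (\<Sum>p | p permutes {0..<k}. signof p * (\<Prod>i = 0..<k. M\<^sup>\<dagger> $$ (i, p i)))"
  proof (rule sum.cong[OF refl])
    fix p assume "p \<in> {p. p permutes {0..<k}}"
    hence pk: "p i < k" if "i < k" for i using permutes_in_image[of p "{0..<k}" i] that by simp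
    have "cnj (\<Prod>i = 0..<k. transpose_mat M $$ (i, p i)) = (\<Prod>i = 0..<k. M\<^sup>\<dagger> $$ (i, p i))"
      unfolding cnj_prod by (rule prod.cong) (use M pk in auto)
    thus "cnj (signof p * (\<Prod>i = 0..<k. transpose_mat M $$ (i, p i))) = signof p * (\<Prod>i = 0..<k. M\<^sup>\<dagger> $$ (i, p i))"
      by (simp add: sign_def)
  qed
  also have "\<dots> = det (M\<^sup>\<dagger>)" using M by (simp add: det_def'[of _ k])
  finally show ?thesis by simp
qed

lemma compound_adjoint:
  assumes A: "A \<in> carrier_mat n n" shows "compound n k (A\<^sup>\<dagger>) = (compound n k A)\<^sup>\<dagger>"
proof (rule eq_matI)
  fix a b assume "a < dim_row ((compound n k A)\<^sup>\<dagger>)" "b < dim_col ((compound n k A)\<^sup>\<dagger>)"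
  hence ab: "a < compound_dim n k" "b < compound_dim n k" by (auto simp: compound_def)
  let ?I = "incr_enum n k ! a" and ?J = "incr_enum n k ! b"
  have IJ: "i < k \<Longrightarrow> ?I ! i < n" "i < k \<Longrightarrow> ?J ! i < n" for i
    using incr_listsD(4)[OF incr_enum_nth[OF ab(1)]] incr_listsD(4)[OF incr_enum_nth[OF ab(2)]] by auto
  have "mat k k (\<lambda>(i, j). A\<^sup>\<dagger> $$ (?I ! i, ?J ! j)) = (mat k k (\<lambda>(i, j). A $$ (?J ! i, ?I ! j)))\<^sup>\<dagger>"
    by (rule eq_matI) (use A IJ in auto)
  thus "compound n k (A\<^sup>\<dagger>) $$ (a, b) = (compound n k A)\<^sup>\<dagger> $$ (a, b)"
    using ab by (simp add: compound_def minor_def det_adjoint[of _ k])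
qed (auto simp: compound_def)

text \<open>
For distinct index sets \<open>I\<close> and \<open>J\<close> some element of \<open>I\<close> is missing from \<open>J\<close>, so the corresponding
row of the minor vanishes.
\<close>

lemma compound_mat_diag:
  "compound n k (mat_diag n f) = mat_diag (compound_dim n k) (\<lambda>a. \<Prod>i<k. f (incr_enum n k ! a ! i))"
proof (rule eq_matI)
  fix a b
  assume "a < dim_row (mat_diag (compound_dim n k) (\<lambda>a. \<Prod>i<k. f (incr_enum n k ! a ! i)))"
    "b < dim_col (mat_diag (compound_dim n k) (\<lambda>a. \<Prod>i<k. f (incr_enum n k ! a ! i)))"
  hence ab: "a < compound_dim n k" "b < compound_dim n k" by (auto simp: mat_diag_def)
  let ?I = "incr_enum n k ! a" and ?J = "incr_enum n k ! b"
  note I = incr_enum_nth[OF ab(1)] and J = incr_enum_nth[OF ab(2)]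
  note I' = incr_listsD[OF I] and J' = incr_listsD[OF J]
  have "minor k (mat_diag n f) ?I ?J = (if a = b then \<Prod>i<k. f (?J ! i) else 0)"
  proof (cases "a = b")
    case True
    have "mat k k (\<lambda>(i, j). mat_diag n f $$ (?J ! i, ?J ! j)) = mat_diag k (\<lambda>i. f (?J ! i))"
      by (rule eq_matI) (use J' in \<open>auto simp: mat_diag_def nth_eq_iff_index_eq\<close>)
    thus ?thesis using True by (simp add: minor_def det_mat_diag)
  next
    case False
    hence "?I \<noteq> ?J" using ab incr_enum(1) nth_eq_iff_index_eq by blast
    hence ne: "set ?I \<noteq> set ?J" using incr_lists_eqI[OF I J] by blast
    have "\<not> set ?I \<subseteq> set ?J"
    proof
      assume "set ?I \<subseteq> set ?J"
      moreover have "card (set ?I) = card (set ?J)" using I' J' by (simp add: distinct_card)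
      ultimately show False using ne card_subset_eq[of "set ?J" "set ?I"] by simp
    qed
    then obtain i where i: "i < k" "?I ! i \<notin> set ?J" using I' by (metis in_set_conv_nth subsetI)
    let ?M = "mat k k (\<lambda>(i, j). mat_diag n f $$ (?I ! i, ?J ! j))"
    have "?M $$ (i, j) = 0" if "j < k" for j
    proof -
      have "?I ! i \<noteq> ?J ! j" using i(2) J'(1) that by (metis nth_mem)
      thus ?thesis using i(1) that I' J' by (simp add: mat_diag_def)
    qed
    hence 0: "(\<Prod>l = 0..<k. ?M $$ (l, p l)) = 0" if "p permutes {0..<k}" for p
      using i(1) permutes_in_image[OF that, of i] by (intro prod_zero) (auto intro!: bexI[of _ i])
    have "det ?M = (\<Sum>p | p permutes {0..<k}. signof p * (\<Prod>l = 0..<k. ?M $$ (l, p l)))"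
      by (rule det_def') simp
    also have "\<dots> = 0" by (intro sum.neutral ballI) (simp only: mem_Collect_eq 0 mult_zero_right)
    finally have "det ?M = 0" .
    thus ?thesis using False by (simp add: minor_def)
  qed
  thus "compound n k (mat_diag n f) $$ (a, b) = mat_diag (compound_dim n k) (\<lambda>a. \<Prod>i<k. f (incr_enum n k ! a ! i)) $$ (a, b)"
    using ab by (simp add: compound_def mat_diag_def)
qed (auto simp: compound_def mat_diag_def)

lemma compound_one: "compound n k (1\<^sub>m n) = 1\<^sub>m (compound_dim n k)"
  using compound_mat_diag[of n k "\<lambda>_. 1"] by simp

lemma compound_unitary:
  assumes U: "unitary_mat n U" shows "unitary_mat (compound_dim n k) (compound n k U)"
proof (rule unitary_matI)
  note u = unitary_matD[OF U]
  have "(compound n k U)\<^sup>\<dagger> * compound n k U = compound n k (U\<^sup>\<dagger> * U)"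
    using u(1) by (simp add: compound_mult compound_adjoint)
  thus "(compound n k U)\<^sup>\<dagger> * compound n k U = 1\<^sub>m (compound_dim n k)" using u by (simp add: compound_one)
qed simp

lemma compound_spectral:
  assumes U: "unitary_mat n U"
  shows "compound n k (spectral n U d) = spectral (compound_dim n k) (compound n k U) (\<lambda>a. \<Prod>i<k. d (incr_enum n k ! a ! i))"
  using unitary_matD(1)[OF U]
  by (simp add: spectral_def compound_mult[of _ n] compound_adjoint compound_mat_diag)

lemma compound_pd:
  assumes "pd n A" shows "pd (compound_dim n k) (compound n k A)"
  using assms
proof (elim pd_spectral)
  fix U d assume *: "unitary_mat n U" "A = spectral n U d" "\<And>i. i < n \<Longrightarrow> 0 < d i"
  show ?thesis unfolding *(2) compound_spectral[OF *(1)]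
    by (intro pd_spectralI compound_unitary *(1) prod_pos *(3) incr_listsD(4)[OF incr_enum_nth]) auto
qed

lemma prod_powr_nonneg:
  "(\<And>i. i \<in> S \<Longrightarrow> 0 \<le> d i) \<Longrightarrow> (\<Prod>i\<in>S. (d i :: real) powr r) = (\<Prod>i\<in>S. d i) powr r"
  by (induction S rule: infinite_finite_induct) (auto simp: powr_mult prod_nonneg)

lemma compound_powr:
  assumes "psd n A" shows "compound n k (mat_powr A r) = mat_powr (compound n k A) r"
  using assms
proof (elim psd_spectral)
  fix U d assume *: "unitary_mat n U" "A = spectral n U d" "\<And>i. i < n \<Longrightarrow> 0 \<le> d i"
  show ?thesis unfolding *(2) spectral_powr[OF *(1)] compound_spectral[OF *(1)] spectral_powr[OF compound_unitary[OF *(1)]]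
    by (intro spectral_cong prod_powr_nonneg *(3) incr_listsD(4)[OF incr_enum_nth]) auto
qed

lemma compound_sym_prod:
  assumes "psd n A" "psd n B"
  shows "compound n k (sym_prod A B) = sym_prod (compound n k A) (compound n k B)"
  using psd_carrier[OF assms(1)] powr_carrier[OF psd_herm[OF assms(2)]]
  by (simp add: sym_prod_def compound_mult[of _ n] compound_powr[OF assms(2), symmetric])

lemma compound_pd_geom_mean:
  assumes A: "pd n A" and B: "pd n B"
  shows "compound n k (pd_geom_mean t A B) = pd_geom_mean t (compound n k A) (compound n k B)"
proof -
  note C = powr_congr_pd[OF A B, of "-1/2"]
  have m: "compound n k (X * Y * X) = compound n k X * compound n k Y * compound n k X"
    if "X \<in> carrier_mat n n" "Y \<in> carrier_mat n n" for X Y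
    using that by (simp only: compound_mult[of _ n] mult_carrier_square)
  show ?thesis
    unfolding pd_geom_mean_def m[OF powr_carrier[OF pd_herm[OF A]] powr_carrier[OF pd_herm[OF C]]]
      compound_powr[OF pd_psd[OF C]] m[OF powr_carrier[OF pd_herm[OF A]] pd_carrier[OF B]]
      compound_powr[OF pd_psd[OF A]] ..
qed

text \<open>
Compounds commute with every operation involved, so this is \<open>geom_mean_norm_bound\<close> for the
compounds of \<open>A\<close> and \<open>B\<close>.
\<close>

lemma compound_norm_bound:
  assumes A: "pd n A" and B: "pd n B" and c: "0 < c"
    and le: "loewner_le (compound_dim n k) (compound n k (sym_prod A B)) (complex_of_real c \<cdot>\<^sub>m 1\<^sub>m (compound_dim n k))"
    and t: "0 \<le> t" "t \<le> 1/2" and p: "0 \<le> p" "p * (1 - 2 * t) \<le> 1"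
  shows "loewner_le (compound_dim n k)
     (compound n k (sym_prod (mat_powr (pd_geom_mean t A B) p) (mat_powr (pd_geom_mean (1 - t) A B) p)))
     (complex_of_real (c powr p) \<cdot>\<^sub>m 1\<^sub>m (compound_dim n k))"
proof -
  note G = pd_geom_mean_pd[OF A B]
  have "compound n k (mat_powr (pd_geom_mean s A B) p) = mat_powr (pd_geom_mean s (compound n k A) (compound n k B)) p" for s
    by (simp add: compound_powr[OF pd_psd[OF G]] compound_pd_geom_mean[OF A B])
  thus ?thesis
    using geom_mean_norm_bound[OF compound_pd[OF A] compound_pd[OF B] c _ t p] le
    by (simp add: compound_sym_prod[OF pd_psd[OF A] pd_psd[OF B]] compound_sym_prod[OF powr_psd[OF pd_herm[OF G]] powr_psd[OF pd_herm[OF G]]])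
qed

lemma incr_lists_nth_ge:
  assumes "L \<in> incr_lists n k" "i < k" shows "i \<le> L ! i"
  using assms(2)
proof (induction i)
  case (Suc i)
  have "L ! i < L ! Suc i"
    using Suc.prems assms(1) by (auto simp: incr_lists_def intro: sorted_wrt_nth_less)
  thus ?case using Suc by simp
qed simp

text \<open>
The eigenvalues of the compound are the products of the \<open>d i\<close> over the index sets, and the largest
product belongs to the index set \<open>{0..<k}\<close>. This turns a Loewner bound on the compound into a bound
on the product of the \<open>k\<close> largest eigenvalues.
\<close>

lemma compound_le_iff:
  assumes U: "unitary_mat n U" and d: "\<And>i j. i \<le> j \<Longrightarrow> j < n \<Longrightarrow> d j \<le> d i" "\<And>i. i < n \<Longrightarrow> 0 \<le> d i" and k: "k \<le> n"
  shows "loewner_le (compound_dim n k) (compound n k (spectral n U d)) (complex_of_real c \<cdot>\<^sub>m 1\<^sub>m (compound_dim n k))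
    \<longleftrightarrow> (\<Prod>i<k. d i) \<le> c"
  unfolding compound_spectral[OF U] loewner_le_spectral_one[OF compound_unitary[OF U]]
proof
  assume *: "\<forall>a<compound_dim n k. (\<Prod>i<k. d (incr_enum n k ! a ! i)) \<le> c"
  have "[0..<k] \<in> incr_lists n k" using k by (auto simp: incr_lists_def)
  then obtain a where "a < compound_dim n k" "incr_enum n k ! a = [0..<k]"
    using incr_enum(2)[of n k] by (metis in_set_conv_nth)
  thus "(\<Prod>i<k. d i) \<le> c" using * by auto
next
  assume *: "(\<Prod>i<k. d i) \<le> c"
  show "\<forall>a<compound_dim n k. (\<Prod>i<k. d (incr_enum n k ! a ! i)) \<le> c"
  proof (intro allI impI)
    fix a assume "a < compound_dim n k"
    note I = incr_enum_nth[OF this]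
    have "(\<Prod>i<k. d (incr_enum n k ! a ! i)) \<le> (\<Prod>i<k. d i)"
      by (rule prod_mono) (use incr_lists_nth_ge[OF I] incr_listsD(4)[OF I] d in auto)
    thus "(\<Prod>i<k. d (incr_enum n k ! a ! i)) \<le> c" using * by simp
  qed
qed

section \<open>Entrywise limits of matrices\<close>

text \<open>
Only the entries with indices below \<open>n\<close> are constrained, and the matrices along the filter need to
have the right dimensions only eventually.
\<close>

definition mat_lim :: "nat \<Rightarrow> (real \<Rightarrow> complex mat) \<Rightarrow> complex mat \<Rightarrow> real filter \<Rightarrow> bool" where
  "mat_lim n X L F \<longleftrightarrow> L \<in> carrier_mat n n \<and> (\<forall>\<^sub>F e in F. X e \<in> carrier_mat n n)
     \<and> (\<forall>i<n. \<forall>j<n. ((\<lambda>e. X e $$ (i, j)) \<longlongrightarrow> L $$ (i, j)) F)"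

lemma mat_lim_const: "L \<in> carrier_mat n n \<Longrightarrow> mat_lim n (\<lambda>_. L) L F"
  by (simp add: mat_lim_def)

lemma mat_lim_transform:
  assumes X: "mat_lim n X L F" and eq: "\<forall>\<^sub>F e in F. X e = Y e"
  shows "mat_lim n Y L F"
  unfolding mat_lim_def
proof (intro conjI allI impI)
  show "L \<in> carrier_mat n n" using X by (simp add: mat_lim_def)
  have "\<forall>\<^sub>F e in F. X e \<in> carrier_mat n n" using X by (simp add: mat_lim_def)
  thus "\<forall>\<^sub>F e in F. Y e \<in> carrier_mat n n" using eq by eventually_elim simp
  fix i j assume "i < n" "j < n"
  hence "((\<lambda>e. X e $$ (i, j)) \<longlongrightarrow> L $$ (i, j)) F" using X by (simp add: mat_lim_def)
  moreover have "\<forall>\<^sub>F e in F. X e $$ (i, j) = Y e $$ (i, j)" using eq by eventually_elim simp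
  ultimately show "((\<lambda>e. Y e $$ (i, j)) \<longlongrightarrow> L $$ (i, j)) F" by (rule Lim_transform_eventually)
qed

lemma mat_lim_mult:
  assumes X: "mat_lim n X L F" and Y: "mat_lim n Y M F"
  shows "mat_lim n (\<lambda>e. X e * Y e) (L * M) F"
  unfolding mat_lim_def
proof (intro conjI allI impI)
  have ev: "\<forall>\<^sub>F e in F. X e \<in> carrier_mat n n \<and> Y e \<in> carrier_mat n n"
    using X Y by (auto simp: mat_lim_def intro: eventually_conj)
  show "\<forall>\<^sub>F e in F. X e * Y e \<in> carrier_mat n n" using ev by eventually_elim auto
  show "L * M \<in> carrier_mat n n" using X Y by (auto simp: mat_lim_def)
  fix i j assume ij: "i < n" "j < n"
  have "((\<lambda>e. \<Sum>k<n. X e $$ (i, k) * Y e $$ (k, j)) \<longlongrightarrow> (\<Sum>k<n. L $$ (i, k) * M $$ (k, j))) F"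
    using X Y ij by (auto simp: mat_lim_def intro!: tendsto_sum tendsto_mult)
  moreover have "(L * M) $$ (i, j) = (\<Sum>k<n. L $$ (i, k) * M $$ (k, j))"
    using X Y ij by (auto simp: mat_lim_def scalar_prod_def lessThan_atLeast0)
  moreover have "\<forall>\<^sub>F e in F. (\<Sum>k<n. X e $$ (i, k) * Y e $$ (k, j)) = (X e * Y e) $$ (i, j)"
    using ev by eventually_elim (use ij in \<open>auto simp: scalar_prod_def lessThan_atLeast0\<close>)
  ultimately show "((\<lambda>e. (X e * Y e) $$ (i, j)) \<longlongrightarrow> (L * M) $$ (i, j)) F"
    using Lim_transform_eventually by fastforce
qed

lemma qform_sum:
  assumes "M \<in> carrier_mat n n" "v \<in> carrier_vec n"
  shows "qform M v = Re (\<Sum>i<n. \<Sum>j<n. M $$ (i, j) * v $ j * cnj (v $ i))"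
  using assms by (auto simp: qform_def scalar_prod_def lessThan_atLeast0 sum_distrib_right
      simp del: times_complex.sel intro!: sum.cong arg_cong[of _ _ Re])

lemma mat_lim_qform:
  assumes X: "mat_lim n X L F" and v: "v \<in> carrier_vec n"
  shows "((\<lambda>e. qform (X e) v) \<longlongrightarrow> qform L v) F"
proof -
  have L: "L \<in> carrier_mat n n" and ev: "\<forall>\<^sub>F e in F. X e \<in> carrier_mat n n"
    using X by (auto simp: mat_lim_def)
  have "((\<lambda>e. Re (\<Sum>i<n. \<Sum>j<n. X e $$ (i, j) * v $ j * cnj (v $ i))) \<longlongrightarrow> qform L v) F"
    unfolding qform_sum[OF L v] using X
    by (auto simp: mat_lim_def simp del: Re_sum times_complex.sel intro!: tendsto_Re tendsto_sum tendsto_mult)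
  moreover have "\<forall>\<^sub>F e in F. Re (\<Sum>i<n. \<Sum>j<n. X e $$ (i, j) * v $ j * cnj (v $ i)) = qform (X e) v"
    using ev by eventually_elim (simp add: qform_sum[OF _ v] del: Re_sum times_complex.sel)
  ultimately show ?thesis by (rule Lim_transform_eventually)
qed

lemma mat_lim_loewner_le:
  assumes X: "mat_lim n X L F" and Y: "mat_lim n Y M F" and F: "F \<noteq> bot"
    and le: "\<forall>\<^sub>F e in F. loewner_le n (X e) (Y e)"
  shows "loewner_le n L M"
  unfolding loewner_le_def
proof
  fix v :: "complex vec" assume v: "v \<in> carrier_vec n"
  show "qform L v \<le> qform M v"
    by (rule tendsto_le[OF F mat_lim_qform[OF Y v] mat_lim_qform[OF X v]])
       (use le in eventually_elim, use v in \<open>simp add: loewner_le_def\<close>)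
qed

lemma mat_lim_herm:
  assumes X: "mat_lim n X L F" and F: "F \<noteq> bot" and h: "\<forall>\<^sub>F e in F. herm n (X e)"
  shows "herm n L"
proof -
  have L: "L \<in> carrier_mat n n" using X by (simp add: mat_lim_def)
  have "L\<^sup>\<dagger> = L"
  proof (rule eq_matI)
    fix i j assume "i < dim_row L" "j < dim_col L"
    hence ij: "i < n" "j < n" using L by auto
    have "((\<lambda>e. cnj (X e $$ (j, i))) \<longlongrightarrow> cnj (L $$ (j, i))) F"
      using X ij by (intro tendsto_cnj) (auto simp: mat_lim_def)
    moreover have "\<forall>\<^sub>F e in F. cnj (X e $$ (j, i)) = X e $$ (i, j)"
      using h
    proof eventually_elim
      case (elim e)
      have "(X e)\<^sup>\<dagger> $$ (i, j) = cnj (X e $$ (j, i))" using hermD(1)[OF elim] ij by simp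
      thus ?case using hermD(2)[OF elim] by simp
    qed
    ultimately have "((\<lambda>e. X e $$ (i, j)) \<longlongrightarrow> cnj (L $$ (j, i))) F" by (rule Lim_transform_eventually)
    moreover have "((\<lambda>e. X e $$ (i, j)) \<longlongrightarrow> L $$ (i, j)) F" using X ij by (simp add: mat_lim_def)
    ultimately have "cnj (L $$ (j, i)) = L $$ (i, j)" using tendsto_unique[OF F] by blast
    thus "L\<^sup>\<dagger> $$ (i, j) = L $$ (i, j)" using L ij by simp
  qed (use L in auto)
  thus ?thesis using L by (simp add: herm_def)
qed

lemma mat_lim_psd:
  assumes X: "mat_lim n X L F" and F: "F \<noteq> bot" and h: "\<forall>\<^sub>F e in F. psd n (X e)"
  shows "psd n L"
  unfolding psd_def
proof (intro conjI ballI)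
  show "herm n L" by (rule mat_lim_herm[OF X F]) (use h in eventually_elim, auto simp: psd_herm)
  fix v :: "complex vec" assume v: "v \<in> carrier_vec n"
  show "0 \<le> qform L v"
    by (rule tendsto_lowerbound[OF mat_lim_qform[OF X v] _ F])
       (use h in eventually_elim, use v in \<open>simp add: psd_qform_nonneg\<close>)
qed

lemma Re_cscalar_commute:
  "x \<in> carrier_vec n \<Longrightarrow> y \<in> carrier_vec n \<Longrightarrow> Re (x \<bullet>c y) = Re (y \<bullet>c x)"
  by (auto simp: scalar_prod_def mult.commute intro!: sum.cong)

text \<open>
A Hermitian matrix is determined by its quadratic form, so that convergence of quadratic forms
implies convergence of the entries.
\<close>

lemma polarization:
  assumes M: "herm n M" and ij: "i < n" "j < n"
  shows "M $$ (i, j) = Complex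
      ((qform M (unit_vec n j + unit_vec n i) - qform M (unit_vec n j) - qform M (unit_vec n i)) / 2)
      (- (qform M (\<i> \<cdot>\<^sub>v unit_vec n j + unit_vec n i) - qform M (unit_vec n j) - qform M (unit_vec n i)) / 2)"
proof -
  note m = hermD[OF M]
  let ?e = "unit_vec n :: nat \<Rightarrow> complex vec"
  have add: "qform M (u + w) = qform M u + qform M w + 2 * Re ((M *\<^sub>v u) \<bullet>c w)"
    if u: "u \<in> carrier_vec n" and w: "w \<in> carrier_vec n" for u w
  proof -
    have "(M *\<^sub>v w) \<bullet>c u = w \<bullet>c (M *\<^sub>v u)" by (rule cscalar_herm[OF M w u])
    hence "Re ((M *\<^sub>v w) \<bullet>c u) = Re ((M *\<^sub>v u) \<bullet>c w)"
      using Re_cscalar_commute[OF w, of "M *\<^sub>v u"] u m by simp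
    thus ?thesis using u w m
      by (simp add: qform_def mult_add_distrib_mat_vec[of _ n n] conjugate_add_vec[of _ n]
          add_scalar_prod_distrib[of _ n] scalar_prod_add_distrib[of _ n])
  qed
  have col: "M *\<^sub>v ?e j = col M j" using m ij by (intro eq_vecI) auto
  have con: "conjugate (?e i) = ?e i" by (rule eq_vecI) (auto simp: unit_vec_def)
  have ent: "(M *\<^sub>v ?e j) \<bullet>c ?e i = M $$ (i, j)"
    using m ij by (simp add: col con)
  have sm: "(M *\<^sub>v (\<i> \<cdot>\<^sub>v ?e j)) \<bullet>c ?e i = \<i> * M $$ (i, j)"
    using m ij by (simp add: mult_mat_vec[of _ n n] smult_scalar_prod_distrib[of _ n] ent)
  have q: "qform M (\<i> \<cdot>\<^sub>v ?e j) = qform M (?e j)"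
    using m ij by (simp add: qform_def mult_mat_vec[of _ n n] conjugate_smult_vec smult_scalar_prod_distrib[of _ n] scalar_prod_smult_distrib[of _ n])
  have 1: "qform M (?e j + ?e i) = qform M (?e j) + qform M (?e i) + 2 * Re (M $$ (i, j))"
    using add[of "?e j" "?e i"] by (simp add: ent)
  have 2: "qform M (\<i> \<cdot>\<^sub>v ?e j + ?e i) = qform M (?e j) + qform M (?e i) - 2 * Im (M $$ (i, j))"
    using add[of "\<i> \<cdot>\<^sub>v ?e j" "?e i"] by (simp add: sm q)
  show ?thesis unfolding 1 2 by (simp add: complex_eq_iff)
qed

lemma qform_convergent_mat_lim:
  assumes h: "\<forall>\<^sub>F e in F. herm n (X e)"
    and q: "\<And>v. v \<in> carrier_vec n \<Longrightarrow> ((\<lambda>e. qform (X e) v) \<longlongrightarrow> l v) F"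
  shows "\<exists>L. mat_lim n X L F"
proof -
  let ?e = "unit_vec n :: nat \<Rightarrow> complex vec"
  define c where "c i j = Complex ((l (?e j + ?e i) - l (?e j) - l (?e i)) / 2)
      (- (l (\<i> \<cdot>\<^sub>v ?e j + ?e i) - l (?e j) - l (?e i)) / 2)" for i j
  have "mat_lim n X (mat n n (\<lambda>(i, j). c i j)) F"
    unfolding mat_lim_def
  proof (intro conjI allI impI)
    show "\<forall>\<^sub>F e in F. X e \<in> carrier_mat n n" using h by eventually_elim (simp add: herm_def)
    fix i j assume ij: "i < n" "j < n"
    have "((\<lambda>e. Complex
      ((qform (X e) (?e j + ?e i) - qform (X e) (?e j) - qform (X e) (?e i)) / 2)
      (- (qform (X e) (\<i> \<cdot>\<^sub>v ?e j + ?e i) - qform (X e) (?e j) - qform (X e) (?e i)) / 2)) \<longlongrightarrow> c i j) F"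
      unfolding c_def by (intro tendsto_Complex tendsto_divide tendsto_diff tendsto_minus q tendsto_const) auto
    moreover have "\<forall>\<^sub>F e in F. Complex
      ((qform (X e) (?e j + ?e i) - qform (X e) (?e j) - qform (X e) (?e i)) / 2)
      (- (qform (X e) (\<i> \<cdot>\<^sub>v ?e j + ?e i) - qform (X e) (?e j) - qform (X e) (?e i)) / 2) = X e $$ (i, j)"
      using h by eventually_elim (rule polarization[OF _ ij, symmetric])
    ultimately have "((\<lambda>e. X e $$ (i, j)) \<longlongrightarrow> c i j) F" by (rule Lim_transform_eventually)
    thus "((\<lambda>e. X e $$ (i, j)) \<longlongrightarrow> mat n n (\<lambda>(i, j). c i j) $$ (i, j)) F" using ij by simp
  qed auto
  thus ?thesis by blast
qed

lemma mat_lim_of_qform: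
  assumes h: "\<forall>\<^sub>F e in F. herm n (X e)" and L: "herm n L" and F: "F \<noteq> bot"
    and q: "\<And>v. v \<in> carrier_vec n \<Longrightarrow> ((\<lambda>e. qform (X e) v) \<longlongrightarrow> qform L v) F"
  shows "mat_lim n X L F"
proof -
  obtain L' where L': "mat_lim n X L' F" using qform_convergent_mat_lim[OF h q] by blast
  have hL': "herm n L'" by (rule mat_lim_herm[OF L' F h])
  have eq: "qform L' v = qform L v" if "v \<in> carrier_vec n" for v
    using tendsto_unique[OF F mat_lim_qform[OF L' that] q[OF that]] .
  have "L' = L"
  proof (rule eq_matI)
    fix i j assume "i < dim_row L" "j < dim_col L"
    hence ij: "i < n" "j < n" using L by (auto simp: herm_def)
    show "L' $$ (i, j) = L $$ (i, j)"
      unfolding polarization[OF hL' ij] polarization[OF L ij] by (simp add: eq)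
  qed (use L hL' in \<open>auto simp: herm_def\<close>)
  thus ?thesis using L' by simp
qed

lemma qform_bound:
  assumes M: "M \<in> carrier_mat n n" and v: "v \<in> carrier_vec n"
  shows "\<bar>qform M v\<bar> \<le> (\<Sum>i<n. \<Sum>j<n. cmod (M $$ (i, j))) * norm_sq v"
proof -
  have vn: "(cmod (v $ i))\<^sup>2 \<le> norm_sq v" if "i < n" for i
    unfolding norm_sq_eq[OF v] using that by (intro member_le_sum) auto
  have vij: "cmod (v $ j) * cmod (v $ i) \<le> norm_sq v" if "i < n" "j < n" for i j
    using sum_squares_bound[of "cmod (v $ j)" "cmod (v $ i)"] vn[OF that(1)] vn[OF that(2)] by linarith
  have "\<bar>qform M v\<bar> \<le> cmod (\<Sum>i<n. \<Sum>j<n. M $$ (i, j) * v $ j * cnj (v $ i))"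
    unfolding qform_sum[OF M v] by (rule abs_Re_le_cmod)
  also have "\<dots> \<le> (\<Sum>i<n. \<Sum>j<n. cmod (M $$ (i, j)) * (cmod (v $ j) * cmod (v $ i)))"
    by (intro order.trans[OF norm_sum] sum_mono) (auto simp: norm_mult mult.assoc intro!: order.trans[OF norm_sum] sum_mono)
  also have "\<dots> \<le> (\<Sum>i<n. \<Sum>j<n. cmod (M $$ (i, j)) * norm_sq v)"
    by (intro sum_mono mult_left_mono vij) auto
  also have "\<dots> = (\<Sum>i<n. \<Sum>j<n. cmod (M $$ (i, j))) * norm_sq v"
    by (simp add: sum_distrib_right)
  finally show ?thesis .
qed

text \<open>
Entrywise convergence implies convergence in operator norm.
\<close>

lemma mat_lim_eventually_close:
  assumes X: "mat_lim n X L F" and \<eta>: "0 < \<eta>"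
  shows "\<forall>\<^sub>F e in F. \<forall>v\<in>carrier_vec n. \<bar>qform (X e) v - qform L v\<bar> \<le> \<eta> * norm_sq v"
proof -
  have L: "L \<in> carrier_mat n n" using X by (simp add: mat_lim_def)
  have "((\<lambda>e. \<Sum>i<n. \<Sum>j<n. cmod (X e $$ (i, j) - L $$ (i, j))) \<longlongrightarrow> (\<Sum>i<n. \<Sum>j<n. cmod (L $$ (i, j) - L $$ (i, j)))) F"
    using X by (intro tendsto_sum tendsto_norm tendsto_diff tendsto_const) (auto simp: mat_lim_def)
  hence "\<forall>\<^sub>F e in F. (\<Sum>i<n. \<Sum>j<n. cmod (X e $$ (i, j) - L $$ (i, j))) < \<eta>"
    using \<eta> by (intro order_tendstoD(2)) auto
  moreover have "\<forall>\<^sub>F e in F. X e \<in> carrier_mat n n" using X by (simp add: mat_lim_def)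
  ultimately show ?thesis
  proof eventually_elim
    case (elim e)
    show ?case
    proof
      fix v :: "complex vec" assume v: "v \<in> carrier_vec n"
      define D where "D = X e + complex_of_real (- 1) \<cdot>\<^sub>m L"
      have D: "D \<in> carrier_mat n n" using elim L by (simp add: D_def)
      have "qform (X e) v - qform L v = qform D v"
        unfolding D_def using elim L v by (subst qform_add[of _ n]) (auto simp: qform_smult[of _ n] simp del: of_real_minus of_real_1)
      hence "\<bar>qform (X e) v - qform L v\<bar> \<le> (\<Sum>i<n. \<Sum>j<n. cmod (D $$ (i, j))) * norm_sq v"
        using qform_bound[OF D v] by simp
      also have "(\<Sum>i<n. \<Sum>j<n. cmod (D $$ (i, j))) = (\<Sum>i<n. \<Sum>j<n. cmod (X e $$ (i, j) - L $$ (i, j)))"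
        using elim L by (intro sum.cong refl) (auto simp: D_def)
      also have "(\<Sum>i<n. \<Sum>j<n. cmod (X e $$ (i, j) - L $$ (i, j))) * norm_sq v \<le> \<eta> * norm_sq v"
        using elim by (intro mult_right_mono) (auto simp: norm_sq_eq[OF v] intro!: sum_nonneg)
      finally show "\<bar>qform (X e) v - qform L v\<bar> \<le> \<eta> * norm_sq v" .
    qed
  qed
qed

lemma shift_spectral:
  assumes U: "unitary_mat n U"
  shows "spectral n U d + complex_of_real \<delta> \<cdot>\<^sub>m 1\<^sub>m n = spectral n U (\<lambda>i. d i + \<delta>)"
proof -
  have "complex_of_real \<delta> \<cdot>\<^sub>m 1\<^sub>m n = spectral n U (\<lambda>_. \<delta>)"
    using spectral_smult[OF U, of \<delta> "\<lambda>_. 1"] by (simp add: spectral_one[OF U])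
  thus ?thesis by (simp add: spectral_add[OF U])
qed

lemma shift_pd:
  assumes "psd n A" "0 < \<delta>" shows "pd n (A + complex_of_real \<delta> \<cdot>\<^sub>m 1\<^sub>m n)"
  using assms(1)
proof (elim psd_spectral)
  fix U d assume *: "unitary_mat n U" "A = spectral n U d" "\<And>i. i < n \<Longrightarrow> 0 \<le> d i"
  show ?thesis unfolding *(2) shift_spectral[OF *(1)]
    by (intro pd_spectralI *(1)) (use *(3) assms(2) in \<open>simp add: add_nonneg_pos\<close>)
qed

lemma qform_shift:
  assumes "A \<in> carrier_mat n n" "v \<in> carrier_vec n"
  shows "qform (A + complex_of_real \<delta> \<cdot>\<^sub>m 1\<^sub>m n) v = qform A v + \<delta> * norm_sq v"
  using assms by (simp add: qform_add[of _ n] qform_smult[of _ n] qform_one_norm_sq)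

text \<open>
For \<open>0 \<le> z \<le> 1\<close> and \<open>r \<le> 1\<close> one has \<open>z \<le> z^r\<close>; add this for \<open>z = x/(x+y)\<close> and \<open>z = y/(x+y)\<close>.
\<close>

lemma powr_subadditive:
  fixes x y :: real assumes "0 \<le> x" "0 < y" "0 \<le> r" "r \<le> 1"
  shows "(x + y) powr r \<le> x powr r + y powr r"
proof -
  let ?s = "x + y"
  have s: "0 < ?s" using assms by simp
  have *: "z / ?s \<le> (z / ?s) powr r" if "0 \<le> z" "z \<le> ?s" for z
  proof (cases "z = 0")
    case False
    hence "0 < z / ?s" "z / ?s \<le> 1" using that s by auto
    hence "(z / ?s) powr 1 \<le> (z / ?s) powr r" using assms by (intro powr_mono') auto
    moreover have "(z / ?s) powr 1 = z / ?s" using \<open>0 < z / ?s\<close> by (intro powr_one_gt_zero_iff[THEN iffD2] less_imp_le)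
    ultimately show ?thesis by metis
  qed simp
  have "1 = x / ?s + y / ?s" using s by (simp add: add_divide_distrib[symmetric])
  also have "\<dots> \<le> (x / ?s) powr r + (y / ?s) powr r" using * assms by (intro add_mono) auto
  also have "\<dots> = (x powr r + y powr r) / ?s powr r"
    using assms s by (simp add: powr_divide add_divide_distrib)
  finally show ?thesis using s by (simp add: pos_le_divide_eq)
qed

text \<open>
By Loewner-Heinz \<open>X^r \<le> (Y + \<delta>I)^r\<close>, and the right-hand side is at most \<open>Y^r + \<delta>^r I\<close> because it is
diagonal in the eigenbasis of \<open>Y\<close>.
\<close>

lemma qform_powr_le_shift:
  assumes X: "psd n X" and Y: "psd n Y" and r: "0 \<le> r" "r \<le> 1" and \<delta>: "0 < \<delta>"
    and le: "\<And>v. v \<in> carrier_vec n \<Longrightarrow> qform X v \<le> qform Y v + \<delta> * norm_sq v" and v: "v \<in> carrier_vec n"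
  shows "qform (mat_powr X r) v \<le> qform (mat_powr Y r) v + \<delta> powr r * norm_sq v"
proof -
  obtain U d where U: "unitary_mat n U" and Ys: "Y = spectral n U d" and d: "\<And>i. i < n \<Longrightarrow> 0 \<le> d i"
    using psd_spectral[OF Y] by metis
  have "loewner_le n X (Y + complex_of_real \<delta> \<cdot>\<^sub>m 1\<^sub>m n)"
    using le by (simp add: loewner_le_def qform_shift[OF psd_carrier[OF Y]])
  from loewner_heinz[OF X shift_pd[OF Y \<delta>] this r]
  have "qform (mat_powr X r) v \<le> qform (mat_powr (Y + complex_of_real \<delta> \<cdot>\<^sub>m 1\<^sub>m n) r) v"
    using v by (simp add: loewner_le_def)
  also have "\<dots> \<le> qform (spectral n U (\<lambda>i. d i powr r + \<delta> powr r)) v"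
    unfolding Ys shift_spectral[OF U] spectral_powr[OF U] qform_spectral[OF U v]
    by (intro sum_mono mult_right_mono powr_subadditive d \<delta> r) auto
  also have "spectral n U (\<lambda>i. d i powr r + \<delta> powr r) = mat_powr Y r + complex_of_real (\<delta> powr r) \<cdot>\<^sub>m 1\<^sub>m n"
    by (simp add: Ys spectral_powr[OF U] shift_spectral[OF U])
  also have "qform \<dots> v = qform (mat_powr Y r) v + \<delta> powr r * norm_sq v"
    by (rule qform_shift[OF powr_carrier[OF psd_herm[OF Y]] v])
  finally show ?thesis .
qed

text \<open>
Hoelder continuity: two matrices that differ by at most \<open>\<delta>\<close> have \<open>r\<close>-th powers that differ by at
most \<open>\<delta>^r\<close>.
\<close>

lemma mat_lim_powr_le_one:
  assumes X: "mat_lim n X L F" and F: "F \<noteq> bot" and h: "\<forall>\<^sub>F e in F. psd n (X e)" and r: "0 < r" "r \<le> 1"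
  shows "mat_lim n (\<lambda>e. mat_powr (X e) r) (mat_powr L r) F"
proof (rule mat_lim_of_qform[OF _ _ F])
  have L: "psd n L" by (rule mat_lim_psd[OF X F h])
  show "\<forall>\<^sub>F e in F. herm n (mat_powr (X e) r)" using h by eventually_elim (simp add: powr_herm psd_herm)
  show "herm n (mat_powr L r)" by (simp add: powr_herm psd_herm L)
  fix v :: "complex vec" assume v: "v \<in> carrier_vec n"
  show "((\<lambda>e. qform (mat_powr (X e) r) v) \<longlongrightarrow> qform (mat_powr L r) v) F"
  proof (rule tendstoI)
    fix \<epsilon> :: real assume \<epsilon>: "0 < \<epsilon>"
    have nn: "0 \<le> norm_sq v" by (simp add: norm_sq_eq[OF v] sum_nonneg)
    \<comment> \<open>chosen so that \<open>\<delta>^r\<close> times the squared length of \<open>v\<close> is below \<open>\<epsilon>\<close>\<close>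
    define \<delta> where "\<delta> = (\<epsilon> / (norm_sq v + 1)) powr (1 / r)"
    have \<delta>: "0 < \<delta>" "\<delta> powr r = \<epsilon> / (norm_sq v + 1)"
      using \<epsilon> r nn by (auto simp: \<delta>_def powr_powr)
    have small: "\<delta> powr r * norm_sq v < \<epsilon>" using \<epsilon> nn by (simp add: \<delta>(2) field_simps)
    show "\<forall>\<^sub>F e in F. dist (qform (mat_powr (X e) r) v) (qform (mat_powr L r) v) < \<epsilon>"
      using mat_lim_eventually_close[OF X \<delta>(1)] h
    proof eventually_elim
      case (elim e)
      have "qform (mat_powr (X e) r) v \<le> qform (mat_powr L r) v + \<delta> powr r * norm_sq v"
        by (rule qform_powr_le_shift[OF elim(2) L _ _ \<delta>(1) _ v]) (use r elim(1) in \<open>fastforce simp: abs_le_iff\<close>)+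
      moreover have "qform (mat_powr L r) v \<le> qform (mat_powr (X e) r) v + \<delta> powr r * norm_sq v"
        by (rule qform_powr_le_shift[OF L elim(2) _ _ \<delta>(1) _ v]) (use r elim(1) in \<open>fastforce simp: abs_le_iff\<close>)+
      ultimately show ?case using small by (simp add: dist_real_def abs_less_iff)
    qed
  qed
qed

text \<open>
Larger exponents reduce to exponents in \<open>(0, 1]\<close> by splitting off factors \<open>X\<close>.
\<close>

lemma mat_lim_powr:
  assumes X: "mat_lim n X L F" and F: "F \<noteq> bot" and h: "\<forall>\<^sub>F e in F. psd n (X e)" and r: "0 < r"
  shows "mat_lim n (\<lambda>e. mat_powr (X e) r) (mat_powr L r) F"
proof -
  have L: "psd n L" by (rule mat_lim_psd[OF X F h])
  have "0 < r \<Longrightarrow> r \<le> real (Suc k) \<Longrightarrow> mat_lim n (\<lambda>e. mat_powr (X e) r) (mat_powr L r) F" for k r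
  proof (induction k arbitrary: r)
    case (Suc k)
    show ?case
    proof (cases "r \<le> 1")
      case False
      have lim: "mat_lim n (\<lambda>e. X e * mat_powr (X e) (r - 1)) (L * mat_powr L (r - 1)) F"
        by (rule mat_lim_mult[OF X Suc.IH]) (use False Suc.prems in auto)
      have eq: "Y * mat_powr Y (r - 1) = mat_powr Y r" if "psd n Y" for Y
        using powr_mult_powr[OF psd_herm[OF that], of 1 "r - 1"] by (simp add: powr_1[OF that])
      have "\<forall>\<^sub>F e in F. X e * mat_powr (X e) (r - 1) = mat_powr (X e) r"
        using h by eventually_elim (rule eq)
      from mat_lim_transform[OF lim this] show ?thesis by (simp add: eq[OF L])
    qed (use mat_lim_powr_le_one[OF X F h] Suc.prems in auto)
  qed (use mat_lim_powr_le_one[OF X F h] in auto)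
  from this[of r "nat \<lceil>r\<rceil>"] r show ?thesis by (simp add: of_nat_nat) linarith
qed

lemma mat_lim_sym_prod:
  assumes X: "mat_lim n X L F" and Y: "mat_lim n Y M F" and F: "F \<noteq> bot" and h: "\<forall>\<^sub>F e in F. psd n (Y e)"
  shows "mat_lim n (\<lambda>e. sym_prod (X e) (Y e)) (sym_prod L M) F"
  unfolding sym_prod_def by (intro mat_lim_mult X mat_lim_powr[OF Y F h]) auto

lemma tendsto_minor:
  assumes X: "mat_lim n X L F" and I: "\<And>i. i < k \<Longrightarrow> I ! i < n" and J: "\<And>i. i < k \<Longrightarrow> J ! i < n"
  shows "((\<lambda>e. minor k (X e) I J) \<longlongrightarrow> minor k L I J) F"
proof -
  have eq: "minor k M I J = (\<Sum>p | p permutes {0..<k}. signof p * (\<Prod>i = 0..<k. M $$ (I ! i, J ! p i)))" for M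
  proof -
    have "minor k M I J = (\<Sum>p | p permutes {0..<k}. signof p * (\<Prod>i = 0..<k. mat k k (\<lambda>(i, j). M $$ (I ! i, J ! j)) $$ (i, p i)))"
      unfolding minor_def by (rule det_def') simp
    also have "\<dots> = (\<Sum>p | p permutes {0..<k}. signof p * (\<Prod>i = 0..<k. M $$ (I ! i, J ! p i)))"
    proof (rule sum.cong[OF refl])
      fix p assume "p \<in> {p. p permutes {0..<k}}"
      hence "p i < k" if "i < k" for i using permutes_in_image[of p "{0..<k}" i] that by simp
      thus "signof p * (\<Prod>i = 0..<k. mat k k (\<lambda>(i, j). M $$ (I ! i, J ! j)) $$ (i, p i))
          = signof p * (\<Prod>i = 0..<k. M $$ (I ! i, J ! p i))" by simp
    qed
    finally show ?thesis .
  qed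
  show ?thesis unfolding eq
  proof (intro tendsto_sum tendsto_mult tendsto_const tendsto_prod)
    fix p i assume "p \<in> {p. p permutes {0..<k}}" "i \<in> {0..<k}"
    hence "I ! i < n" "J ! p i < n" using I J permutes_in_image[of p "{0..<k}" i] by auto
    thus "((\<lambda>e. X e $$ (I ! i, J ! p i)) \<longlongrightarrow> L $$ (I ! i, J ! p i)) F" using X by (simp add: mat_lim_def)
  qed
qed

lemma mat_lim_compound:
  assumes X: "mat_lim n X L F"
  shows "mat_lim (compound_dim n k) (\<lambda>e. compound n k (X e)) (compound n k L) F"
  unfolding mat_lim_def
proof (intro conjI allI impI)
  fix a b assume ab: "a < compound_dim n k" "b < compound_dim n k"
  show "((\<lambda>e. compound n k (X e) $$ (a, b)) \<longlongrightarrow> compound n k L $$ (a, b)) F"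
    using ab tendsto_minor[OF X incr_listsD(4)[OF incr_enum_nth[OF ab(1)]] incr_listsD(4)[OF incr_enum_nth[OF ab(2)]]]
    by (simp add: compound_def)
qed auto

lemma tendsto_det:
  assumes X: "mat_lim n X L F"
  shows "((\<lambda>e. det (X e)) \<longlongrightarrow> det L) F"
proof -
  have eq: "minor n M [0..<n] [0..<n] = det M" if "M \<in> carrier_mat n n" for M
  proof -
    have "mat n n (\<lambda>(i, j). M $$ ([0..<n] ! i, [0..<n] ! j)) = M"
      by (rule eq_matI) (use that in auto)
    thus ?thesis by (simp add: minor_def)
  qed
  have "((\<lambda>e. minor n (X e) [0..<n] [0..<n]) \<longlongrightarrow> det L) F"
    using tendsto_minor[OF X, of n "[0..<n]" "[0..<n]"] X by (simp add: eq mat_lim_def)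
  moreover have "\<forall>\<^sub>F e in F. X e \<in> carrier_mat n n" using X by (simp add: mat_lim_def)
  hence "\<forall>\<^sub>F e in F. minor n (X e) [0..<n] [0..<n] = det (X e)" by eventually_elim (rule eq)
  ultimately show ?thesis by (rule Lim_transform_eventually)
qed

section \<open>The geometric mean of positive semidefinite matrices\<close>

lemma mono_tendsto_at_right_0:
  fixes f :: "real \<Rightarrow> real"
  assumes mono: "\<And>x y. 0 < x \<Longrightarrow> x \<le> y \<Longrightarrow> f x \<le> f y" and nn: "\<And>x. 0 < x \<Longrightarrow> 0 \<le> f x"
  shows "(f \<longlongrightarrow> Inf (f ` {0<..})) (at_right 0)"
proof (rule order_tendstoI)
  have bdd: "bdd_below (f ` {0<..})" using nn by (auto intro!: bdd_belowI[of _ 0])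
  have ev: "\<forall>\<^sub>F x in at_right (0::real). 0 < x" by (simp add: eventually_at_right_less)
  fix a assume "a < Inf (f ` {0<..})"
  show "\<forall>\<^sub>F x in at_right 0. a < f x" using ev
  proof eventually_elim
    case (elim x)
    have "Inf (f ` {0<..}) \<le> f x" using bdd elim by (intro cInf_lower) auto
    thus ?case using \<open>a < _\<close> by simp
  qed
next
  fix a assume "Inf (f ` {0<..}) < a"
  moreover have "f ` {0<..} \<noteq> {}" by auto
  ultimately obtain y where y: "0 < y" "f y < a" using cInf_lessD[of "f ` {0<..}" a] by auto
  have "\<forall>\<^sub>F x in at_right 0. x \<in> {0<..<y}" using y by (intro eventually_at_right_real)
  thus "\<forall>\<^sub>F x in at_right 0. f x < a"
  proof eventually_elim
    case (elim x)
    thus ?case using mono[of x y] y by auto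
  qed
qed

abbreviation shift :: "nat \<Rightarrow> complex mat \<Rightarrow> real \<Rightarrow> complex mat" where
  "shift n A \<epsilon> \<equiv> A + complex_of_real \<epsilon> \<cdot>\<^sub>m 1\<^sub>m n"

lemma eventually_pos: "\<forall>\<^sub>F e in at_right (0::real). 0 < e"
  by (simp add: eventually_at_right_less)

lemma mat_lim_shift:
  assumes A: "A \<in> carrier_mat n n" shows "mat_lim n (shift n A) A (at_right 0)"
  unfolding mat_lim_def
proof (intro conjI allI impI)
  fix i j assume ij: "i < n" "j < n"
  have "((\<lambda>e. A $$ (i, j) + complex_of_real e * 1\<^sub>m n $$ (i, j)) \<longlongrightarrow> A $$ (i, j) + complex_of_real 0 * 1\<^sub>m n $$ (i, j)) (at_right 0)"
    by (intro tendsto_intros)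
  thus "((\<lambda>e. shift n A e $$ (i, j)) \<longlongrightarrow> A $$ (i, j)) (at_right 0)" using A ij by simp
qed (use A in auto)

text \<open>
The quadratic forms decrease as \<open>\<epsilon>\<close> decreases, since the mean is monotone in both arguments, and
they are nonnegative; hence they converge, and by polarization so do the entries. The limit in
the definition of \<open>geom_mean\<close> is therefore a genuine one.
\<close>

lemma geom_mean_limit:
  assumes A: "psd n A" and B: "psd n B" and t: "0 \<le> t" "t \<le> 1"
  shows "mat_lim n (\<lambda>\<epsilon>. pd_geom_mean t (shift n A \<epsilon>) (shift n B \<epsilon>)) (geom_mean t A B) (at_right 0)"
proof -
  note cA = psd_carrier[OF A] and cB = psd_carrier[OF B]
  let ?G = "\<lambda>\<epsilon>. pd_geom_mean t (shift n A \<epsilon>) (shift n B \<epsilon>)"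
  have pdG: "pd n (?G e)" if "0 < e" for e using that by (intro pd_geom_mean_pd shift_pd A B)
  have ev: "\<forall>\<^sub>F e in at_right 0. herm n (?G e)"
    using eventually_pos by eventually_elim (simp add: pdG pd_herm)
  have "((\<lambda>e. qform (?G e) v) \<longlongrightarrow> Inf ((\<lambda>e. qform (?G e) v) ` {0<..})) (at_right 0)" if v: "v \<in> carrier_vec n" for v
  proof (rule mono_tendsto_at_right_0)
    fix x y :: real assume xy: "0 < x" "x \<le> y"
    have le: "loewner_le n (shift n M x) (shift n M y)" if "M \<in> carrier_mat n n" for M
      using xy that by (auto simp: loewner_le_def qform_shift norm_sq_eq intro!: mult_right_mono sum_nonneg)
    have "loewner_le n (?G x) (?G y)"
      using xy by (intro pd_geom_mean_mono shift_pd A B le cA cB t) auto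
    thus "qform (?G x) v \<le> qform (?G y) v" using v by (simp add: loewner_le_def)
  next
    fix x :: real assume "0 < x"
    thus "0 \<le> qform (?G x) v" using psd_qform_nonneg[OF pd_psd[OF pdG] v] by blast
  qed
  then obtain L where L: "mat_lim n ?G L (at_right 0)" using qform_convergent_mat_lim[OF ev, of "\<lambda>v. Inf ((\<lambda>e. qform (?G e) v) ` {0<..})"] by blast
  have "geom_mean t A B = L"
  proof (rule eq_matI)
    fix i j assume "i < dim_row L" "j < dim_col L"
    hence ij: "i < n" "j < n" using L by (auto simp: mat_lim_def)
    hence "((\<lambda>e. ?G e $$ (i, j)) \<longlongrightarrow> L $$ (i, j)) (at_right 0)" using L by (simp add: mat_lim_def)
    hence "Lim (at_right 0) (\<lambda>e. ?G e $$ (i, j)) = L $$ (i, j)" by (intro tendsto_Lim) auto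
    thus "geom_mean t A B $$ (i, j) = L $$ (i, j)" using ij cA by (simp add: geom_mean_def)
  qed (use L cA in \<open>auto simp: geom_mean_def mat_lim_def\<close>)
  thus ?thesis using L by simp
qed

lemma geom_mean_psd:
  assumes A: "psd n A" and B: "psd n B" and t: "0 \<le> t" "t \<le> 1"
  shows "psd n (geom_mean t A B)"
proof (rule mat_lim_psd[OF geom_mean_limit[OF assms]])
  show "\<forall>\<^sub>F e in at_right 0. psd n (pd_geom_mean t (shift n A e) (shift n B e))"
    using eventually_pos by eventually_elim (intro pd_psd pd_geom_mean_pd shift_pd A B)
qed simp

section \<open>Eigenvalues of products\<close>

text \<open>
Over the polynomial ring let \<open>M\<close> be the block matrix with rows \<open>(x, A)\<close> and \<open>(B, 1)\<close>. Its determinant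
is \<open>det (x - A B)\<close>. Multiplication from the left by the block matrix with rows \<open>(1, 0)\<close> and
\<open>(-B, x)\<close> makes it block triangular with diagonal blocks \<open>x\<close> and \<open>x - B A\<close>.
\<close>

lemma char_poly_mult_commute:
  fixes A B :: "'a :: field mat"
  assumes A: "A \<in> carrier_mat n n" and B: "B \<in> carrier_mat n n"
  shows "char_poly (A * B) = char_poly (B * A)"
proof -
  let ?h = "map_mat (\<lambda>a. [:a:])"
  define X where "X = [:0, 1:] \<cdot>\<^sub>m (1\<^sub>m n :: 'a poly mat)"
  define \<alpha> where "\<alpha> = ?h A"
  define \<beta> where "\<beta> = ?h B"
  have c: "X \<in> carrier_mat n n" "\<alpha> \<in> carrier_mat n n" "\<beta> \<in> carrier_mat n n"
    using A B by (auto simp: X_def \<alpha>_def \<beta>_def)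
  have cp: "char_poly (C * D) = det (X - ?h C * ?h D)"
    if "C \<in> carrier_mat n n" "D \<in> carrier_mat n n" for C D
  proof -
    interpret hom: comm_ring_hom "\<lambda>a :: 'a. [:a:]" by unfold_locales (auto simp: one_pCons)
    have "?h C * ?h D = ?h (C * D)" using that by (simp add: hom.mat_hom_mult)
    thus ?thesis
      unfolding char_poly_def char_poly_matrix_def using that
      by (intro arg_cong[of _ _ det] eq_matI) (auto simp: X_def)
  qed
  have XM: "X * M = [:0, 1:] \<cdot>\<^sub>m M" "M * X = [:0, 1:] \<cdot>\<^sub>m M" if "M \<in> carrier_mat n n" for M
    using that unfolding X_def by (simp_all add: mult_smult_distrib[of _ n n _ n] mult_smult_assoc_mat[of _ n n _ n])
  define M where "M = four_block_mat X \<alpha> \<beta> (1\<^sub>m n)"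
  define N where "N = four_block_mat (1\<^sub>m n) (0\<^sub>m n n) (- \<beta>) X"
  have "det M = det (X * 1\<^sub>m n - \<alpha> * \<beta>)"
    unfolding M_def by (rule det_four_block_mat) (use c in auto)
  hence M: "det M = det (X - \<alpha> * \<beta>)" using c by simp
  have "N * M = four_block_mat (1\<^sub>m n * X + 0\<^sub>m n n * \<beta>) (1\<^sub>m n * \<alpha> + 0\<^sub>m n n * 1\<^sub>m n)
      (- \<beta> * X + X * \<beta>) (- \<beta> * \<alpha> + X * 1\<^sub>m n)"
    unfolding M_def N_def by (rule mult_four_block_mat) (use c in auto)
  also have "\<dots> = four_block_mat X \<alpha> (0\<^sub>m n n) (X - \<beta> * \<alpha>)"
  proof -
    have "- \<beta> * X + X * \<beta> = 0\<^sub>m n n" using c by (auto simp: XM)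
    moreover have "- \<beta> * \<alpha> + X * 1\<^sub>m n = X - \<beta> * \<alpha>" using c by (auto intro!: eq_matI)
    ultimately show ?thesis using c by simp
  qed
  moreover have "X - \<beta> * \<alpha> \<in> carrier_mat n n" using c by (intro minus_carrier_mat) simp
  ultimately have "det (N * M) = det X * det (X - \<beta> * \<alpha>)"
    using det_four_block_mat_lower_left_zero[of X n \<alpha> n "0\<^sub>m n n" "X - \<beta> * \<alpha>"] c by simp
  moreover have "det N = det X"
    unfolding N_def using det_four_block_mat_upper_right_zero[of "1\<^sub>m n" n "0\<^sub>m n n" n "- \<beta>" X] c by simp
  moreover have "det (N * M) = det N * det M"
    by (rule det_mult[of _ "n + n"]) (use c in \<open>auto simp: M_def N_def\<close>)
  ultimately have "det X * det (X - \<alpha> * \<beta>) = det X * det (X - \<beta> * \<alpha>)" using M by simp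
  moreover have "det X \<noteq> 0" by (simp add: X_def)
  ultimately show ?thesis using cp[OF A B] cp[OF B A] by (simp add: \<alpha>_def \<beta>_def)
qed

lemma eigvals_desc_spectral:
  assumes U: "unitary_mat n U" and d: "\<And>i j. i \<le> j \<Longrightarrow> j < n \<Longrightarrow> d j \<le> d i"
    and cp: "char_poly X = char_poly (spectral n U d)"
  shows "eigvals_desc X = map d [0..<n]"
proof (rule eigvals_desc_eqI)
  show "sorted_wrt (\<ge>) (map d [0..<n])"
    unfolding sorted_wrt_iff_nth_less using d by (auto simp: less_imp_le)
  have "proots (\<Prod>i\<in>S. [:- complex_of_real (d i), 1:]) = image_mset (\<lambda>i. complex_of_real (d i)) (mset_set S)"
    if "finite S" for S
    using that
  proof (induction S)
    case (insert x S)
    have "proots ([:- complex_of_real (d x), 1:] * (\<Prod>i\<in>S. [:- complex_of_real (d i), 1:]))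
        = proots [:- complex_of_real (d x), 1:] + proots (\<Prod>i\<in>S. [:- complex_of_real (d i), 1:])"
      by (rule proots_mult) (auto simp: prod_zero_iff insert.hyps)
    thus ?case using insert by (simp del: mult_pCons_left)
  qed auto
  hence "proots (char_poly X) = image_mset (\<lambda>i. complex_of_real (d i)) (mset_set {..<n})"
    by (simp add: cp char_poly_spectral[OF U])
  thus "image_mset complex_of_real (mset (map d [0..<n])) = proots (char_poly X)"
    by (simp add: lessThan_atLeast0 image_mset.compositionality comp_def mset_upt)
qed

lemma char_poly_sym_prod:
  assumes A: "psd n A" and B: "psd n B"
  shows "char_poly (A * B) = char_poly (sym_prod A B)"
proof -
  note cA = psd_carrier[OF A] and cB = powr_carrier[OF psd_herm[OF B]]
  have "A * B = (A * mat_powr B (1/2)) * mat_powr B (1/2)"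
    using cA cB powr_mult_powr[OF psd_herm[OF B], of "1/2" "1/2"]
    by (simp add: assoc_mult_mat[of _ n n _ n _ n] powr_1[OF B])
  also have "char_poly \<dots> = char_poly (mat_powr B (1/2) * (A * mat_powr B (1/2)))"
    by (rule char_poly_mult_commute) (use cA cB in auto)
  also have "mat_powr B (1/2) * (A * mat_powr B (1/2)) = sym_prod A B"
    using cA cB by (simp add: sym_prod_def assoc_mult_mat[of _ n n _ n _ n])
  finally show ?thesis .
qed

section \<open>Determinants\<close>

lemma det_psd:
  assumes "psd n A"
  shows "det A = complex_of_real (Re (det A))" "0 \<le> Re (det A)"
proof -
  obtain U d where "unitary_mat n U" "A = spectral n U d" "\<And>i. i < n \<Longrightarrow> 0 \<le> d i" using psd_spectral[OF assms] by metis
  thus "det A = complex_of_real (Re (det A))" "0 \<le> Re (det A)" by (auto simp: det_spectral simp del: of_real_prod intro!: prod_nonneg)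
qed

lemma Re_det_powr:
  assumes "psd n A" shows "Re (det (mat_powr A r)) = Re (det A) powr r"
proof -
  obtain U d where U: "unitary_mat n U" "A = spectral n U d" "\<And>i. i < n \<Longrightarrow> 0 \<le> d i" using psd_spectral[OF assms] by metis
  thus ?thesis using prod_powr_nonneg[of "{..<n}" d r] by (simp add: spectral_powr det_spectral del: of_real_prod)
qed

lemma Re_det_sandwich:
  assumes X: "psd n X" and Y: "psd n Y" and A: "A = mat_powr Y r * X * mat_powr Y r"
  shows "Re (det A) = Re (det Y) powr (2 * r) * Re (det X)"
proof -
  note cY = powr_carrier[OF psd_herm[OF Y]] and cX = psd_carrier[OF X]
  have "det A = det (mat_powr Y r) * det X * det (mat_powr Y r)"
    unfolding A using cX cY by (simp add: det_mult[of _ n])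
  also have "\<dots> = complex_of_real (Re (det Y) powr r * Re (det X) * Re (det Y) powr r)"
    using det_psd(1)[OF X] det_psd(1)[OF powr_psd[OF psd_herm[OF Y]], of r] Re_det_powr[OF Y, of r] by simp
  also have "Re (det Y) powr r * Re (det X) * Re (det Y) powr r = Re (det Y) powr (2 * r) * Re (det X)"
    by (simp add: powr_add[symmetric])
  finally show ?thesis by simp
qed

lemma Re_det_sym_prod:
  assumes "psd n A" "psd n B" shows "Re (det (sym_prod A B)) = Re (det A) * Re (det B)"
  using Re_det_sandwich[OF assms(1,2) sym_prod_def] det_psd(2)[OF assms(2)] by simp

lemma pd_det_pos:
  assumes "pd n A" shows "0 < Re (det A)"
proof -
  obtain U d where "unitary_mat n U" "A = spectral n U d" "\<And>i. i < n \<Longrightarrow> 0 < d i" using pd_spectral[OF assms] by metis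
  thus ?thesis by (auto simp: det_spectral simp del: of_real_prod intro!: prod_pos)
qed

lemma Re_det_pd_geom_mean:
  assumes A: "pd n A" and B: "pd n B"
  shows "Re (det (pd_geom_mean t A B)) = Re (det A) powr (1 - t) * Re (det B) powr t"
proof -
  let ?C = "mat_powr A (-1/2) * B * mat_powr A (-1/2)"
  have C: "pd n ?C" by (rule powr_congr_pd[OF A B])
  have a: "0 < Re (det A)" and b: "0 < Re (det B)" using pd_det_pos A B by auto
  have "Re (det ?C) = Re (det A) powr (- 1) * Re (det B)"
    using Re_det_sandwich[OF pd_psd[OF B] pd_psd[OF A] refl, of "-1/2"] by simp
  moreover have "Re (det (pd_geom_mean t A B)) = Re (det A) powr (2 * (1/2)) * Re (det ?C) powr t"
    unfolding pd_geom_mean_def Re_det_sandwich[OF powr_psd[OF pd_herm[OF C]] pd_psd[OF A] refl] Re_det_powr[OF pd_psd[OF C]] ..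
  ultimately have "Re (det (pd_geom_mean t A B)) = Re (det A) powr 1 * (Re (det A) powr (- 1) * Re (det B)) powr t"
    by simp
  also have "\<dots> = Re (det A) powr 1 * (Re (det A) powr (- t) * Re (det B) powr t)"
  proof -
    have "(Re (det A) powr (- 1) * Re (det B)) powr t = (Re (det A) powr (- 1)) powr t * Re (det B) powr t"
      by (rule powr_mult)
    also have "(Re (det A) powr (- 1)) powr t = Re (det A) powr (- t)" unfolding powr_powr by simp
    finally show ?thesis by simp
  qed
  also have "\<dots> = Re (det A) powr (1 + - t) * Re (det B) powr t"
    unfolding powr_add by simp
  finally show ?thesis by simp
qed

section \<open>Log-majorization\<close>

lemma Re_det_geom_mean_powr:
  assumes A: "pd n A" and B: "pd n B"
  shows "Re (det (sym_prod (mat_powr (pd_geom_mean t A B) p) (mat_powr (pd_geom_mean (1 - t) A B) p)))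
      = Re (det (sym_prod A B)) powr p"
proof -
  note G = pd_geom_mean_pd[OF A B]
  have a: "0 < Re (det A)" and b: "0 < Re (det B)" using pd_det_pos A B by auto
  have "Re (det (sym_prod (mat_powr (pd_geom_mean t A B) p) (mat_powr (pd_geom_mean (1 - t) A B) p)))
      = Re (det (pd_geom_mean t A B)) powr p * Re (det (pd_geom_mean (1 - t) A B)) powr p"
    by (simp add: Re_det_sym_prod[OF powr_psd[OF pd_herm[OF G]] powr_psd[OF pd_herm[OF G]]] Re_det_powr[OF pd_psd[OF G]])
  also have "\<dots> = ((Re (det A) powr (1 - t) * Re (det A) powr t) * (Re (det B) powr t * Re (det B) powr (1 - t))) powr p"
    using a b by (simp add: Re_det_pd_geom_mean[OF A B] powr_mult mult_ac)
  also have "\<dots> = (Re (det A) * Re (det B)) powr p"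
    unfolding powr_add[symmetric] using a b by simp
  finally show ?thesis by (simp add: Re_det_sym_prod[OF pd_psd[OF A] pd_psd[OF B]])
qed

context
  fixes n :: nat and A B :: "complex mat" and t p :: real
  assumes A: "psd n A" and B: "psd n B" and t: "0 \<le> t" "t \<le> 1/2" and p: "0 < p" "p * (1 - 2 * t) \<le> 1"
begin

lemma psd_geom_mean_powr: "0 \<le> s \<Longrightarrow> s \<le> 1 \<Longrightarrow> psd n (mat_powr (geom_mean s A B) p)"
  by (intro powr_psd psd_herm[OF geom_mean_psd[OF A B]])

lemma mat_lim_sym_prod_shift: "mat_lim n (\<lambda>\<epsilon>. sym_prod (shift n A \<epsilon>) (shift n B \<epsilon>)) (sym_prod A B) (at_right 0)"
proof (rule mat_lim_sym_prod[OF mat_lim_shift[OF psd_carrier[OF A]] mat_lim_shift[OF psd_carrier[OF B]]])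
  show "\<forall>\<^sub>F e in at_right 0. psd n (shift n B e)"
    using eventually_pos by eventually_elim (intro pd_psd shift_pd B)
qed simp

lemma mat_lim_sym_prod_geom_mean:
  "mat_lim n (\<lambda>\<epsilon>. sym_prod (mat_powr (pd_geom_mean t (shift n A \<epsilon>) (shift n B \<epsilon>)) p)
       (mat_powr (pd_geom_mean (1 - t) (shift n A \<epsilon>) (shift n B \<epsilon>)) p))
     (sym_prod (mat_powr (geom_mean t A B) p) (mat_powr (geom_mean (1 - t) A B) p)) (at_right 0)"
proof -
  have ev: "\<forall>\<^sub>F e in at_right 0. psd n (pd_geom_mean s (shift n A e) (shift n B e))" for s
    using eventually_pos by eventually_elim (intro pd_psd pd_geom_mean_pd shift_pd A B)
  have ev': "\<forall>\<^sub>F e in at_right 0. psd n (mat_powr (pd_geom_mean s (shift n A e) (shift n B e)) p)" for s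
    using ev by eventually_elim (intro powr_psd psd_herm)
  have lim: "mat_lim n (\<lambda>\<epsilon>. mat_powr (pd_geom_mean s (shift n A \<epsilon>) (shift n B \<epsilon>)) p) (mat_powr (geom_mean s A B) p) (at_right 0)"
    if "0 \<le> s" "s \<le> 1" for s
    by (rule mat_lim_powr[OF geom_mean_limit[OF A B that] _ ev p(1)]) simp
  show ?thesis by (rule mat_lim_sym_prod[OF lim lim _ ev']) (use t in auto)
qed

text \<open>
The compound of the perturbed product is eventually at most \<open>c + \<eta>\<close>, so the bound for positive
definite matrices applies to the perturbed matrices with the constant \<open>c + \<eta>\<close>. First the
perturbation tends to 0, then \<open>\<eta>\<close>. The slack \<open>\<eta>\<close> also makes the constant positive when \<open>c = 0\<close>.
\<close>

lemma compound_norm_bound_psd: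
  assumes c: "0 \<le> c"
    and le: "loewner_le (compound_dim n k) (compound n k (sym_prod A B)) (complex_of_real c \<cdot>\<^sub>m 1\<^sub>m (compound_dim n k))"
  shows "loewner_le (compound_dim n k)
     (compound n k (sym_prod (mat_powr (geom_mean t A B) p) (mat_powr (geom_mean (1 - t) A B) p)))
     (complex_of_real (c powr p) \<cdot>\<^sub>m 1\<^sub>m (compound_dim n k))" (is "loewner_le ?N ?S' _")
proof -
  let ?I = "1\<^sub>m ?N :: complex mat"
  have bound: "loewner_le ?N ?S' (complex_of_real ((c + \<eta>) powr p) \<cdot>\<^sub>m ?I)" if \<eta>: "0 < \<eta>" for \<eta>
  proof (rule mat_lim_loewner_le[OF mat_lim_compound[OF mat_lim_sym_prod_geom_mean] mat_lim_const])
    have "\<forall>\<^sub>F e in at_right 0. \<forall>v\<in>carrier_vec ?N.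
        \<bar>qform (compound n k (sym_prod (shift n A e) (shift n B e))) v - qform (compound n k (sym_prod A B)) v\<bar> \<le> \<eta> * norm_sq v"
      by (rule mat_lim_eventually_close[OF mat_lim_compound[OF mat_lim_sym_prod_shift] \<eta>])
    with eventually_pos show "\<forall>\<^sub>F e in at_right 0. loewner_le ?N
       (compound n k (sym_prod (mat_powr (pd_geom_mean t (shift n A e) (shift n B e)) p)
       (mat_powr (pd_geom_mean (1 - t) (shift n A e) (shift n B e)) p)))
       (complex_of_real ((c + \<eta>) powr p) \<cdot>\<^sub>m ?I)"
    proof eventually_elim
      case (elim e)
      show ?case
      proof (rule compound_norm_bound[OF shift_pd[OF A elim(1)] shift_pd[OF B elim(1)] _ _ t _ p(2)])
        show "loewner_le ?N (compound n k (sym_prod (shift n A e) (shift n B e))) (complex_of_real (c + \<eta>) \<cdot>\<^sub>m ?I)"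
          unfolding loewner_le_def
        proof
          fix v :: "complex vec" assume v: "v \<in> carrier_vec ?N"
          have "qform (compound n k (sym_prod A B)) v \<le> c * norm_sq v"
            using le v by (simp add: loewner_le_def qform_smult[of _ ?N] qform_one_norm_sq)
          thus "qform (compound n k (sym_prod (shift n A e) (shift n B e))) v \<le> qform (complex_of_real (c + \<eta>) \<cdot>\<^sub>m ?I) v"
            using elim(2)[rule_format, OF v] v
            by (simp add: qform_smult[of _ ?N] qform_one_norm_sq distrib_right abs_le_iff del: of_real_add)
        qed
      qed (use c \<eta> p in auto)
    qed
  qed auto
  show ?thesis
    unfolding loewner_le_def
  proof
    fix v :: "complex vec" assume v: "v \<in> carrier_vec ?N"
    have "((\<lambda>\<eta>. (c + \<eta>) powr p * norm_sq v) \<longlongrightarrow> (c + 0) powr p * norm_sq v) (at_right 0)"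
    proof (intro tendsto_mult tendsto_const tendsto_powr')
      show "c + 0 \<noteq> 0 \<or> 0 < p \<and> (\<forall>\<^sub>F \<eta> in at_right 0. 0 \<le> c + \<eta>)"
        using p c by (auto intro: eventually_mono[OF eventually_pos])
      show "((\<lambda>\<eta>. c + \<eta>) \<longlongrightarrow> c + 0) (at_right 0)" by (intro tendsto_intros)
    qed
    hence "qform ?S' v \<le> (c + 0) powr p * norm_sq v"
    proof (rule tendsto_lowerbound)
      show "\<forall>\<^sub>F \<eta> in at_right 0. qform ?S' v \<le> (c + \<eta>) powr p * norm_sq v"
        using eventually_pos
      proof eventually_elim
        case (elim \<eta>)
        thus ?case using bound[OF elim] v by (simp add: loewner_le_def qform_smult[of _ ?N] qform_one_norm_sq)
      qed
    qed simp
    thus "qform ?S' v \<le> qform (complex_of_real (c powr p) \<cdot>\<^sub>m ?I) v"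
      using v by (simp add: qform_smult[of _ ?N] qform_one_norm_sq)
  qed
qed

lemma Re_det_geom_mean_psd:
  "Re (det (sym_prod (mat_powr (geom_mean t A B) p) (mat_powr (geom_mean (1 - t) A B) p))) = Re (det (sym_prod A B)) powr p"
proof -
  let ?S = "\<lambda>e. sym_prod (shift n A e) (shift n B e)"
  have "\<forall>\<^sub>F e in at_right 0. Re (det (?S e)) powr p
     = Re (det (sym_prod (mat_powr (pd_geom_mean t (shift n A e) (shift n B e)) p)
         (mat_powr (pd_geom_mean (1 - t) (shift n A e) (shift n B e)) p)))"
    using eventually_pos by eventually_elim (simp add: Re_det_geom_mean_powr[OF shift_pd[OF A] shift_pd[OF B]])
  moreover have "((\<lambda>e. Re (det (?S e)) powr p) \<longlongrightarrow> Re (det (sym_prod A B)) powr p) (at_right 0)"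
  proof (rule tendsto_powr'[OF _ tendsto_const])
    show "((\<lambda>e. Re (det (?S e))) \<longlongrightarrow> Re (det (sym_prod A B))) (at_right 0)"
      by (intro tendsto_Re tendsto_det[OF mat_lim_sym_prod_shift])
    have "\<forall>\<^sub>F e in at_right 0. 0 \<le> Re (det (?S e))"
      using eventually_pos by eventually_elim (intro det_psd(2)[of n] sym_prod_psd pd_psd shift_pd A B)
    thus "Re (det (sym_prod A B)) \<noteq> 0 \<or> 0 < p \<and> (\<forall>\<^sub>F e in at_right 0. 0 \<le> Re (det (?S e)))" using p by simp
  qed
  ultimately have "((\<lambda>e. Re (det (sym_prod (mat_powr (pd_geom_mean t (shift n A e) (shift n B e)) p)
         (mat_powr (pd_geom_mean (1 - t) (shift n A e) (shift n B e)) p)))) \<longlongrightarrow> Re (det (sym_prod A B)) powr p) (at_right 0)"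
    by (rule Lim_transform_eventually[rotated])
  moreover have "((\<lambda>e. Re (det (sym_prod (mat_powr (pd_geom_mean t (shift n A e) (shift n B e)) p)
         (mat_powr (pd_geom_mean (1 - t) (shift n A e) (shift n B e)) p)))) \<longlongrightarrow>
       Re (det (sym_prod (mat_powr (geom_mean t A B) p) (mat_powr (geom_mean (1 - t) A B) p)))) (at_right 0)"
    by (intro tendsto_Re tendsto_det[OF mat_lim_sym_prod_geom_mean])
  ultimately show ?thesis using tendsto_unique[OF trivial_limit_at_right_real] by blast
qed

text \<open>
The matrix \<open>X\<close> may be either of the two products \<open>P Q\<close> and \<open>Q P\<close>, which have the same
characteristic polynomial.
\<close>

lemma geom_mean_log_majorized:
  assumes X: "char_poly X = char_poly (mat_powr (geom_mean t A B) p * mat_powr (geom_mean (1 - t) A B) p)"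
  shows "eigvals_desc X \<prec>\<^sub>l\<^sub>o\<^sub>g map (\<lambda>x. x powr p) (eigvals_desc (A * B))"
proof -
  let ?P = "mat_powr (geom_mean t A B) p" and ?Q = "mat_powr (geom_mean (1 - t) A B) p"
  have P: "psd n ?P" and Q: "psd n ?Q" using psd_geom_mean_powr t by auto
  obtain U d where U: "unitary_mat n U" and S: "sym_prod A B = spectral n U d"
    and d: "\<And>i j. i \<le> j \<Longrightarrow> j < n \<Longrightarrow> d j \<le> d i" "\<And>i. i < n \<Longrightarrow> 0 \<le> d i"
    using psd_spectral[OF sym_prod_psd[OF A B]] by metis
  obtain V e where V: "unitary_mat n V" and S': "sym_prod ?P ?Q = spectral n V e"
    and e: "\<And>i j. i \<le> j \<Longrightarrow> j < n \<Longrightarrow> e j \<le> e i" "\<And>i. i < n \<Longrightarrow> 0 \<le> e i"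
    using psd_spectral[OF sym_prod_psd[OF P Q]] by metis
  have eigAB: "eigvals_desc (A * B) = map d [0..<n]"
    by (rule eigvals_desc_spectral[OF U d(1)]) (simp_all add: char_poly_sym_prod[OF A B] S)
  have eigX: "eigvals_desc X = map e [0..<n]"
    by (rule eigvals_desc_spectral[OF V e(1)]) (simp_all add: X char_poly_sym_prod[OF P Q] S')
  have le: "(\<Prod>i<k. e i) \<le> (\<Prod>i<k. d i powr p)" if k: "k \<le> n" for k
  proof -
    have nn: "0 \<le> (\<Prod>i<k. d i)" using d(2) k by (intro prod_nonneg) auto
    have "loewner_le (compound_dim n k) (compound n k (sym_prod A B)) (complex_of_real (\<Prod>i<k. d i) \<cdot>\<^sub>m 1\<^sub>m (compound_dim n k))"
      unfolding S by (subst compound_le_iff[OF U _ _ k]) (use d in auto)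
    from compound_norm_bound_psd[OF nn this] have "(\<Prod>i<k. e i) \<le> (\<Prod>i<k. d i) powr p"
      unfolding S' by (subst (asm) compound_le_iff[OF V _ _ k]) (use e in auto)
    also have "\<dots> = (\<Prod>i<k. d i powr p)" using d(2) k by (intro prod_powr_nonneg[symmetric]) auto
    finally show ?thesis .
  qed
  have "(\<Prod>i<n. e i) = (\<Prod>i<n. d i) powr p"
    using Re_det_geom_mean_psd unfolding S S' det_spectral[OF U] det_spectral[OF V] by (simp del: of_real_prod)
  also have "\<dots> = (\<Prod>i<n. d i powr p)" using d(2) by (intro prod_powr_nonneg[symmetric]) auto
  finally have eq: "(\<Prod>i<n. e i) = (\<Prod>i<n. d i powr p)" .
  have "(\<Prod>i<k. map e [0..<n] ! i) \<le> (\<Prod>i<k. map (\<lambda>x. x powr p) (map d [0..<n]) ! i)" if "k < n" for k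
    using le[of k] that by simp
  thus ?thesis unfolding log_majorized_def eigAB eigX using eq by simp
qed

end

theorem theorem2p2:
  fixes A B :: "complex mat" and n :: nat and p t :: real
  assumes "A \<in> carrier_mat n n" and "B \<in> carrier_mat n n"
    and "psd_mat A" and "psd_mat B"
    and "p \<ge> 2"
    and "(p - 1) / (2 * p) \<le> t" and "t \<le> (p + 1) / (2 * p)"
  shows "eigvals_desc (mat_powr (geom_mean t A B) p * mat_powr (geom_mean (1 - t) A B) p)
           \<prec>\<^sub>l\<^sub>o\<^sub>g map (\<lambda>x. x powr p) (eigvals_desc (A * B))"
proof -
  have A: "psd n A" and B: "psd n B"
    using assms(1-4) by (simp_all add: psd_def herm_def psd_mat_iff[of _ n])
  have p: "0 < p" using assms(5) by simp
  have t: "p - 1 \<le> 2 * p * t" "2 * p * t \<le> p + 1"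
    using assms(6,7) p by (simp_all add: field_simps)
  have t01: "0 \<le> t" "t \<le> 1"
  proof -
    have "0 \<le> (p - 1) / (2 * p)" "(p + 1) / (2 * p) \<le> 1" using assms(5) by (simp_all add: field_simps)
    thus "0 \<le> t" "t \<le> 1" using assms(6,7) by linarith+
  qed
  show ?thesis
  proof (cases "t \<le> 1/2")
    case True
    have "p * (1 - 2 * t) \<le> 1" using t(1) by (simp add: algebra_simps)
    from geom_mean_log_majorized[OF A B t01(1) True p this refl] show ?thesis .
  next
    case False
    have "p * (1 - 2 * (1 - t)) \<le> 1" using t(2) by (simp add: algebra_simps)
    moreover have "char_poly (mat_powr (geom_mean t A B) p * mat_powr (geom_mean (1 - t) A B) p)
        = char_poly (mat_powr (geom_mean (1 - t) A B) p * mat_powr (geom_mean (1 - (1 - t)) A B) p)"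
      using char_poly_mult_commute[OF powr_carrier[OF psd_herm[OF geom_mean_psd[OF A B t01]]]
          powr_carrier[OF psd_herm[OF geom_mean_psd[OF A B, of "1 - t"]]]] t01 by simp
    ultimately show ?thesis
      using geom_mean_log_majorized[OF A B, of "1 - t" p] t01 False p by simp
  qed
qed

end
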